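(* Let $d\ge 1$, let $\delta=(1\ 2\ \cdots\ d)\in\mathrm{Sym}_d$, and let $\psi\colon\mathrm{Sym}_d\to\Pi(d)$ send a permutation to the partition of $\{1,\dots,d\}$ into its orbits. Define $\Psi\colon\mathrm{Mult}(\mathrm{Sym}_d,\mathbf S)\to\Pi_d(\mathbf S)$ by sending the $\mathrm{Sym}_d$-multiset $0^{x_L}s_1^{x_1}\cdots s_k^{x_k}1^{1}$ to the partition $0^{\psi(x_L)}s_1^{\psi(x_1)}\cdots s_k^{\psi(x_k)}$. Then $\Psi$ restricts to a poset isomorphism from $\mathcal F(\mathrm{Sym}_d,\delta,\mathbf S)$ onto the poset $\mathrm{NC}_d(\mathbf S)$ of degree-$d$ noncrossing partitions of the unit circle.
   Context: Group-theoretic setup: $G=\mathrm{Sym}_d$ with generating set $X=T$, the set of all transpositions (closed under conjugation). For $h\in G$, $\ell(h)$ is the minimal number of transpositions whose product is $h$. For $h,g\in G$ write $h\le g$ if $\ell(h)+\ell(h^{-1}g)=\ell(g)$; $[1,g]=\{h:h\le g\}$. A linear factorization of $h\in G$ is a row vector $[x_L\ x_1\ \cdots\ x_k\ x_R]$ ($k\ge0$) of elements of $G$ with $x_1,\dots,x_k\ne 1$ ($x_L,x_R$ may be trivial), $\ell(x_L)+\ell(x_1)+\cdots+\ell(x_k)+\ell(x_R)=\ell(h)$, and $x_Lx_1\cdots x_kx_R=h$. A $G$-multiset on a set $S$ is a function $S\to G$ that is the identity at all but finitely many points; $\mathrm{Mult}(G,S)$ denotes the set of these. A weighted linear factorization of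 $h$ is a $G$-multiset $\mathbf u$ on $\mathbf I=[0,1]$ such that, if $0<s_1<\cdots<s_k<1$ are the points of $(0,1)$ where $\mathbf u$ is nontrivial, then $[\mathbf u(0)\ \mathbf u(s_1)\cdots\mathbf u(s_k)\ \mathbf u(1)]$ is a linear factorization of $h$; it is written $0^{x_L}s_1^{x_1}\cdots s_k^{x_k}1^{x_R}$ with $x_L=\mathbf u(0)$, $x_i=\mathbf u(s_i)$, $x_R=\mathbf u(1)$. Let $\mathcal F(G,g,\mathbf I)$ be the set of all weighted linear factorizations of all $h\in[1,g]$, ordered by $\mathbf v\subseteq\mathbf u$ iff $\mathbf v(r)\le\mathbf u(r)$ for all $r\in\mathbf I$. Two elements $0^{x_L}s_1^{x_1}\cdots s_k^{x_k}1^{x_R}$ and $0^{y_L}s_1^{y_1}\cdots s_k^{y_k}1^{y_R}$ of $\mathcal F(G,g,\mathbf I)$ (same points $s_i$) are equivalent if $x_i=y_i$ for all $1\le i\le k$ and $gx_Rg^{-1}x_L=gy_Rg^{-1}y_L$. The set of equivalence classes is $\mathcal F(G,g,\mathbf S)$, with the order $[\mathbf v]\le[\mathbf u]$ iff $\mathbf v'\subseteq\mathbf u'$ for some representatives. Each class has a unique representative of the form $0^{z_L}s_1^{z_1}\cdots s_k^{z_k}1^1$, which is regarded as a $G$-multiset on the unit circle $\mathbf S\subset\mathbb C$ via $s\mapsto e^{2\pi i s}$ (so $0$ and $1$ are identified); this is how $\mathcal F(\mathrm{Sym}_d,\delta,\mathbf S)\subseteq\mathrm{Mult}(\mathrm{Sym}_d,\mathbf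 S)$. Partitions: $\Pi(P)$ is the set of partitions of a set $P$ ordered by refinement. A partition of a subset of $\mathbb C$ is noncrossing if the convex hulls of its blocks are pairwise disjoint. A partition $\pi$ of $\mathbf S$ is a degree-$d$ partition if $z^d=w^d$ whenever $z,w$ lie in the same block; $\Pi_d(\mathbf S)$ is the set of these and $\mathrm{NC}_d(\mathbf S)$ the subposet of noncrossing ones. Notation: given $0\le s_1<\dots<s_k<1$ (with $s_L=0$) and partitions $\pi_L,\pi_1,\dots,\pi_k$ of $\{1,\dots,d\}$, the partition $0^{\pi_L}s_1^{\pi_1}\cdots s_k^{\pi_k}$ of $\mathbf S$ is obtained by identifying, for each $j$, the $d$ preimages of $e^{2\pi i s_j}$ under $z\mapsto z^d$ with $\{1,\dots,d\}$ in increasing order of argument in $[0,2\pi)$, taking the blocks of $\pi_j$ on these preimages, and letting all other points of $\mathbf S$ be singletons. *)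

theory Defs
  imports "HOL-Analysis.Analysis" "HOL-Combinatorics.Permutations" "HOL-Combinatorics.Transposition"
begin

type_synonym perm = "nat \<Rightarrow> nat"

text \<open>The symmetric group Sym_d, as permutations of {1..d} (composition is function
composition; products are read right-to-left as functions).\<close>
definition Sym :: "nat \<Rightarrow> perm set" where
  "Sym d = {p. p permutes {1..d}}"

definition transps :: "nat \<Rightarrow> perm set" where
  "transps d = {Transposition.transpose a b | a b. a \<in> {1..d} \<and> b \<in> {1..d} \<and> a \<noteq> b}"

definition tlen :: "nat \<Rightarrow> perm \<Rightarrow> nat" where
  "tlen d h = (LEAST n. \<exists>ts. length ts = n \<and> set ts \<subseteq> transps d \<and> foldr (\<circ>) ts id = h)"

definition tle :: "nat \<Rightarrow> perm \<Rightarrow> perm \<Rightarrow> bool" where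
  "tle d h g \<longleftrightarrow> tlen d h + tlen d (inv h \<circ> g) = tlen d g"

definition interval :: "nat \<Rightarrow> perm \<Rightarrow> perm set" where
  "interval d g = {h \<in> Sym d. tle d h g}"

definition multI :: "nat \<Rightarrow> (real \<Rightarrow> perm) set" where
  "multI d = {u. (\<forall>r. u r \<in> Sym d) \<and> (\<forall>r. r \<notin> {0..1} \<longrightarrow> u r = id)
                 \<and> finite {r. u r \<noteq> id}}"

definition interior_pts :: "(real \<Rightarrow> perm) \<Rightarrow> real list" where
  "interior_pts u = sorted_list_of_set {r \<in> {0<..<1}. u r \<noteq> id}"

definition wlf :: "nat \<Rightarrow> (real \<Rightarrow> perm) \<Rightarrow> perm \<Rightarrow> bool" where
  "wlf d u h \<longleftrightarrow> u \<in> multI d \<and>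
     tlen d (u 0) + (\<Sum>s\<leftarrow>interior_pts u. tlen d (u s)) + tlen d (u 1) = tlen d h \<and>
     u 0 \<circ> foldr (\<circ>) (map u (interior_pts u)) id \<circ> u 1 = h"

definition FI :: "nat \<Rightarrow> perm \<Rightarrow> (real \<Rightarrow> perm) set" where
  "FI d g = {u. \<exists>h \<in> interval d g. wlf d u h}"

definition sub_le :: "nat \<Rightarrow> (real \<Rightarrow> perm) \<Rightarrow> (real \<Rightarrow> perm) \<Rightarrow> bool" where
  "sub_le d v u \<longleftrightarrow> (\<forall>r \<in> {0..1}. tle d (v r) (u r))"

definition fequiv :: "perm \<Rightarrow> (real \<Rightarrow> perm) \<Rightarrow> (real \<Rightarrow> perm) \<Rightarrow> bool" where
  "fequiv g v u \<longleftrightarrow> (\<forall>r \<in> {0<..<1}. v r = u r) \<and>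
     g \<circ> v 1 \<circ> inv g \<circ> v 0 = g \<circ> u 1 \<circ> inv g \<circ> u 0"

definition circ_param :: "complex \<Rightarrow> real" where
  "circ_param z = (SOME t. 0 \<le> t \<and> t < 1 \<and> z = cis (2 * pi * t))"

text \<open>Transport of a representative (with x_R = 1) to a multiset on the circle S.\<close>
definition to_circle :: "(real \<Rightarrow> perm) \<Rightarrow> complex \<Rightarrow> perm" where
  "to_circle u z = (if z \<in> sphere 0 1 then u (circ_param z) else id)"

definition FS :: "nat \<Rightarrow> perm \<Rightarrow> (complex \<Rightarrow> perm) set" where
  "FS d g = {to_circle u | u. u \<in> FI d g \<and> u 1 = id}"

text \<open>Order on classes: [v] <= [u] iff v' \<subseteq> u' for some representatives.\<close>
definition FS_le :: "nat \<Rightarrow> perm \<Rightarrow> (complex \<Rightarrow> perm) \<Rightarrow> (complex \<Rightarrow> perm) \<Rightarrow> bool" where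
  "FS_le d g m m' \<longleftrightarrow> (\<exists>v0 u0 v' u'. v0 \<in> FI d g \<and> v0 1 = id \<and> to_circle v0 = m \<and>
      u0 \<in> FI d g \<and> u0 1 = id \<and> to_circle u0 = m' \<and>
      v' \<in> FI d g \<and> u' \<in> FI d g \<and> fequiv g v' v0 \<and> fequiv g u' u0 \<and> sub_le d v' u')"

definition is_partition :: "'a set set \<Rightarrow> 'a set \<Rightarrow> bool" where
  "is_partition P X \<longleftrightarrow> (\<forall>B\<in>P. B \<noteq> {} \<and> B \<subseteq> X) \<and> \<Union>P = X \<and>
     (\<forall>B\<in>P. \<forall>C\<in>P. B \<noteq> C \<longrightarrow> B \<inter> C = {})"

definition refines :: "'a set set \<Rightarrow> 'a set set \<Rightarrow> bool" where
  "refines P Q \<longleftrightarrow> (\<forall>B\<in>P. \<exists>C\<in>Q. B \<subseteq> C)"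

definition Pi_d :: "nat \<Rightarrow> complex set set set" where
  "Pi_d d = {P. is_partition P (sphere 0 1) \<and> (\<forall>B\<in>P. \<forall>z\<in>B. \<forall>w\<in>B. z ^ d = w ^ d)}"

definition NC_d :: "nat \<Rightarrow> complex set set set" where
  "NC_d d = {P \<in> Pi_d d. \<forall>B\<in>P. \<forall>C\<in>P. B \<noteq> C \<longrightarrow> convex hull B \<inter> convex hull C = {}}"

definition psi :: "nat \<Rightarrow> perm \<Rightarrow> nat set set" where
  "psi d p = (\<lambda>i. {(p ^^ n) i | n. True}) ` {1..d}"

text \<open>The j-th (j = 1..d) preimage of z under w -> w^d, in increasing argument in [0, 2 pi).\<close>
definition root_label :: "nat \<Rightarrow> complex \<Rightarrow> nat \<Rightarrow> complex" where
  "root_label d z j = cis (2 * pi * (circ_param z + real j - 1) / real d)"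

definition Psi :: "nat \<Rightarrow> (complex \<Rightarrow> perm) \<Rightarrow> complex set set" where
  "Psi d m = (\<Union>z \<in> sphere 0 1. (\<lambda>B. root_label d z ` B) ` psi d (m z))"

definition long_cycle :: "nat \<Rightarrow> perm" where
  "long_cycle d = (\<lambda>i. if 1 \<le> i \<and> i < d then i + 1 else if i = d then 1 else i)"

end

(*
  All reflection lengths are turned into orbit counts: l(p) = d - #orbits(p).  A factorization
  x_0 x_1 ... x_k of h, with x_i placed at s_i, is encoded as one permutation X of the d(k+1)
  preimages of the points s_i on the circle.  If c is the cyclic successor on these preimages,
  then X^-1 c has as many orbits as h^-1 delta, because the latter is the first return map of the
  former to one level.  Hence the condition l(x_0) + ... + l(x_k) + l(h^-1 delta) = d - 1 says
  exactly that #orbits(X) + #orbits(X^-1 c) = d(k+1) + 1, and by Biane's theorem this holds iff X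
  is the cyclic successor permutation of a noncrossing partition.  Convex hulls of finite subsets
  of the circle are disjoint iff the subsets do not cross.
*)
theory Submission
  imports Defs
begin

section \<open>Orbits of finite permutations\<close>

text \<open>Biane's theorem is proved by cutting: at an ascent a < X(a) = b, multiplying X by the
  transposition of a and b isolates a in X and at the same time cuts the cycle c into the arc [a, b)
  and its complement, so that X and X^-1 c split together. The splitting is forced by the equality
  case of the triangle inequality for orbit counts. The same equality case governs the order: in a
  length-additive product both factors move points only inside the cycles of the product. Two
  obstacles remain. A partition in NC_d(S) is not assumed to have finitely many nontrivial blocks;
  this follows because every level with a nontrivial permutation uses up at least one of the d - 1
  available units of length, so d such levels cannot coexist. And the order on classes is witnessed
  by representatives with nontrivial x_R; absorbing x_R into the value at 0, conjugated by delta,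
  keeps lengths additive and hence respects refinement. In the other direction the normal forms
  themselves serve as representatives.\<close>

abbreviation transp :: "'a \<Rightarrow> 'a \<Rightarrow> 'a \<Rightarrow> 'a" where
  "transp \<equiv> Transposition.transpose"

text \<open>Only forward iterates are taken; for a bijection of a finite set they already fill the
  whole cycle (\<open>orb_eq\<close>). The blocks of \<open>psi\<close> are sets of exactly this
  form.\<close>

definition orb :: "('a \<Rightarrow> 'a) \<Rightarrow> 'a \<Rightarrow> 'a set" where
  "orb f x = {(f ^^ n) x | n. True}"

definition orbs :: "'a set \<Rightarrow> ('a \<Rightarrow> 'a) \<Rightarrow> 'a set set" where
  "orbs A f = orb f ` A"

definition num_orbs :: "'a set \<Rightarrow> ('a \<Rightarrow> 'a) \<Rightarrow> nat" where
  "num_orbs A f = card (orbs A f)"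

lemma orb_refl [simp]: "x \<in> orb f x"
  unfolding orb_def by (auto intro: exI[of _ 0])

lemma orb_step: "y \<in> orb f x \<Longrightarrow> f y \<in> orb f x"
  unfolding orb_def by (auto intro: exI[of _ "Suc n" for n])

lemma orb_least:
  assumes "x \<in> S" "\<And>y. y \<in> S \<Longrightarrow> f y \<in> S"
  shows "orb f x \<subseteq> S"
proof -
  have "(f ^^ n) x \<in> S" for n
    by (induction n) (auto intro: assms)
  then show ?thesis unfolding orb_def by auto
qed

lemma orb_mono: "y \<in> orb f x \<Longrightarrow> orb f y \<subseteq> orb f x"
  by (rule orb_least) (auto intro: orb_step)

lemma orb_subset: "bij_betw f A A \<Longrightarrow> x \<in> A \<Longrightarrow> orb f x \<subseteq> A"
  by (rule orb_least) (auto simp: bij_betw_def)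

lemma orb_cong:
  assumes "x \<in> S" "\<And>y. y \<in> S \<Longrightarrow> f y \<in> S" "\<And>y. y \<in> S \<Longrightarrow> f y = g y"
  shows "orb f x = orb g x"
proof -
  have "(f ^^ n) x = (g ^^ n) x \<and> (f ^^ n) x \<in> S" for n
    by (induction n) (use assms in auto)
  then show ?thesis unfolding orb_def by auto
qed

lemma orb_fixed: "f x = x \<Longrightarrow> orb f x = {x}"
proof -
  assume "f x = x"
  then have "orb f x \<subseteq> {x}" by (intro orb_least) auto
  then show ?thesis using orb_refl[of x f] by blast
qed

text \<open>A forward orbit inside a finite set is mapped injectively, hence onto itself. So no step
  leads into \<open>orb f y\<close> from outside, and a point from which \<open>y\<close> can be
  reached already lies in it.\<close>

lemma orb_eq:
  assumes "finite A" "bij_betw f A A" "x \<in> A" "y \<in> orb f x"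
  shows "orb f y = orb f x"
proof
  show sub: "orb f y \<subseteq> orb f x" by (rule orb_mono) fact
  have inA: "orb f x \<subseteq> A" by (rule orb_subset[OF assms(2,3)])
  have inj: "inj_on f A" using assms by (auto simp: bij_betw_def)
  have fin: "finite (orb f y)" by (rule finite_subset[OF subset_trans[OF sub inA] assms(1)])
  have img: "f ` orb f y = orb f y"
  proof (rule card_subset_eq[OF fin])
    show "f ` orb f y \<subseteq> orb f y" by (auto intro: orb_step)
    show "card (f ` orb f y) = card (orb f y)"
      by (rule card_image) (rule inj_on_subset[OF inj subset_trans[OF sub inA]])
  qed
  have "x \<in> orb f y"
  proof (rule ccontr)
    assume x: "x \<notin> orb f y"
    have "orb f x \<subseteq> orb f x - orb f y"
    proof (rule orb_least)
      fix z assume z: "z \<in> orb f x - orb f y"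
      have "f z \<notin> orb f y"
      proof
        assume "f z \<in> orb f y"
        then obtain w where w: "w \<in> orb f y" "f w = f z" using img by (metis imageE)
        then have "w = z" using inj sub inA z by (metis DiffD1 inj_onD subsetD)
        then show False using w z by auto
      qed
      then show "f z \<in> orb f x - orb f y" using z by (auto intro: orb_step)
    qed (use x in auto)
    then show False using assms(4) by auto
  qed
  then show "orb f x \<subseteq> orb f y" by (rule orb_mono)
qed

lemma orb_sym:
  assumes "finite A" "bij_betw f A A" "x \<in> A" "y \<in> orb f x"
  shows "x \<in> orb f y"
  using orb_eq[OF assms] by simp

lemma finite_orbs [simp]: "finite A \<Longrightarrow> finite (orbs A f)"
  by (simp add: orbs_def)

section \<open>Counting orbits\<close>

lemma num_orbs_cong:
  assumes "\<And>x. x \<in> A \<Longrightarrow> f x \<in> A" "\<And>x. x \<in> A \<Longrightarrow> f x = g x"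
  shows "num_orbs A f = num_orbs A g"
proof -
  have "orb f x = orb g x" if "x \<in> A" for x
    by (rule orb_cong[of _ A]) (use assms that in auto)
  then show ?thesis by (simp add: num_orbs_def orbs_def)
qed

lemma num_orbs_id:
  assumes "\<And>x. x \<in> A \<Longrightarrow> f x = x"
  shows "num_orbs A f = card A"
proof -
  have "orbs A f = (\<lambda>x. {x}) ` A" using assms by (auto simp: orbs_def orb_fixed image_iff)
  then show ?thesis by (simp add: num_orbs_def card_image)
qed

lemma num_orbs_Union:
  assumes "finite I" "\<And>i. i \<in> I \<Longrightarrow> finite (A i)" "\<And>i. i \<in> I \<Longrightarrow> bij_betw f (A i) (A i)"
    "\<And>i j. i \<in> I \<Longrightarrow> j \<in> I \<Longrightarrow> i \<noteq> j \<Longrightarrow> A i \<inter> A j = {}"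
  shows "num_orbs (\<Union>i\<in>I. A i) f = (\<Sum>i\<in>I. num_orbs (A i) f)"
proof -
  have "orbs (\<Union>i\<in>I. A i) f = (\<Union>i\<in>I. orbs (A i) f)" by (auto simp: orbs_def)
  moreover have "card (\<Union>i\<in>I. orbs (A i) f) = (\<Sum>i\<in>I. card (orbs (A i) f))"
  proof (rule card_UN_disjoint)
    show "\<forall>i\<in>I. \<forall>j\<in>I. i \<noteq> j \<longrightarrow> orbs (A i) f \<inter> orbs (A j) f = {}"
    proof (intro ballI impI, rule ccontr)
      fix i j assume ij: "i \<in> I" "j \<in> I" "i \<noteq> j" "orbs (A i) f \<inter> orbs (A j) f \<noteq> {}"
      then obtain x y where "x \<in> A i" "y \<in> A j" "orb f x = orb f y" by (auto simp: orbs_def)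
      then have "x \<in> A i \<inter> A j" using orb_subset[OF assms(3)[OF ij(2)]] orb_refl[of x f] by blast
      then show False using assms(4) ij by auto
    qed
  qed (use assms in auto)
  ultimately show ?thesis by (simp add: num_orbs_def)
qed

lemma num_orbs_split:
  assumes "finite A" "bij_betw f A1 A1" "bij_betw f A2 A2" "A = A1 \<union> A2" "A1 \<inter> A2 = {}"
  shows "num_orbs A f = num_orbs A1 f + num_orbs A2 f"
proof -
  have "num_orbs (\<Union>i\<in>{True,False}. if i then A1 else A2) f
      = (\<Sum>i\<in>{True,False}. num_orbs (if i then A1 else A2) f)"
    by (rule num_orbs_Union) (use assms in auto)
  then show ?thesis using assms by (simp add: Un_commute)
qed

text \<open>Only two values change: \<open>a\<close> becomes fixed, and its former predecessor is
  sent past \<open>a\<close> to \<open>b\<close>. Thus \<open>a\<close> is cut out of its cycle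
  while the rest of that cycle stays together, which creates exactly one new orbit.\<close>

lemma orb_detach:
  assumes "finite A" "bij_betw f A A" "a \<in> A" "f a = b" "b \<noteq> a"
  defines "g \<equiv> transp a b \<circ> f"
  shows "g a = a" "bij_betw g A A" "\<And>x. x \<in> A \<Longrightarrow> x \<noteq> a \<Longrightarrow> orb g x = orb f x - {a}"
    "num_orbs A g = num_orbs A f + 1"
proof -
  show ga: "g a = a" using assms(1-5) by (simp add: g_def)
  have bA: "b \<in> A" using assms(1-5) by (auto simp: bij_betw_def)
  have "bij_betw (transp a b) A A"
    using assms(3) bA by (metis permutes_imp_bij permutes_swap_id)
  then show bij: "bij_betw g A A"
    unfolding g_def using assms(2) bij_betw_trans by blast
  have injf: "inj_on f A" using assms(1-5) by (auto simp: bij_betw_def)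
  have fA: "f x \<in> A" if "x \<in> A" for x using assms(1-5) that by (auto simp: bij_betw_def)
  have gA: "g x \<in> A" if "x \<in> A" for x using bij that by (auto simp: bij_betw_def)
  have gx: "g x = (if f x = a then b else f x)" if "x \<in> A" "x \<noteq> a" for x
  proof -
    have "f x \<noteq> b" using that injf assms(3,4) by (auto dest: inj_onD)
    then show ?thesis by (simp add: g_def Transposition.transpose_def)
  qed
  show o: "orb g x = orb f x - {a}" if x: "x \<in> A" "x \<noteq> a" for x
  proof
    have sf: "orb f x \<subseteq> A" by (rule orb_subset[OF assms(2) x(1)])
    have sg: "orb g x \<subseteq> A" by (rule orb_subset[OF bij x(1)])
    show "orb g x \<subseteq> orb f x - {a}"
    proof (rule orb_least)
      fix y assume y: "y \<in> orb f x - {a}"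
      then have "g y = (if f y = a then b else f y)" using gx sf by auto
      moreover have "f y \<in> orb f x" using y orb_step by fastforce
      moreover have "b \<in> orb f x" if "f y = a"
        using that calculation(2) orb_step[of a f x] assms(4) by auto
      ultimately show "g y \<in> orb f x - {a}" using assms(5) by auto
    qed (use x in auto)
    have na: "a \<notin> orb g x"
    proof
      assume "a \<in> orb g x"
      then have "x \<in> orb g a" using orb_sym[OF assms(1) bij x(1)] by blast
      then show False using x orb_fixed[of g a] ga by auto
    qed
    have "orb f x \<subseteq> (if b \<in> orb g x then insert a (orb g x) else orb g x)"
    proof (rule orb_least)
      fix y assume y: "y \<in> (if b \<in> orb g x then insert a (orb g x) else orb g x)"
      show "f y \<in> (if b \<in> orb g x then insert a (orb g x) else orb g x)"
      proof (cases "y = a")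
        case True then show ?thesis using y na assms(1-5) by (auto split: if_splits)
      next
        case False
        then have yo: "y \<in> orb g x" using y by (auto split: if_splits)
        then have "g y \<in> orb g x" by (rule orb_step)
        moreover have "g y = (if f y = a then b else f y)" using gx sg yo False by auto
        ultimately show ?thesis by (auto split: if_splits)
      qed
    qed auto
    then show "orb f x - {a} \<subseteq> orb g x" by (auto split: if_splits)
  qed
  have eq: "orbs A g = insert {a} ((\<lambda>B. B - {a}) ` orbs A f)"
  proof -
    have 1: "orbs A g = insert {a} (orb g ` (A - {a}))"
      using assms(3) orb_fixed[of g a] ga unfolding orbs_def by auto
    have 2: "orb g ` (A - {a}) = (\<lambda>B. B - {a}) ` orb f ` (A - {a})"
      using o by (auto simp: image_image image_iff)
    have 3: "orb f ` (A - {a}) = orbs A f"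
    proof -
      have "orb f a = orb f b" using orb_eq[OF assms(1,2,3), of b] orb_step[of a f a] assms(4) by auto
      then have "orb f a \<in> orb f ` (A - {a})" using bA assms(5) by auto
      then show ?thesis unfolding orbs_def by auto
    qed
    show ?thesis using 1 2 3 by simp
  qed
  \<comment> \<open>The cycle of \<open>a\<close> also contains \<open>b\<close>, which differs from
    \<open>a\<close>, so deleting \<open>a\<close> leaves every orbit nonempty and the remainders
    still tell the orbits apart.\<close>
  have inj: "inj_on (\<lambda>B. B - {a}) (orbs A f)"
  proof (rule inj_onI)
    fix B C assume B: "B \<in> orbs A f" and C: "C \<in> orbs A f" and e: "B - {a} = C - {a}"
    obtain x y where xy: "x \<in> A" "y \<in> A" "B = orb f x" "C = orb f y" using B C by (auto simp: orbs_def)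
    have ex: "\<exists>z. z \<in> orb f x \<and> z \<noteq> a" for x
    proof (cases "x = a")
      case True then show ?thesis using orb_step[of a f a] assms(1-5) by auto
    next
      case False then show ?thesis by (intro exI[of _ x]) simp
    qed
    obtain z where "z \<in> B" "z \<noteq> a" using ex xy by auto
    then have "z \<in> orb f x" "z \<in> orb f y" using e xy by auto
    then show "B = C" using orb_eq[OF assms(1,2)] xy by metis
  qed
  have "{a} \<notin> (\<lambda>B. B - {a}) ` orbs A f" by auto
  then show "num_orbs A g = num_orbs A f + 1"
    unfolding num_orbs_def eq card_image[OF inj, symmetric] using assms(1) by simp
qed

lemma moved_detach:
  assumes "finite A" "bij_betw f A A" "a \<in> A" "f a = b" "b \<noteq> a"
  shows "{x \<in> A. (transp a b \<circ> f) x \<noteq> x} \<subset> {x \<in> A. f x \<noteq> x}"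
proof -
  have "f b \<noteq> b" using assms by (auto simp: bij_betw_def inj_on_def)
  then have "{x \<in> A. (transp a b \<circ> f) x \<noteq> x} \<subseteq> {x \<in> A. f x \<noteq> x} - {a}"
    using assms by (auto simp: Transposition.transpose_def split: if_splits)
  moreover have "a \<in> {x \<in> A. f x \<noteq> x}" using assms by auto
  ultimately show ?thesis by blast
qed

text \<open>The measure is the number of moved points: composing with the transposition of
  \<open>a\<close> and \<open>f a\<close> fixes \<open>a\<close> and moves no new point. Peeling off
  transpositions this way yields both the bound on labellings and words of minimal length.\<close>

lemma bij_induct [consumes 2, case_names fixed moved]:
  assumes "finite A" "bij_betw f A A"
    and "\<And>f. bij_betw f A A \<Longrightarrow> (\<And>x. x \<in> A \<Longrightarrow> f x = x) \<Longrightarrow> P f"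
    and "\<And>f a. bij_betw f A A \<Longrightarrow> a \<in> A \<Longrightarrow> f a \<noteq> a \<Longrightarrow> P (transp a (f a) \<circ> f) \<Longrightarrow> P f"
  shows "P f"
  using assms(2)
proof (induction "card {x \<in> A. f x \<noteq> x}" arbitrary: f rule: less_induct)
  case less
  show ?case
  proof (cases "\<forall>x\<in>A. f x = x")
    case True then show ?thesis using assms(3) less by blast
  next
    case False
    then obtain a where a: "a \<in> A" "f a \<noteq> a" by auto
    have "card {x \<in> A. (transp a (f a) \<circ> f) x \<noteq> x} < card {x \<in> A. f x \<noteq> x}"
      by (rule psubset_card_mono[OF _ moved_detach]) (use assms(1) less a in auto)
    then have "P (transp a (f a) \<circ> f)"
      using less.hyps orb_detach(2)[OF assms(1) less.prems a(1) refl a(2)] by blast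
    then show ?thesis using assms(4) less.prems a by blast
  qed
qed

text \<open>Making a labelling invariant under one more transposition merges at most two labels.\<close>

lemma ex_invariant_labelling:
  fixes g :: "'a \<Rightarrow> 'b"
  assumes "finite A" "bij_betw p A A"
  shows "\<exists>f :: 'a \<Rightarrow> 'b. (\<forall>x y. g x = g y \<longrightarrow> f x = f y) \<and> (\<forall>x\<in>A. f (p x) = f x) \<and>
    card (g ` A) + num_orbs A p \<le> card (f ` A) + card A"
  using assms
proof (induction rule: bij_induct)
  case (fixed p)
  then show ?case by (intro exI[of _ g]) (auto simp: num_orbs_id)
next
  case (moved p a)
  let ?b = "p a" and ?q = "transp a (p a) \<circ> p"
  obtain f :: "'a \<Rightarrow> 'b" where f: "\<And>x y. g x = g y \<Longrightarrow> f x = f y" "\<And>x. x \<in> A \<Longrightarrow> f (?q x) = f x"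
    "card (g ` A) + num_orbs A ?q \<le> card (f ` A) + card A"
    using moved.IH by blast
  \<comment> \<open>Merging the label of \<open>a\<close> into that of \<open>p a\<close> makes the
    labelling invariant under their transposition. Only the value \<open>f a\<close> can disappear,
    and this loss is paid for by the one orbit that \<open>p\<close> has fewer than
    \<open>?q\<close>.\<close>
  define h where "h x = (if f x = f a then f ?b else f x)" for x
  have ht: "h (transp a ?b x) = h x" for x
    by (auto simp: h_def Transposition.transpose_def)
  have inv: "h (p x) = h x" if "x \<in> A" for x
  proof -
    have inv: "h (p x) = h (transp a ?b (p x))" using ht by simp
    also have "\<dots> = h x" using f(2)[OF that] by (simp add: h_def)
    finally show ?thesis .
  qed
  have card: "card (f ` A) \<le> card (h ` A) + 1"
  proof -
    have "f ` A \<subseteq> insert (f a) (h ` A)" by (auto simp: h_def image_iff)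
    then have "card (f ` A) \<le> card (insert (f a) (h ` A))" using assms(1) by (intro card_mono) auto
    also have "\<dots> \<le> card (h ` A) + 1" by (simp add: card_insert_if assms(1))
    finally show ?thesis .
  qed
  have num: "num_orbs A ?q = num_orbs A p + 1"
    using orb_detach(4)[OF assms(1) moved(1,2) refl moved(3)] .
  have coarse: "h x = h y" if "g x = g y" for x y using f(1)[OF that] by (simp add: h_def)
  have "card (g ` A) + num_orbs A p \<le> card (h ` A) + card A"
    using f(3) card num by linarith
  then show ?case using coarse inv by blast
qed

lemma invariant_on_orb:
  assumes "\<And>x. x \<in> A \<Longrightarrow> f (p x) = f x" "bij_betw p A A" "x \<in> A" "y \<in> orb p x"
  shows "f y = f x"
proof -
  have "orb p x \<subseteq> {y \<in> A. f y = f x}"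
    by (rule orb_least) (use assms in \<open>auto simp: bij_betw_def\<close>)
  then show ?thesis using assms by auto
qed

text \<open>Starting from the labelling by \<open>id\<close>, invariance under \<open>X\<close> and
  then under \<open>Y\<close> costs at most \<open>card A - num_orbs A X\<close> and
  \<open>card A - num_orbs A Y\<close> labels. The result is constant on orbits of \<open>C\<close>,
  which bounds the number of surviving labels by \<open>num_orbs A C\<close>. In the case of
  equality distinct orbits of \<open>C\<close> carry distinct labels, so \<open>X\<close> and
  \<open>Y\<close>, which preserve labels, cannot leave an orbit of \<open>C\<close>.\<close>

lemma num_orbs_comp:
  assumes fin: "finite A" and X: "bij_betw X A A" and Y: "bij_betw Y A A"
    and C: "\<And>x. x \<in> A \<Longrightarrow> C x = X (Y x)"
  shows "num_orbs A X + num_orbs A Y \<le> num_orbs A C + card A"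
    and "num_orbs A X + num_orbs A Y = num_orbs A C + card A \<Longrightarrow> x \<in> A \<Longrightarrow>
          X x \<in> orb C x \<and> Y x \<in> orb C x"
proof -
  obtain f1 :: "'a \<Rightarrow> 'a" where f1: "\<And>x. x \<in> A \<Longrightarrow> f1 (X x) = f1 x"
    "card (id ` A) + num_orbs A X \<le> card (f1 ` A) + card A"
    using ex_invariant_labelling[OF fin X, of id] by blast
  obtain f :: "'a \<Rightarrow> 'a" where f: "\<And>x y. f1 x = f1 y \<Longrightarrow> f x = f y" "\<And>x. x \<in> A \<Longrightarrow> f (Y x) = f x"
    "card (f1 ` A) + num_orbs A Y \<le> card (f ` A) + card A"
    using ex_invariant_labelling[OF fin Y, of f1] by blast
  have fX: "f (X x) = f x" if "x \<in> A" for x using f1 f(1) that by blast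
  have le: "num_orbs A X + num_orbs A Y \<le> card (f ` A) + card A" using f(3) f1(2) by simp
  have YA: "Y x \<in> A" "X x \<in> A" if "x \<in> A" for x using X Y that by (auto simp: bij_betw_def)
  have bC: "bij_betw C A A"
  proof -
    have "bij_betw (X \<circ> Y) A A" using bij_betw_trans[OF Y X] .
    then show ?thesis using bij_betw_cong[of A C "X \<circ> Y" A] C by (simp add: comp_def)
  qed
  have fC: "f (C x) = f x" if "x \<in> A" for x by (simp add: C fX f(2) YA that)
  have fo: "f y = f x" if "x \<in> A" "y \<in> orb C x" for x y
    using invariant_on_orb[of A f C, OF fC bC that] .
  \<comment> \<open>The labelling is constant on each orbit of \<open>C\<close>, so its value at an
    arbitrarily chosen point gives a map from orbits onto labels.\<close>
  define F where "F B = f (SOME x. x \<in> B)" for B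
  have F: "F (orb C x) = f x" if "x \<in> A" for x
    unfolding F_def using fo[OF that] someI[of "\<lambda>y. y \<in> orb C x"] orb_refl[of x C] by metis
  have im: "F ` orbs A C = f ` A" using F by (force simp: orbs_def image_image)
  then have le2: "card (f ` A) \<le> num_orbs A C"
    unfolding num_orbs_def by (metis card_image_le fin finite_orbs)
  then show "num_orbs A X + num_orbs A Y \<le> num_orbs A C + card A" using le by simp
  assume "num_orbs A X + num_orbs A Y = num_orbs A C + card A" and x: "x \<in> A"
  then have "card (F ` orbs A C) = card (orbs A C)" using le le2 im by (simp add: num_orbs_def)
  then have inj: "inj_on F (orbs A C)" using eq_card_imp_inj_on fin finite_orbs by blast
  have "y \<in> orb C x" if "y \<in> A" "f y = f x" for y
  proof -
    have "F (orb C y) = F (orb C x)" using that x F by simp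
    then have "orb C y = orb C x" using inj that x by (auto simp: inj_on_def orbs_def)
    then show ?thesis using orb_refl[of y C] by simp
  qed
  then show "X x \<in> orb C x \<and> Y x \<in> orb C x" using YA[OF x] fX[OF x] f(2)[OF x] by blast
qed

section \<open>Cyclic successors and noncrossing permutations\<close>

definition nxt :: "'a::linorder set \<Rightarrow> 'a \<Rightarrow> 'a" where
  "nxt A x = (if x \<in> A then if \<exists>y\<in>A. x < y then Min {y \<in> A. x < y} else Min A else x)"

text \<open>The second alternative is the wrap-around: \<open>x\<close> is then the greatest element
  and \<open>y\<close> the least. It also covers a singleton, whose successor map is the
  identity.\<close>

lemma nxt_iff:
  assumes "finite A" "x \<in> A"
  shows "nxt A x = y \<longleftrightarrow> y \<in> A \<and> ((x < y \<and> (\<forall>z\<in>A. x < z \<longrightarrow> y \<le> z)) \<or> (\<forall>z\<in>A. y \<le> z \<and> z \<le> x))"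
proof (cases "\<exists>y\<in>A. x < y")
  case True
  then have "nxt A x = Min {y \<in> A. x < y}" using assms by (simp add: nxt_def)
  moreover have "Min {y \<in> A. x < y} = y \<longleftrightarrow> y \<in> {y \<in> A. x < y} \<and> (\<forall>z\<in>{y \<in> A. x < y}. y \<le> z)"
    by (rule Min_eq_iff) (use assms True in auto)
  moreover have "\<not> (\<forall>z\<in>A. y \<le> z \<and> z \<le> x)" using True by (meson leD)
  ultimately show ?thesis by auto
next
  case False
  then have "nxt A x = Min A" using assms by (simp add: nxt_def)
  moreover have "Min A = y \<longleftrightarrow> y \<in> A \<and> (\<forall>z\<in>A. y \<le> z)"
    by (rule Min_eq_iff) (use assms in auto)
  moreover have "z \<le> x" if "z \<in> A" for z using False that by auto
  moreover have "\<not> x < z" if "z \<in> A" for z using False that by auto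
  ultimately show ?thesis by metis
qed

lemma nxt_in: "finite A \<Longrightarrow> x \<in> A \<Longrightarrow> nxt A x \<in> A"
  using nxt_iff by blast

lemma nxt_inj:
  assumes "finite A" "x \<in> A" "y \<in> A" "nxt A x = nxt A y"
  shows "x = y"
proof (rule ccontr)
  have *: False if h: "x \<in> A" "y \<in> A" "nxt A x = nxt A y" "x < y" for x y
    using nxt_iff[OF assms(1) h(1), of "nxt A y"] nxt_iff[OF assms(1) h(2), of "nxt A y"] h
    by (metis leD order_less_le_trans)
  assume "x \<noteq> y"
  then show False using *[of x y] *[of y x] assms by (metis linorder_less_linear)
qed

lemma bij_nxt: "finite A \<Longrightarrow> bij_betw (nxt A) A A"
proof -
  assume fin: "finite A"
  have "inj_on (nxt A) A" using nxt_inj[OF fin] by (auto intro: inj_onI)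
  moreover have "nxt A ` A \<subseteq> A" using nxt_in[OF fin] by auto
  ultimately show ?thesis using endo_inj_surj[OF fin] by (auto simp: bij_betw_def)
qed

text \<open>The successor of the greatest point of the orbit stays in the orbit, so it must be a
  wrap-around and the orbit contains the least element of \<open>A\<close>. A least missing element
  would then be the successor of the greatest element below it, which is in the orbit.\<close>

lemma orb_nxt:
  assumes fin: "finite A" and x: "x \<in> A"
  shows "orb (nxt A) x = A"
proof -
  let ?O = "orb (nxt A) x"
  have sub: "?O \<subseteq> A" by (rule orb_subset[OF bij_nxt[OF fin] x])
  then have finO: "finite ?O" using fin by (rule finite_subset)
  have ne: "?O \<noteq> {}" using orb_refl[of x "nxt A"] by (metis empty_iff)
  have mO: "Max ?O \<in> ?O" using finO ne by simp
  have "nxt A (Max ?O) \<in> ?O" using mO by (rule orb_step)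
  moreover have "\<not> Max ?O < nxt A (Max ?O)" using calculation finO by (simp add: leD)
  ultimately have low: "\<forall>z\<in>A. nxt A (Max ?O) \<le> z" and lowO: "nxt A (Max ?O) \<in> ?O"
    using nxt_iff[OF fin, of "Max ?O" "nxt A (Max ?O)"] mO sub by auto
  have "y \<in> ?O" if "y \<in> A" for y
  proof (rule ccontr)
    assume y: "y \<notin> ?O"
    define w where "w = Min (A - ?O)"
    have w: "w \<in> A" "w \<notin> ?O" "\<And>z. z \<in> A \<Longrightarrow> z < w \<Longrightarrow> z \<in> ?O"
    proof -
      have "A - ?O \<noteq> {}" using y that by auto
      then have "w \<in> A - ?O" unfolding w_def using fin by (intro Min_in) auto
      then show "w \<in> A" "w \<notin> ?O" by auto
      fix z assume "z \<in> A" "z < w"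
      then show "z \<in> ?O" unfolding w_def using fin by (meson DiffI Min_le finite_Diff leD)
    qed
    define B where "B = {z \<in> A. z < w}"
    have "nxt A (Max ?O) \<noteq> w" using lowO w by auto
    then have "nxt A (Max ?O) \<in> B" using low w lowO sub by (auto simp: B_def order_le_less)
    then have v: "Max B \<in> B" using fin by (intro Max_in) (auto simp: B_def)
    have "nxt A (Max B) = w"
    proof (subst nxt_iff[OF fin])
      show "Max B \<in> A" using v by (auto simp: B_def)
      have "w \<le> z" if "z \<in> A" "Max B < z" for z
      proof (rule ccontr)
        assume "\<not> w \<le> z"
        then have "z \<in> B" using that by (auto simp: B_def)
        moreover have "finite B" using fin by (simp add: B_def)
        ultimately show False using that by (meson Max_ge leD)
      qed
      then show "w \<in> A \<and> (Max B < w \<and> (\<forall>z\<in>A. Max B < z \<longrightarrow> w \<le> z) \<or> (\<forall>z\<in>A. w \<le> z \<and> z \<le> Max B))"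
        using w v by (auto simp: B_def)
    qed
    moreover have "Max B \<in> ?O" using v w by (auto simp: B_def)
    ultimately show False using orb_step[of "Max B" "nxt A" x] w by simp
  qed
  then show ?thesis using sub by auto
qed

lemma num_orbs_nxt: "finite A \<Longrightarrow> A \<noteq> {} \<Longrightarrow> num_orbs A (nxt A) = 1"
proof -
  assume "finite A" "A \<noteq> {}"
  then have "orbs A (nxt A) = {A}" unfolding orbs_def by (auto simp: orb_nxt image_iff)
  then show ?thesis by (simp add: num_orbs_def)
qed

text \<open>Exchanging the values \<open>a\<close> and \<open>b\<close> changes the successor only
  at the two points just before them. The point before \<open>b\<close> returns to \<open>a\<close>
  and closes the arc \<open>[a, b)\<close>; the point before \<open>a\<close> jumps to
  \<open>b\<close> and closes the complement. One cycle becomes two.\<close>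

lemma transp_nxt:
  assumes fin: "finite A" and ab: "a \<in> A" "b \<in> A" "a < b" and x: "x \<in> A"
  defines "A1 \<equiv> {x \<in> A. a \<le> x \<and> x < b}"
  shows "transp a b (nxt A x) = (if x \<in> A1 then nxt A1 x else nxt (A - A1) x)"
proof -
  let ?n = "nxt A x"
  have n: "?n \<in> A" "(x < ?n \<and> (\<forall>z\<in>A. x < z \<longrightarrow> ?n \<le> z)) \<or> (\<forall>z\<in>A. ?n \<le> z \<and> z \<le> x)"
    using nxt_iff[OF fin x, of ?n] by auto
  have fin12: "finite A1" "finite (A - A1)" using fin by (auto simp: A1_def)
  show ?thesis
  proof (cases "x \<in> A1")
    case True
    then have xb: "a \<le> x" "x < b" by (auto simp: A1_def)
    then have nx: "x < ?n" "\<And>z. z \<in> A \<Longrightarrow> x < z \<Longrightarrow> ?n \<le> z" using n ab by auto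
    then have nb: "?n \<le> b" using xb ab by auto
    have "nxt A1 x = transp a b ?n"
    proof (cases "?n = b")
      case True
      have "nxt A1 x = a" unfolding nxt_iff[OF fin12(1) \<open>x \<in> A1\<close>]
        using True nx ab by (force simp: A1_def)
      then show ?thesis using True by simp
    next
      case False
      then have "?n \<noteq> a" "?n < b" using nx xb nb by auto
      moreover have "nxt A1 x = ?n" unfolding nxt_iff[OF fin12(1) \<open>x \<in> A1\<close>]
        using nx n xb calculation by (auto simp: A1_def)
      ultimately show ?thesis by (simp add: transpose_apply_other)
    qed
    then show ?thesis using True by simp
  next
    case False
    then have x2: "x \<in> A - A1" using x by auto
    have xx: "x < a \<or> b \<le> x" using False x by (auto simp: A1_def)
    have "nxt (A - A1) x = transp a b ?n"
    proof (cases "?n = a")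
      case True
      have "nxt (A - A1) x = b" unfolding nxt_iff[OF fin12(2) x2]
        using True n ab xx by (force simp: A1_def)
      then show ?thesis using True by simp
    next
      case False
      have "?n \<noteq> b" using n xx ab by (metis leD order_less_imp_le order_less_le_trans)
      moreover have "?n \<notin> A1" using n xx ab False
        by (auto simp: A1_def)
      moreover have "nxt (A - A1) x = ?n" unfolding nxt_iff[OF fin12(2) x2]
        using n calculation by auto
      ultimately show ?thesis using False by (simp add: Transposition.transpose_def)
    qed
    then show ?thesis using False by simp
  qed
qed

lemma nxt_remove:
  assumes fin: "finite A" and a: "a \<in> A" "nxt A a \<noteq> a" and x: "x \<in> A - {a}"
  shows "nxt (A - {a}) x = (if nxt A x = a then nxt A a else nxt A x)"
proof -
  have fin': "finite (A - {a})" using fin by simp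
  have n: "nxt A x \<in> A" "(x < nxt A x \<and> (\<forall>z\<in>A. x < z \<longrightarrow> nxt A x \<le> z)) \<or> (\<forall>z\<in>A. nxt A x \<le> z \<and> z \<le> x)"
    using nxt_iff[OF fin, of x "nxt A x"] x by auto
  have m: "nxt A a \<in> A" "(a < nxt A a \<and> (\<forall>z\<in>A. a < z \<longrightarrow> nxt A a \<le> z)) \<or> (\<forall>z\<in>A. nxt A a \<le> z \<and> z \<le> a)"
    using nxt_iff[OF fin, of a "nxt A a"] a by auto
  show ?thesis
  proof (cases "nxt A x = a")
    case True
    have "nxt (A - {a}) x = nxt A a" unfolding nxt_iff[OF fin' x]
    proof (intro conjI)
      show "nxt A a \<in> A - {a}" using m a by auto
      show "x < nxt A a \<and> (\<forall>z\<in>A - {a}. x < z \<longrightarrow> nxt A a \<le> z) \<or> (\<forall>z\<in>A - {a}. nxt A a \<le> z \<and> z \<le> x)"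
        using n m x a True by (smt (verit) DiffE insertI1 linorder_not_less order_le_less order_less_trans)
    qed
    then show ?thesis using True by simp
  next
    case False
    have "nxt (A - {a}) x = nxt A x" unfolding nxt_iff[OF fin' x]
      using n False by auto
    then show ?thesis using False by simp
  qed
qed

section \<open>Noncrossing permutations\<close>

text \<open>The permutations that run through the blocks of a noncrossing partition in cyclic order.
  One pattern of alternation suffices for the second clause, since \<open>p\<close> may be taken
  from whichever of the two crossing orbits contains the least of the four points.\<close>

definition nc_perm :: "'a::linorder set \<Rightarrow> ('a \<Rightarrow> 'a) \<Rightarrow> bool" where
  "nc_perm A X \<longleftrightarrow> (\<forall>x\<in>A. X x = nxt (orb X x) x) \<and>
    (\<forall>p\<in>A. \<forall>q\<in>A. \<forall>r\<in>A. \<forall>s\<in>A. p < q \<and> q < r \<and> r < s \<and> r \<in> orb X p \<and> s \<in> orb X q \<longrightarrow> q \<in> orb X p)"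

lemma nc_permD:
  assumes "nc_perm A X"
  shows "x \<in> A \<Longrightarrow> X x = nxt (orb X x) x"
    "p \<in> A \<Longrightarrow> q \<in> A \<Longrightarrow> r \<in> A \<Longrightarrow> s \<in> A \<Longrightarrow> p < q \<Longrightarrow> q < r \<Longrightarrow> r < s \<Longrightarrow>
      r \<in> orb X p \<Longrightarrow> s \<in> orb X q \<Longrightarrow> q \<in> orb X p"
  using assms unfolding nc_perm_def by blast+

lemma bij_betw_split:
  assumes "finite A" "bij_betw f A A" "B \<subseteq> A" "\<And>x. x \<in> B \<Longrightarrow> f x \<in> B"
  shows "bij_betw f B B" "bij_betw f (A - B) (A - B)"
proof -
  have inj: "inj_on f A" using assms(2) by (auto simp: bij_betw_def)
  show B: "bij_betw f B B"
    unfolding bij_betw_def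
    using endo_inj_surj[of B f] assms(1,3,4) inj_on_subset[OF inj assms(3)] finite_subset by blast
  show "bij_betw f (A - B) (A - B)"
    unfolding bij_betw_def
  proof
    show "inj_on f (A - B)" using inj by (rule inj_on_subset) auto
    have "f ` (A - B) = f ` A - f ` B" by (rule inj_on_image_set_diff[OF inj _ assms(3)]) auto
    then show "f ` (A - B) = A - B" using assms(2) B by (simp add: bij_betw_def)
  qed
qed

text \<open>
  Multiplying by \<open>transp a b\<close> detaches \<open>a\<close> from its cycle in \<open>X\<close> and cuts the cyclic successor of
  \<open>A\<close> into those of the arc \<open>[a, b)\<close> and of its complement.
\<close>

context
  fixes A A1 :: "'a::linorder set" and X X' :: "'a \<Rightarrow> 'a" and a b :: 'a
  assumes fin: "finite A" and bij: "bij_betw X A A"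
    and a: "a \<in> A" and Xa: "X a = b" and ab: "a < b"
    and A1_def: "A1 = {x \<in> A. a \<le> x \<and> x < b}" and X'_def: "X' = transp a b \<circ> X"
begin

lemma b_in: "b \<in> A" using bij a Xa by (auto simp: bij_betw_def)

lemma X'_a: "X' a = a" using Xa by (simp add: X'_def)

lemmas bij' = orb_detach(2)[OF fin bij a Xa less_imp_neq[OF ab, symmetric], folded X'_def]
lemmas orb' = orb_detach(3)[OF fin bij a Xa less_imp_neq[OF ab, symmetric], folded X'_def]
lemmas num' = orb_detach(4)[OF fin bij a Xa less_imp_neq[OF ab, symmetric], folded X'_def]

lemma orb'_a: "orb X' a = {a}" by (rule orb_fixed) (rule X'_a)

lemma X'_if:
  assumes "x \<in> A" "x \<noteq> a"
  shows "X' x = (if X x = a then b else X x)" "X x = (if X' x = b then a else X' x)"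
proof -
  have "X x \<noteq> b" using bij assms a Xa by (auto simp: bij_betw_def dest: inj_onD)
  then show "X' x = (if X x = a then b else X x)" "X x = (if X' x = b then a else X' x)"
    using ab by (auto simp: X'_def Transposition.transpose_def)
qed

text \<open>The product of \<open>X'\<close> and \<open>Y\<close> is the cut successor map, whose
  two orbits are \<open>A1\<close> and its complement, and \<open>X'\<close> has one orbit more than
  \<open>X\<close>. The assumed count is therefore the equality case of
  \<open>num_orbs_comp\<close>, which confines \<open>X'\<close> and \<open>Y\<close> to the two
  arcs; there the counts add up.\<close>

lemma factor_split:
  assumes bijY: "bij_betw Y A A" and XY: "\<forall>x\<in>A. X (Y x) = nxt A x"
  shows "num_orbs A X + num_orbs A Y = card A + 1 \<longleftrightarrow>
    bij_betw X' A1 A1 \<and> bij_betw X' (A - A1) (A - A1) \<and> bij_betw Y A1 A1 \<and> bij_betw Y (A - A1) (A - A1) \<and>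
    num_orbs A1 X' + num_orbs A1 Y = card A1 + 1 \<and>
    num_orbs (A - A1) X' + num_orbs (A - A1) Y = card (A - A1) + 1"
    (is "?L \<longleftrightarrow> ?R")
    and "x \<in> A1 \<Longrightarrow> X' (Y x) = nxt A1 x" "x \<in> A - A1 \<Longrightarrow> X' (Y x) = nxt (A - A1) x"
    and "bij_betw X' A1 A1 \<Longrightarrow> bij_betw Y A1 A1"
proof -
  define B where "B = A1"
  have B: "B \<subseteq> A" "a \<in> B" "b \<in> A - B" using a b_in ab by (auto simp: B_def A1_def)
  have finB: "finite B" "finite (A - B)" using fin B finite_subset by auto
  define C where "C = transp a b \<circ> nxt A"
  have C12: "C x = (if x \<in> B then nxt B x else nxt (A - B) x)" if "x \<in> A" for x
    unfolding C_def B_def A1_def comp_def by (rule transp_nxt[OF fin a b_in ab that])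
  have C: "C x = X' (Y x)" if "x \<in> A" for x using XY that by (simp add: C_def X'_def)
  have C1: "C x = nxt B x" if "x \<in> B" for x using C12 that B by auto
  have C2: "C x = nxt (A - B) x" if "x \<in> A - B" for x using C12 that B by auto
  have CB1: "C x \<in> B" if "x \<in> B" for x using C1 that nxt_in[OF finB(1)] by simp
  have CB2: "C x \<in> A - B" if "x \<in> A - B" for x using C2[OF that] nxt_in[OF finB(2) that] by simp
  have bC1: "bij_betw C B B" using bij_nxt[OF finB(1)] C1 bij_betw_cong by blast
  have bC2: "bij_betw C (A - B) (A - B)" using bij_nxt[OF finB(2)] C2 bij_betw_cong by blast
  have o1: "orb C x = B" if "x \<in> B" for x
  proof -
    have "orb C x = orb (nxt B) x" by (rule orb_cong[OF that]) (use CB1 C1 in auto)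
    then show ?thesis using orb_nxt[OF finB(1) that] by simp
  qed
  have o2: "orb C x = A - B" if "x \<in> A - B" for x
  proof -
    have "orb C x = orb (nxt (A - B)) x" by (rule orb_cong[OF that]) (use CB2 C2 in auto)
    then show ?thesis using orb_nxt[OF finB(2) that] by simp
  qed
  have "num_orbs A C = num_orbs B C + num_orbs (A - B) C"
    by (rule num_orbs_split[OF fin bC1 bC2]) (use B in auto)
  moreover have "num_orbs B C = num_orbs B (nxt B)"
    by (rule num_orbs_cong) (use CB1 C1 in auto)
  moreover have "num_orbs (A - B) C = num_orbs (A - B) (nxt (A - B))"
    by (rule num_orbs_cong) (use CB2 C2 in auto)
  moreover have "num_orbs B (nxt B) = 1" using num_orbs_nxt[OF finB(1)] B by blast
  moreover have "num_orbs (A - B) (nxt (A - B)) = 1" using num_orbs_nxt[OF finB(2)] B by blast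
  ultimately have nC: "num_orbs A C = 2" by simp
  have cardA: "card A = card B + card (A - B)"
    using fin B by (metis card_Diff_subset card_mono finB(1) le_add_diff_inverse)
  have X'Y1: "X' (Y x) = nxt B x" if "x \<in> B" for x using C C1 that B by (metis subsetD)
  have X'Y2: "X' (Y x) = nxt (A - B) x" if "x \<in> A - B" for x using C C2 that by (metis DiffD1)
  show "x \<in> A1 \<Longrightarrow> X' (Y x) = nxt A1 x" "x \<in> A - A1 \<Longrightarrow> X' (Y x) = nxt (A - A1) x"
    using X'Y1 X'Y2 unfolding B_def by blast+
  have Yb: "bij_betw Y B B" if X'B: "bij_betw X' B B"
  proof (rule bij_betw_split(1)[OF fin bijY B(1)])
    fix x assume x: "x \<in> B"
    have "Y x \<in> A" using bijY x B by (auto simp: bij_betw_def)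
    moreover have "X' (Y x) \<in> B" using CB1[OF x] C x B by auto
    moreover have "bij_betw X' (A - B) (A - B)"
      by (rule bij_betw_split(2)[OF fin bij' B(1)]) (use X'B in \<open>auto simp: bij_betw_def\<close>)
    ultimately show "Y x \<in> B" using bij_betwE by blast
  qed
  then show "bij_betw X' A1 A1 \<Longrightarrow> bij_betw Y A1 A1" by (simp add: B_def)
  have "?L \<longleftrightarrow> bij_betw X' B B \<and> bij_betw X' (A - B) (A - B) \<and> bij_betw Y B B \<and> bij_betw Y (A - B) (A - B) \<and>
    num_orbs B X' + num_orbs B Y = card B + 1 \<and>
    num_orbs (A - B) X' + num_orbs (A - B) Y = card (A - B) + 1" (is "?L \<longleftrightarrow> ?S")
  proof
    assume L: ?L
    \<comment> \<open>Both sides of the count have risen by one: \<open>X'\<close> has one more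
      orbit than \<open>X\<close>, and \<open>C\<close> has two orbits where the full successor map
      has one.\<close>
    then have eq: "num_orbs A X' + num_orbs A Y = num_orbs A C + card A" using nC num' by simp
    have m: "X' x \<in> orb C x \<and> Y x \<in> orb C x" if "x \<in> A" for x
      by (rule num_orbs_comp(2)[OF fin bij' bijY C eq that])
    have X'B: "bij_betw X' B B" "bij_betw X' (A - B) (A - B)"
      using bij_betw_split[OF fin bij' B(1)] m o1 B by blast+
    have YB: "bij_betw Y B B" "bij_betw Y (A - B) (A - B)"
      using bij_betw_split[OF fin bijY B(1)] m o1 B by blast+
    have "num_orbs A X' = num_orbs B X' + num_orbs (A - B) X'"
      by (rule num_orbs_split[OF fin X'B]) (use B in auto)
    moreover have "num_orbs A Y = num_orbs B Y + num_orbs (A - B) Y"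
      by (rule num_orbs_split[OF fin YB]) (use B in auto)
    moreover have "num_orbs B X' + num_orbs B Y \<le> num_orbs B (nxt B) + card B"
      by (rule num_orbs_comp(1)[OF finB(1) X'B(1) YB(1)]) (use X'Y1 in simp)
    moreover have "num_orbs (A - B) X' + num_orbs (A - B) Y \<le> num_orbs (A - B) (nxt (A - B)) + card (A - B)"
      by (rule num_orbs_comp(1)[OF finB(2) X'B(2) YB(2)]) (use X'Y2 in simp)
    moreover have "num_orbs B (nxt B) = 1" "num_orbs (A - B) (nxt (A - B)) = 1" by fact+
    \<comment> \<open>Each arc satisfies an inequality, and the two inequalities add up to the
      equality for \<open>A\<close>; hence both are equalities.\<close>
    ultimately have "num_orbs B X' + num_orbs B Y = card B + 1 \<and>
      num_orbs (A - B) X' + num_orbs (A - B) Y = card (A - B) + 1"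
      using L num' cardA by linarith
    then show ?S using X'B YB by blast
  next
    assume S: ?S
    have "num_orbs A X' = num_orbs B X' + num_orbs (A - B) X'"
      by (rule num_orbs_split[OF fin]) (use B S in auto)
    moreover have "num_orbs A Y = num_orbs B Y + num_orbs (A - B) Y"
      by (rule num_orbs_split[OF fin]) (use B S in auto)
    ultimately show ?L using S num' cardA by linarith
  qed
  then show "?L \<longleftrightarrow> ?R" by (simp only: B_def)
qed

lemma nxt_orb_detach:
  assumes "x \<in> A" "x \<noteq> a" "a \<in> orb X x" "nxt (orb X a) a = b"
  shows "nxt (orb X' x) x = (if nxt (orb X x) x = a then b else nxt (orb X x) x)"
proof -
  have e: "orb X a = orb X x" by (rule orb_eq[OF fin bij assms(1,3)])
  have "nxt (orb X x - {a}) x = (if nxt (orb X x) x = a then nxt (orb X x) a else nxt (orb X x) x)"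
  proof (rule nxt_remove)
    show "finite (orb X x)" using orb_subset[OF bij assms(1)] fin by (rule finite_subset)
    show "nxt (orb X x) a \<noteq> a" using assms(4) e ab by simp
  qed (use assms in auto)
  then show ?thesis using orb'[OF assms(1,2)] assms(4) e by simp
qed

text \<open>Since \<open>b\<close> follows \<open>a\<close> directly in the orbit of
  \<open>a\<close>, that orbit has no point strictly between them. A cycle starting in this gap
  cannot leave it, because a step beyond \<open>b\<close> or below \<open>a\<close> would cross the
  pair \<open>a\<close>, \<open>b\<close>. So \<open>X'\<close> preserves the arc, and both
  restrictions inherit the noncrossing condition.\<close>

lemma nc_detach:
  assumes nc: "nc_perm A X"
  shows "x \<in> A1 \<Longrightarrow> X' x \<in> A1" "nc_perm A1 X'" "nc_perm (A - A1) X'"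
proof -
  have A1I: "x \<in> A1 \<longleftrightarrow> x \<in> A \<and> a \<le> x \<and> x < b" for x by (simp add: A1_def)
  note succ = nc_permD(1)[OF nc] and cross = nc_permD(2)[OF nc]
  have fo: "finite (orb X x)" if "x \<in> A" for x
    using orb_subset[OF bij that] fin by (rule finite_subset)
  have na: "nxt (orb X a) a = b" using succ[OF a] Xa by simp
  have bo: "b \<in> orb X a" using orb_step[of a X a] Xa by simp
  have gap: "a \<notin> orb X x" if "x \<in> A1" "x \<noteq> a" for x
  proof
    assume "a \<in> orb X x"
    then have "x \<in> orb X a" using orb_sym[OF fin bij] that by (auto simp: A1I)
    moreover have "\<forall>z\<in>orb X a. a < z \<longrightarrow> b \<le> z"
      using na nxt_iff[OF fo[OF a], of a b] ab by (auto dest: leD)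
    ultimately show False using that by (auto simp: A1I)
  qed
  show inv: "X' x \<in> A1" if x: "x \<in> A1" for x
  proof (cases "x = a")
    case True then show ?thesis using X'_a x by simp
  next
    case False
    have xA: "x \<in> A" using x by (simp add: A1I)
    have XA: "X x \<in> A" using bij xA by (auto simp: bij_betw_def)
    have Xo: "X x \<in> orb X x" using orb_step[of x X x] by simp
    have Xs: "x \<in> orb X (X x)" using orb_sym[OF fin bij xA Xo] .
    have ax: "a < x" "x < b" "x \<in> A" using x False by (auto simp: A1I)
    have neq: "X x \<noteq> a" using Xo gap[OF x False] by metis
    have nb: "X x \<noteq> b" using bij ax a Xa False by (auto simp: bij_betw_def dest: inj_onD)
    have xa: "x \<notin> orb X a" using gap[OF x False] orb_sym[OF fin bij a] by blast
    have "\<not> b < X x" using cross[OF a ax(3) b_in XA ax(1,2) _ bo Xo] xa by blast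
    moreover have "\<not> X x < a"
    proof
      assume "X x < a"
      then have "a \<in> orb X (X x)" using cross[OF XA a ax(3) b_in _ ax(1,2) Xs bo] by blast
      then show False using orb_eq[OF fin bij ax(3) Xo] gap[OF x False] by simp
    qed
    ultimately have "X x \<in> A1" using XA neq nb by (auto simp: A1I)
    moreover have "X' x = X x" using neq nb by (simp add: X'_def transpose_apply_other)
    ultimately show ?thesis by simp
  qed
  have sub: "orb X' x \<subseteq> orb X x" if "x \<in> A" for x
    using orb'[OF that] orb'_a orb_refl[of a X] by (cases "x = a") auto
  \<comment> \<open>The exclusion of \<open>q = a\<close> is harmless in both uses: inside the arc
    \<open>q\<close> exceeds \<open>p\<close>, which is at least \<open>a\<close>, and the
    complement does not contain \<open>a\<close>.\<close>
  have cr: "q \<in> orb X' p" if "p \<in> A" "q \<in> A" "r \<in> A" "s \<in> A" "p < q" "q < r" "r < s" "r \<in> orb X' p" "s \<in> orb X' q"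
    "q \<noteq> a" for p q r s
  proof -
    have "q \<in> orb X p"
      using cross[OF that(1-7)] sub[OF that(1)] sub[OF that(2)] that(8,9) by blast
    moreover have pa: "p \<noteq> a"
    proof
      assume "p = a"
      then have "r = a" using that(8) orb'_a by simp
      then show False using that(5,6) \<open>p = a\<close> by simp
    qed
    ultimately show ?thesis using orb'[OF that(1) pa] that(10) by blast
  qed
  have crA1: "q \<in> orb X' p" if "p \<in> A1" "q \<in> A1" "r \<in> A1" "s \<in> A1" "p < q" "q < r" "r < s" "r \<in> orb X' p" "s \<in> orb X' q" for p q r s
    by (rule cr[of p q r s]) (use that in \<open>auto simp: A1I\<close>)
  have crA2: "q \<in> orb X' p" if "p \<in> A - A1" "q \<in> A - A1" "r \<in> A - A1" "s \<in> A - A1" "p < q" "q < r" "r < s" "r \<in> orb X' p" "s \<in> orb X' q" for p q r s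
    by (rule cr[of p q r s]) (use that a ab in \<open>auto simp: A1I\<close>)
  have s0: "X' x = nxt (orb X' x) x" if x: "x \<in> A" "x \<noteq> a" for x
  proof (cases "a \<in> orb X x")
    case True
    show ?thesis unfolding nxt_orb_detach[OF x True na] X'_if(1)[OF x] succ[OF x(1), symmetric] ..
  next
    case False
    then have "X x \<noteq> a" using orb_step[of x X x] by auto
    then show ?thesis using X'_if(1)[OF x] orb'[OF x] False succ[OF x(1)] by simp
  qed
  have sa: "X' a = nxt (orb X' a) a" unfolding orb'_a X'_a by (simp add: nxt_def)
  show "nc_perm A1 X'" unfolding nc_perm_def using crA1 s0 sa
    by (metis A1I)
  have "x \<noteq> a" if "x \<in> A - A1" for x using that a ab by (auto simp: A1I)
  then have "X' x = nxt (orb X' x) x" if "x \<in> A - A1" for x using s0 that by blast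
  then show "nc_perm (A - A1) X'" unfolding nc_perm_def by (blast intro: crA2)
qed

text \<open>Going back from \<open>X'\<close> to \<open>X\<close> inserts \<open>a\<close> just
  before \<open>b\<close> into the cycle of \<open>b\<close>. As no point of the complement lies
  between \<open>a\<close> and \<open>b\<close>, the enlarged cycle is still in cyclic order and
  crosses nothing new.\<close>

lemma nc_attach:
  assumes inv: "\<And>x. x \<in> A1 \<Longrightarrow> X' x \<in> A1" and nc1: "nc_perm A1 X'" and nc2: "nc_perm (A - A1) X'"
  shows "nc_perm A X"
proof -
  have bij1: "bij_betw X' A1 A1" "bij_betw X' (A - A1) (A - A1)"
    using bij_betw_split[OF fin bij', of A1] inv A1_def by blast+
  have o1: "orb X' x \<subseteq> A1" if "x \<in> A1" for x by (rule orb_subset[OF bij1(1) that])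
  have o2: "orb X' x \<subseteq> A - A1" if "x \<in> A - A1" for x by (rule orb_subset[OF bij1(2) that])
  have b2: "b \<in> A - A1" using b_in by (auto simp: A1_def)
  have a1: "a \<in> A1" using a ab by (auto simp: A1_def)
  have fo: "finite (orb X x)" if "x \<in> A" for x
    using orb_subset[OF bij that] fin by (rule finite_subset)
  have bo: "b \<in> orb X a" using orb_step[of a X a] Xa by simp
  have oab: "orb X b = orb X a" by (rule orb_eq[OF fin bij a bo])
  have oa: "orb X a = insert a (orb X' b)" using orb'[OF b_in] ab oab orb_refl[of a X] by auto
  have na: "nxt (orb X a) a = b"
  proof (subst nxt_iff[OF fo[OF a]])
    have "b \<le> z" if "z \<in> orb X a" "a < z" for z
      using that oa o2[OF b2] by (force simp: A1_def)
    then show "b \<in> orb X a \<and> (a < b \<and> (\<forall>z\<in>orb X a. a < z \<longrightarrow> b \<le> z) \<or> (\<forall>z\<in>orb X a. b \<le> z \<and> z \<le> a))"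
      using bo ab by blast
  qed simp
  have s': "X' x = nxt (orb X' x) x" if "x \<in> A" for x
    using nc_permD(1)[OF nc1, of x] nc_permD(1)[OF nc2, of x] that by blast
  have succ: "X x = nxt (orb X x) x" if x: "x \<in> A" for x
  proof (cases "x = a")
    case True then show ?thesis using na Xa by simp
  next
    case False
    show ?thesis
    proof (cases "a \<in> orb X x")
      case True
      have e: "orb X a = orb X x" by (rule orb_eq[OF fin bij x True])
      have "nxt (orb X x) x \<noteq> b"
        using nxt_inj[OF fo[OF x], of x a] True False na e by auto
      moreover have "X' x = (if nxt (orb X x) x = a then b else nxt (orb X x) x)"
        unfolding s'[OF x] by (rule nxt_orb_detach[OF x False True na])
      ultimately show ?thesis using X'_if(2)[OF x False] by (cases "nxt (orb X x) x = a") presburger+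
    next
      case F: False
      then have o: "orb X' x = orb X x" using orb'[OF x False] by simp
      have "X' x \<noteq> b"
      proof
        assume "X' x = b"
        then have "X x = a" using X'_if(2)[OF x False] by simp
        then show False using F orb_step[of x X x] by simp
      qed
      then show ?thesis using s'[OF x] X'_if(2)[OF x False] o by simp
    qed
  qed
  \<comment> \<open>The orbit of \<open>b\<close> is the only one that is enlarged, and only by
    \<open>a\<close>. So each orbit of \<open>X\<close> lies either strictly inside the arc or in
    the complement together with \<open>a\<close>.\<close>
  define A2a where "A2a = insert a (A - A1)"
  have cls: "orb X p \<subseteq> A1 - {a} \<or> orb X p \<subseteq> A2a" if p: "p \<in> A" for p
  proof (cases "a \<in> orb X p")
    case True
    then have "orb X p = orb X a" by (rule orb_eq[OF fin bij p, symmetric])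
    then show ?thesis using oa o2[OF b2] by (auto simp: A2a_def)
  next
    case False
    then have "p \<noteq> a" by auto
    then have "orb X p = orb X' p" using orb'[OF p] False by simp
    then show ?thesis using o1[of p] o2[of p] p False by (auto simp: A2a_def)
  qed
  \<comment> \<open>Sliding \<open>a\<close> to \<open>b\<close> carries \<open>A2a\<close> into the
    complement of the arc. It respects orbits, and it keeps the order of points in different orbits
    because only \<open>a\<close> and \<open>b\<close> themselves collide. A crossing in
    \<open>A2a\<close> thus becomes a crossing for \<open>X'\<close> in the complement.\<close>
  define \<phi> where "\<phi> x = (if x = a then b else x)" for x
  have \<phi>1: "\<phi> x \<in> A - A1" if "x \<in> A2a" for x using that b2 by (auto simp: \<phi>_def A2a_def)
  have \<phi>o: "\<phi> y \<in> orb X' (\<phi> x) \<longleftrightarrow> y \<in> orb X x" if "x \<in> A" "y \<in> A" for x y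
  proof -
    have "orb X' (\<phi> x) = orb X x - {a}"
    proof (cases "x = a")
      case True then show ?thesis using orb'[OF b_in] ab oab by (simp add: \<phi>_def)
    next
      case False then show ?thesis using orb'[OF that(1)] by (simp add: \<phi>_def)
    qed
    moreover have "a \<in> orb X x \<longleftrightarrow> b \<in> orb X x"
      using orb_step[of a X x] orb_mono[of b X x] Xa oab orb_refl[of a X] by blast
    ultimately show ?thesis using ab by (cases "y = a") (simp_all add: \<phi>_def less_imp_neq[symmetric])
  qed
  have \<phi>lt: "\<phi> x < \<phi> y" if "x \<in> A2a" "y \<in> A2a" "x < y" "y \<notin> orb X x" for x y
  proof -
    have "x = a \<Longrightarrow> y \<noteq> b" using that bo by auto
    then show ?thesis using that ab by (auto simp: \<phi>_def A2a_def A1_def)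
  qed
  have cross: "q \<in> orb X p" if h: "p \<in> A" "q \<in> A" "r \<in> A" "s \<in> A" "p < q" "q < r" "r < s" "r \<in> orb X p" "s \<in> orb X q"
    for p q r s
  proof (rule ccontr)
    assume n: "q \<notin> orb X p"
    have er: "orb X r = orb X p" by (rule orb_eq[OF fin bij h(1,8)])
    have es: "orb X s = orb X q" by (rule orb_eq[OF fin bij h(2,9)])
    have n2: "r \<notin> orb X q" using n er orb_eq[OF fin bij h(2)] orb_refl[of q X] by metis
    have n3: "s \<notin> orb X r"
      using n er es orb_eq[OF fin bij h(3), of s] orb_refl[of q X] by metis
    consider "orb X p \<subseteq> A1 - {a}" "orb X q \<subseteq> A1 - {a}" | "orb X p \<subseteq> A2a" "orb X q \<subseteq> A2a"
      | "orb X p \<subseteq> A1 - {a}" "orb X q \<subseteq> A2a" | "orb X p \<subseteq> A2a" "orb X q \<subseteq> A1 - {a}"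
      using cls h by blast
    then show False
    proof cases
      case 1
      then have m: "p \<in> A1" "q \<in> A1" "r \<in> A1" "s \<in> A1" "p \<noteq> a" "q \<noteq> a" "r \<noteq> a" "s \<noteq> a"
        using h orb_refl[of p X] orb_refl[of q X] by blast+
      have "q \<in> orb X' p"
        using nc_permD(2)[OF nc1 m(1-4) h(5-7)] orb'[of p] orb'[of q] h m by simp
      then show False using n orb'[of p] m h by simp
    next
      case 2
      then have m: "p \<in> A2a" "q \<in> A2a" "r \<in> A2a" "s \<in> A2a"
        using h orb_refl[of p X] orb_refl[of q X] by blast+
      have "\<phi> q \<in> orb X' (\<phi> p)"
        by (rule nc_permD(2)[OF nc2 \<phi>1[OF m(1)] \<phi>1[OF m(2)] \<phi>1[OF m(3)] \<phi>1[OF m(4)]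
          \<phi>lt[OF m(1,2) h(5) n] \<phi>lt[OF m(2,3) h(6) n2] \<phi>lt[OF m(3,4) h(7) n3]])
          (use \<phi>o h in auto)
      then show False using n \<phi>o h by simp
    next
      \<comment> \<open>Points of \<open>A1 - {a}\<close> lie strictly between \<open>a\<close> and
        \<open>b\<close>, where \<open>A2a\<close> has no points. In either mixed case the
        alternation would put a point of \<open>A2a\<close> between two points of
        \<open>A1 - {a}\<close>.\<close>
      case 3
      then have "p \<in> A1 - {a}" "r \<in> A1 - {a}" "q \<in> A2a"
        using h orb_refl[of p X] orb_refl[of q X] by blast+
      then show False using h by (auto simp: A2a_def A1_def)
    next
      case 4
      then have "q \<in> A1 - {a}" "s \<in> A1 - {a}" "r \<in> A2a"
        using h orb_refl[of p X] orb_refl[of q X] by blast+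
      then show False using h by (auto simp: A2a_def A1_def)
    qed
  qed
  show ?thesis unfolding nc_perm_def using succ cross by blast
qed

end

text \<open>At an ascent \<open>a < X a\<close> both sides split along the arc from \<open>a\<close>
  to \<open>X a\<close> into the same two smaller statements: the count by
  \<open>factor_split\<close>, the noncrossing property by \<open>nc_detach\<close> and
  \<open>nc_attach\<close>. Without an ascent \<open>X\<close> is the identity and \<open>Y\<close>
  is the single cycle \<open>nxt A\<close>, and both sides hold. In the noncrossing case
  \<open>Y\<close> is the Kreweras complement of \<open>X\<close>.\<close>

lemma num_orbs_nc_perm:
  fixes A :: "'a::linorder set"
  assumes "finite A" "A \<noteq> {}" "bij_betw X A A" "bij_betw Y A A" "\<And>x. x \<in> A \<Longrightarrow> X (Y x) = nxt A x"
  shows "num_orbs A X + num_orbs A Y = card A + 1 \<longleftrightarrow> nc_perm A X"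
  using assms
proof (induction "card A" arbitrary: A X Y rule: less_induct)
  case less
  note fin = less.prems(1) and bij = less.prems(3) and bijY = less.prems(4) and XY = less.prems(5)
  have XA: "X x \<in> A" if "x \<in> A" for x using bij that by (auto simp: bij_betw_def)
  show ?case
  proof (cases "\<exists>a\<in>A. a < X a")
    case True
    then obtain a where a: "a \<in> A" "a < X a" by auto
    let ?b = "X a"
    let ?A1 = "{x \<in> A. a \<le> x \<and> x < ?b}" and ?X = "transp a ?b \<circ> X"
    have XY': "\<forall>x\<in>A. X (Y x) = nxt A x" using XY by blast
    note s = factor_split[OF fin bij a(1) refl a(2) refl refl bijY XY']
    have ne: "?A1 \<noteq> {}" "A - ?A1 \<noteq> {}" using a XA by auto
    have lt: "card ?A1 < card A" "card (A - ?A1) < card A"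
      using fin ne by (auto intro!: psubset_card_mono)
    have f12: "finite ?A1" "finite (A - ?A1)" using fin by auto
    have IH1: "num_orbs ?A1 ?X + num_orbs ?A1 Y = card ?A1 + 1 \<longleftrightarrow> nc_perm ?A1 ?X"
      if "bij_betw ?X ?A1 ?A1" "bij_betw Y ?A1 ?A1"
      by (rule less.hyps[OF lt(1) f12(1) ne(1) that s(2)])
    have IH2: "num_orbs (A - ?A1) ?X + num_orbs (A - ?A1) Y = card (A - ?A1) + 1 \<longleftrightarrow> nc_perm (A - ?A1) ?X"
      if "bij_betw ?X (A - ?A1) (A - ?A1)" "bij_betw Y (A - ?A1) (A - ?A1)"
      by (rule less.hyps[OF lt(2) f12(2) ne(2) that s(3)])
    show ?thesis
    proof
      assume "num_orbs A X + num_orbs A Y = card A + 1"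
      then have h: "bij_betw ?X ?A1 ?A1" "nc_perm ?A1 ?X" "nc_perm (A - ?A1) ?X"
        using s(1) IH1 IH2 by blast+
      show "nc_perm A X"
        by (rule nc_attach[OF fin bij a(1) refl a(2) refl refl _ h(2,3)]) (use h(1) bij_betwE in blast)
    next
      assume "nc_perm A X"
      note d = nc_detach[OF fin bij a(1) refl a(2) refl refl this]
      note b' = orb_detach(2)[OF fin bij a(1) refl less_imp_neq[OF a(2), symmetric]]
      have bX: "bij_betw ?X ?A1 ?A1" "bij_betw ?X (A - ?A1) (A - ?A1)"
        using bij_betw_split[OF fin b' _ d(1)] by blast+
      have bY: "bij_betw Y ?A1 ?A1" by (rule s(4)[OF bX(1)])
      have bY2: "bij_betw Y (A - ?A1) (A - ?A1)"
        by (rule bij_betw_split(2)[OF fin bijY]) (use bY bij_betwE in blast)+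
      show "num_orbs A X + num_orbs A Y = card A + 1"
        using s(1) IH1[OF bX(1) bY] IH2[OF bX(2) bY2] bX bY bY2 d(2,3) by blast
    qed
  next
    case False
    have X: "X x = x" if "x \<in> A" for x
    proof (rule ccontr)
      assume "X x \<noteq> x"
      \<comment> \<open>The least moved point cannot move up, as there is no ascent, so it moves
        down to a fixed point, which contradicts injectivity.\<close>
      define M where "M = {x \<in> A. X x \<noteq> x}"
      have M: "finite M" "M \<noteq> {}" using fin \<open>X x \<noteq> x\<close> that by (auto simp: M_def)
      then have m: "Min M \<in> M" by simp
      then have "X (Min M) < Min M" using False by (force simp: M_def)
      then have "X (Min M) \<notin> M" using M by (meson Min_le leD)
      then have "X (X (Min M)) = X (Min M)" using m XA by (auto simp: M_def)
      then have "X (Min M) = Min M"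
        using bij m XA by (auto simp: M_def bij_betw_def dest: inj_onD)
      then show False using m by (simp add: M_def)
    qed
    have "nc_perm A X" unfolding nc_perm_def using X by (auto simp: orb_fixed nxt_def)
    moreover have "num_orbs A X = card A" by (rule num_orbs_id[OF X])
    moreover have "num_orbs A Y = num_orbs A (nxt A)"
    proof (rule num_orbs_cong)
      show "Y x \<in> A" if "x \<in> A" for x using bijY that by (auto simp: bij_betw_def)
      then show "Y x = nxt A x" if "x \<in> A" for x using that X XY by metis
    qed
    ultimately show ?thesis using num_orbs_nxt less.prems by simp
  qed
qed

section \<open>Reflection length and orbit counts\<close>

lemma orb_image:
  assumes "x \<in> A" "\<And>y. y \<in> A \<Longrightarrow> f y \<in> A" "\<And>y. y \<in> A \<Longrightarrow> g (h y) = h (f y)"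
  shows "orb g (h x) = h ` orb f x"
proof -
  have "(g ^^ n) (h x) = h ((f ^^ n) x) \<and> (f ^^ n) x \<in> A" for n
    by (induction n) (use assms in auto)
  then show ?thesis unfolding orb_def by auto
qed

lemma num_orbs_image:
  assumes "bij_betw f A A" "inj_on h A" "\<And>y. y \<in> A \<Longrightarrow> g (h y) = h (f y)"
  shows "num_orbs (h ` A) g = num_orbs A f"
proof -
  have fA: "f y \<in> A" if "y \<in> A" for y using assms(1) that by (auto simp: bij_betw_def)
  have "orb g (h x) = h ` orb f x" if "x \<in> A" for x
    by (rule orb_image[of x A f g h]) (use that fA assms(3) in auto)
  then have "orbs (h ` A) g = (`) h ` orbs A f" by (auto simp: orbs_def image_image)
  moreover have "inj_on ((`) h) (orbs A f)"
  proof (rule inj_onI)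
    fix B C assume BC: "B \<in> orbs A f" "C \<in> orbs A f" "h ` B = h ` C"
    then have "B \<subseteq> A" "C \<subseteq> A" using orb_subset[OF assms(1)] by (auto simp: orbs_def)
    then show "B = C" using BC(3) inj_on_image_eq_iff[OF assms(2)] by blast
  qed
  ultimately show ?thesis by (simp add: num_orbs_def card_image)
qed

lemma Sym_bij: "p \<in> Sym d \<Longrightarrow> bij_betw p {1..d} {1..d}"
  by (simp add: Sym_def permutes_imp_bij)

lemma Sym_comp: "p \<in> Sym d \<Longrightarrow> q \<in> Sym d \<Longrightarrow> p \<circ> q \<in> Sym d"
  by (simp add: Sym_def permutes_compose)

lemma Sym_inv: "p \<in> Sym d \<Longrightarrow> inv p \<in> Sym d"
  by (simp add: Sym_def permutes_inv)

lemma Sym_id: "id \<in> Sym d"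
  by (simp add: Sym_def permutes_id)

lemma transps_Sym: "t \<in> transps d \<Longrightarrow> t \<in> Sym d"
  unfolding transps_def Sym_def by (auto intro: permutes_swap_id)

lemma num_orbs_transps:
  assumes "t \<in> transps d"
  shows "num_orbs {1..d} t + 1 = d"
proof -
  obtain a b where ab: "t = transp a b" "a \<in> {1..d}" "b \<in> {1..d}" "a \<noteq> b"
    using assms unfolding transps_def by blast
  have "num_orbs {1..d} (transp a b \<circ> t) = num_orbs {1..d} t + 1"
    by (rule orb_detach(4)) (use ab Sym_bij[OF transps_Sym[OF assms]] in auto)
  moreover have "num_orbs {1..d} (transp a b \<circ> t) = card {1..d}"
    by (rule num_orbs_id) (simp add: ab)
  ultimately show ?thesis by simp
qed

text \<open>A transposition has \<open>d - 1\<close> orbits, so by \<open>num_orbs_comp\<close> each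
  further letter lowers the number of orbits by at most one, starting from the \<open>d\<close>
  orbits of the identity.\<close>

lemma word_length_ge:
  assumes "set ts \<subseteq> transps d"
  shows "foldr (\<circ>) ts id \<in> Sym d \<and> d \<le> num_orbs {1..d} (foldr (\<circ>) ts id) + length ts"
  using assms
proof (induction ts)
  case Nil
  then show ?case using Sym_id[of d] num_orbs_id[of "{1..d}" id] by (simp add: id_def)
next
  case (Cons t ts)
  let ?p = "foldr (\<circ>) ts id"
  have "t \<in> transps d \<and> set ts \<subseteq> transps d" using Cons.prems by simp
  then have t: "t \<in> transps d" "t \<in> Sym d" and p: "?p \<in> Sym d" "d \<le> num_orbs {1..d} ?p + length ts"
    using Cons.IH transps_Sym by blast+
  have "num_orbs {1..d} t + num_orbs {1..d} ?p \<le> num_orbs {1..d} (t \<circ> ?p) + card {1..d}"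
    by (rule num_orbs_comp(1)) (use t p Sym_bij in auto)
  then have "d \<le> num_orbs {1..d} (t \<circ> ?p) + length (t # ts)"
    using num_orbs_transps[OF t(1)] p(2) unfolding card_atLeastAtMost list.size by linarith
  moreover have "foldr (\<circ>) (t # ts) id = t \<circ> ?p" by simp
  ultimately show ?case using Sym_comp[OF t(2) p(1)] by metis
qed

lemma ex_word:
  assumes "p \<in> Sym d"
  shows "\<exists>ts. set ts \<subseteq> transps d \<and> foldr (\<circ>) ts id = p \<and> length ts + num_orbs {1..d} p = d"
proof -
  have "finite {1..d}" by simp
  moreover have "bij_betw p {1..d} {1..d}" using Sym_bij assms by blast
  \<comment> \<open>The induction sees the permutation only on \<open>{1..d}\<close>, but the word
    has to equal it as a function on all naturals; hence the premise that outside points are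
    fixed.\<close>
  ultimately have "(\<forall>x. x \<notin> {1..d} \<longrightarrow> p x = x) \<longrightarrow>
    (\<exists>ts. set ts \<subseteq> transps d \<and> foldr (\<circ>) ts id = p \<and> length ts + num_orbs {1..d} p = d)"
  proof (induction rule: bij_induct)
    case (fixed p)
    show ?case
    proof
      assume "\<forall>x. x \<notin> {1..d} \<longrightarrow> p x = x"
      then have "p = id" using fixed(2) by (intro ext) (metis id_apply)
      then show "\<exists>ts. set ts \<subseteq> transps d \<and> foldr (\<circ>) ts id = p \<and> length ts + num_orbs {1..d} p = d"
        by (intro exI[of _ "[]"]) (simp add: num_orbs_id)
    qed
  next
    case (moved p a)
    let ?t = "transp a (p a)"
    have pa: "p a \<in> {1..d}" using moved(1,2) bij_betwE by blast
    show ?case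
    proof
      assume out: "\<forall>x. x \<notin> {1..d} \<longrightarrow> p x = x"
      have "(?t \<circ> p) x = x" if "x \<notin> {1..d}" for x
      proof -
        have "x \<noteq> a" "x \<noteq> p a" using that moved(2) pa by auto
        then show ?thesis using out that by (simp add: transpose_apply_other)
      qed
      then obtain ts where ts: "set ts \<subseteq> transps d" "foldr (\<circ>) ts id = ?t \<circ> p"
        "length ts + num_orbs {1..d} (?t \<circ> p) = d"
        using moved.IH by blast
      have "num_orbs {1..d} (?t \<circ> p) = num_orbs {1..d} p + 1"
        by (rule orb_detach(4)) (use moved in auto)
      moreover have "?t \<in> transps d" unfolding transps_def using moved(2,3) pa by fastforce
      moreover have "?t \<circ> (?t \<circ> p) = p" by (simp add: fun_eq_iff)
      ultimately show "\<exists>ts. set ts \<subseteq> transps d \<and> foldr (\<circ>) ts id = p \<and> length ts + num_orbs {1..d} p = d"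
        using ts by (intro exI[of _ "?t # ts"]) simp
    qed
  qed
  then show ?thesis using assms by (auto simp: Sym_def permutes_def)
qed

text \<open>The bridge from lengths to orbit counts, written as a sum because subtraction of
  naturals truncates.\<close>

lemma tlen_num_orbs:
  assumes "p \<in> Sym d"
  shows "tlen d p + num_orbs {1..d} p = d"
proof -
  obtain ts where ts: "set ts \<subseteq> transps d" "foldr (\<circ>) ts id = p" "length ts + num_orbs {1..d} p = d"
    using ex_word[OF assms] by blast
  have "tlen d p = length ts"
    unfolding tlen_def
  proof (rule Least_equality)
    show "\<exists>ts'. length ts' = length ts \<and> set ts' \<subseteq> transps d \<and> foldr (\<circ>) ts' id = p"
      using ts by blast
    fix n assume "\<exists>ts'. length ts' = n \<and> set ts' \<subseteq> transps d \<and> foldr (\<circ>) ts' id = p"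
    then obtain ts' where "length ts' = n" "set ts' \<subseteq> transps d" "foldr (\<circ>) ts' id = p" by blast
    then show "length ts \<le> n" using word_length_ge[of ts' d] ts(3) by simp
  qed
  then show ?thesis using ts(3) by simp
qed

lemma tlen_comp_le:
  assumes "p \<in> Sym d" "q \<in> Sym d"
  shows "tlen d (p \<circ> q) \<le> tlen d p + tlen d q"
proof -
  have "num_orbs {1..d} p + num_orbs {1..d} q \<le> num_orbs {1..d} (p \<circ> q) + card {1..d}"
    by (rule num_orbs_comp(1)) (use assms Sym_bij in auto)
  then show ?thesis
    using tlen_num_orbs[OF assms(1)] tlen_num_orbs[OF assms(2)] tlen_num_orbs[OF Sym_comp[OF assms]] by simp
qed

text \<open>In terms of orbit counts additivity of length is the equality case of
  \<open>num_orbs_comp\<close>: the factors of a geodesic product respect its cycles.\<close>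

lemma tlen_comp_eq_orb:
  assumes "p \<in> Sym d" "q \<in> Sym d" "tlen d (p \<circ> q) = tlen d p + tlen d q" "x \<in> {1..d}"
  shows "p x \<in> orb (p \<circ> q) x" "q x \<in> orb (p \<circ> q) x"
proof -
  have "p x \<in> orb (p \<circ> q) x \<and> q x \<in> orb (p \<circ> q) x"
  proof (rule num_orbs_comp(2))
    show "num_orbs {1..d} p + num_orbs {1..d} q = num_orbs {1..d} (p \<circ> q) + card {1..d}"
      using tlen_num_orbs[OF assms(1)] tlen_num_orbs[OF assms(2)]
        tlen_num_orbs[OF Sym_comp[OF assms(1,2)]] assms(3) by simp
  qed (use assms Sym_bij in auto)
  then show "p x \<in> orb (p \<circ> q) x" "q x \<in> orb (p \<circ> q) x" by auto
qed

lemma tlen_id [simp]: "tlen d id = 0"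
  using tlen_num_orbs[OF Sym_id, of d] num_orbs_id[of "{1..d}" id] by simp

lemma tlen_eq_0:
  assumes "p \<in> Sym d" "tlen d p = 0"
  shows "p = id"
proof -
  obtain ts where "length ts + num_orbs {1..d} p = d" "foldr (\<circ>) ts id = p"
    using ex_word[OF assms(1)] by blast
  then show ?thesis using tlen_num_orbs[OF assms(1)] assms(2) by simp
qed

lemma tlen_conj:
  assumes "g \<in> Sym d" "p \<in> Sym d"
  shows "tlen d (g \<circ> p \<circ> inv g) = tlen d p"
proof -
  have g: "g permutes {1..d}" using assms by (simp add: Sym_def)
  have "num_orbs (g ` {1..d}) (g \<circ> p \<circ> inv g) = num_orbs {1..d} p"
    by (rule num_orbs_image[OF Sym_bij[OF assms(2)]])
      (use g in \<open>auto simp: permutes_inverses permutes_inj_on\<close>)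
  then have "num_orbs {1..d} (g \<circ> p \<circ> inv g) = num_orbs {1..d} p" using permutes_image[OF g] by simp
  then show ?thesis
    using tlen_num_orbs[OF assms(2)] tlen_num_orbs[OF Sym_comp[OF Sym_comp[OF assms] Sym_inv[OF assms(1)]]]
    by simp
qed

section \<open>Convex hulls of subsets of the circle\<close>

definition circle_pt :: "real \<Rightarrow> complex" where
  "circle_pt t = cis (2 * pi * t)"

text \<open>Twice the signed area of the triangle \<open>p\<close>, \<open>q\<close>,
  \<open>r\<close>, positive for counterclockwise order. It is affine in each vertex, so its sign
  distinguishes the two sides of a line.\<close>

definition orient :: "complex \<Rightarrow> complex \<Rightarrow> complex \<Rightarrow> real" where
  "orient p q r = (Re q - Re p) * (Im r - Im p) - (Im q - Im p) * (Re r - Re p)"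

text \<open>The chord between parameters \<open>x\<close> and \<open>y\<close> is
  \<open>2 * sin (pi * (y - x))\<close> times the unit vector normal to the direction of angle
  \<open>pi * (x + y)\<close>. Two chords from \<open>a\<close> give the factor 4 and two of the
  sines; the third sine comes from the angle between their directions.\<close>

lemma orient_circle_pt: "orient (circle_pt a) (circle_pt b) (circle_pt c) = 4 * sin (pi * (b - a)) * sin (pi * (c - a)) * sin (pi * (c - b))"
proof -
  have 1: "cos (2 * pi * y) - cos (2 * pi * x) = - 2 * sin (pi * y + pi * x) * sin (pi * (y - x))" for x y
  proof -
    have "(2 * pi * y + 2 * pi * x) / 2 = pi * y + pi * x" "(2 * pi * x - 2 * pi * y) / 2 = - (pi * (y - x))"
      by (simp_all add: field_simps)
    then show ?thesis unfolding cos_diff_cos by (simp only: sin_minus)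
  qed
  have 2: "sin (2 * pi * y) - sin (2 * pi * x) = 2 * sin (pi * (y - x)) * cos (pi * y + pi * x)" for x y
  proof -
    have "(2 * pi * y + 2 * pi * x) / 2 = pi * y + pi * x" "(2 * pi * y - 2 * pi * x) / 2 = pi * (y - x)"
      by (simp_all add: field_simps)
    then show ?thesis unfolding sin_diff_sin by (simp only:)
  qed
  have "sin (pi * (c - b)) = sin ((pi * c + pi * a) - (pi * b + pi * a))" by (simp add: algebra_simps)
  then have 3: "sin (pi * (c - b)) = sin (pi * c + pi * a) * cos (pi * b + pi * a) - cos (pi * c + pi * a) * sin (pi * b + pi * a)"
    by (simp only: sin_diff)
  show ?thesis unfolding orient_def circle_pt_def cis.sel 1 2 3 by (simp add: algebra_simps)
qed

lemma orient_pos: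
  assumes "0 \<le> a" "a < b" "b < c" "c < 1"
  shows "orient (circle_pt a) (circle_pt b) (circle_pt c) > 0"
proof -
  have "sin (pi * t) > 0" if "0 < t" "t < 1" for t
    using that by (intro sin_gt_zero) auto
  then show ?thesis unfolding orient_circle_pt using assms by (intro mult_pos_pos) auto
qed

lemma orient_swap: "orient p q r = - orient q p r" "orient p q r = - orient p r q"
  by (simp_all add: orient_def algebra_simps)

lemma orient_halfplane: "orient p z q = Complex (Im q - Im p) (Re p - Re q) \<bullet> z - Complex (Im q - Im p) (Re p - Re q) \<bullet> p"
  by (simp add: orient_def inner_complex_def algebra_simps)

lemma hulls_separated:
  assumes "\<And>z. z \<in> S \<Longrightarrow> orient p z q > 0" "\<And>z. z \<in> T \<Longrightarrow> orient p z q < 0"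
  shows "convex hull S \<inter> convex hull T = {}"
proof -
  define v where "v = Complex (Im q - Im p) (Re p - Re q)"
  have "convex hull S \<subseteq> {z. v \<bullet> z > v \<bullet> p}"
    by (rule hull_minimal) (use assms(1) in \<open>auto simp: orient_halfplane v_def convex_halfspace_gt\<close>)
  moreover have "convex hull T \<subseteq> {z. v \<bullet> z < v \<bullet> p}"
    by (rule hull_minimal) (use assms(2) in \<open>auto simp: orient_halfplane v_def convex_halfspace_lt\<close>)
  ultimately show ?thesis by fastforce
qed

text \<open>No point of \<open>B\<close> lies between two points of \<open>C\<close>, since
  \<open>m\<close> lies below all of \<open>C\<close> and would complete a crossing. So
  \<open>C\<close> sits in a single gap of \<open>B\<close>, and the midpoints between
  \<open>C\<close> and the neighbouring points of \<open>B\<close> serve as \<open>p\<close> and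
  \<open>q\<close>.\<close>

lemma arc_between:
  fixes B C :: "real set"
  assumes "finite B" "finite C" "C \<noteq> {}" "B \<inter> C = {}" "B \<subseteq> {0..<1}" "C \<subseteq> {0..<1}"
    and m: "m \<in> B" "\<And>c. c \<in> C \<Longrightarrow> m < c"
    and nc: "\<And>a b c e. a \<in> B \<Longrightarrow> b \<in> C \<Longrightarrow> c \<in> B \<Longrightarrow> e \<in> C \<Longrightarrow> \<not> (a < b \<and> b < c \<and> c < e)"
  shows "\<exists>p q. 0 \<le> p \<and> p < q \<and> q < 1 \<and> (\<forall>c\<in>C. p < c \<and> c < q) \<and> (\<forall>b\<in>B. b < p \<or> q < b)"
proof -
  define c0 c1 where "c0 = Min C" and "c1 = Max C"
  have c: "c0 \<in> C" "c1 \<in> C" "\<And>c. c \<in> C \<Longrightarrow> c0 \<le> c" "\<And>c. c \<in> C \<Longrightarrow> c \<le> c1"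
    using assms by (auto simp: c0_def c1_def)
  \<comment> \<open>The value 1 is a sentinel for the case that no point of \<open>B\<close> lies
    above \<open>C\<close>; the midpoint with it still lies below 1. On the other side
    \<open>m\<close> ensures that \<open>L\<close> is nonempty.\<close>
  define L R where "L = {b \<in> B. b < c0}" and "R = insert 1 {b \<in> B. c1 < b}"
  have fin: "finite L" "finite R" using assms by (auto simp: L_def R_def)
  have mL: "m \<in> L" using m c by (auto simp: L_def)
  have l: "Max L \<in> L" "\<And>b. b \<in> L \<Longrightarrow> b \<le> Max L" using Max_in[OF fin(1)] Max_ge[OF fin(1)] mL by blast+
  have r: "Min R \<in> R" "\<And>b. b \<in> R \<Longrightarrow> Min R \<le> b"
    using Min_in[OF fin(2)] Min_le[OF fin(2)] by (auto simp: R_def)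
  have r1: "c1 < Min R" "Min R \<le> 1" using r assms(6) c by (auto simp: R_def)
  have l0: "Max L < c0" "0 \<le> Max L" using l assms(5) by (auto simp: L_def)
  have "b \<in> L \<or> b \<in> R" if "b \<in> B" for b
  proof -
    have "b \<noteq> c0" "b \<noteq> c1" using that c assms(4) by auto
    moreover have "\<not> (c0 < b \<and> b < c1)" using nc[OF m(1) c(1) that c(2)] m(2)[OF c(1)] by auto
    ultimately show ?thesis using that by (auto simp: L_def R_def)
  qed
  then have "b < (Max L + c0) / 2 \<or> (c1 + Min R) / 2 < b" if "b \<in> B" for b
    using that l(2)[of b] r(2)[of b] l0 r1 by fastforce
  moreover have "(Max L + c0) / 2 < c \<and> c < (c1 + Min R) / 2" if "c \<in> C" for c
    using c(3,4)[OF that] l0 r1 by auto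
  moreover have "(Max L + c0) / 2 < (c1 + Min R) / 2" using c(3)[OF c(2)] l0 r1 by auto
  moreover have "0 \<le> (Max L + c0) / 2" using l0 by auto
  moreover have "(c1 + Min R) / 2 < 1" using r1 by auto
  ultimately show ?thesis by blast
qed

text \<open>Whichever set contains the least point overall leaves the other one in a single gap, and
  the line through the endpoints of an arc within that gap separates the two sets strictly.\<close>

lemma hulls_disjoint:
  assumes fin: "finite B" "finite C" and ne: "B \<noteq> {}" "C \<noteq> {}" and disj: "B \<inter> C = {}"
    and sub: "B \<subseteq> {0..<1}" "C \<subseteq> {0..<1}"
    and nc: "\<And>a b c e. a \<in> B \<Longrightarrow> b \<in> C \<Longrightarrow> c \<in> B \<Longrightarrow> e \<in> C \<Longrightarrow> \<not> (a < b \<and> b < c \<and> c < e)"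
      "\<And>a b c e. a \<in> C \<Longrightarrow> b \<in> B \<Longrightarrow> c \<in> C \<Longrightarrow> e \<in> B \<Longrightarrow> \<not> (a < b \<and> b < c \<and> c < e)"
  shows "convex hull (circle_pt ` B) \<inter> convex hull (circle_pt ` C) = {}"
proof -
  have main: "convex hull (circle_pt ` C) \<inter> convex hull (circle_pt ` B) = {}"
    if "\<exists>p q. 0 \<le> p \<and> p < q \<and> q < 1 \<and> (\<forall>c\<in>C. p < c \<and> c < q) \<and> (\<forall>b\<in>B. b < p \<or> q < b)"
      "B \<subseteq> {0..<1}" for B C
  proof -
    obtain p q where pq: "0 \<le> p" "p < q" "q < 1" "\<And>c. c \<in> C \<Longrightarrow> p < c \<and> c < q" "\<And>b. b \<in> B \<Longrightarrow> b < p \<or> q < b"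
      using \<open>\<exists>p q. _ p q\<close> by blast
    show ?thesis
    proof (rule hulls_separated)
      fix z assume "z \<in> circle_pt ` C"
      then show "orient (circle_pt p) z (circle_pt q) > 0" using orient_pos pq by blast
    next
      fix z assume "z \<in> circle_pt ` B"
      then obtain b where b: "b \<in> B" "z = circle_pt b" by auto
      then have "0 \<le> b" "b < 1" using that(2) by auto
      then show "orient (circle_pt p) z (circle_pt q) < 0"
        using pq(5)[OF b(1)] orient_pos[of b p q] orient_pos[of p q b] orient_swap(1)[of "circle_pt p" z] orient_swap(2)[of "circle_pt p" z] pq b
        by auto
    qed
  qed
  define m where "m = Min (B \<union> C)"
  have m: "m \<in> B \<union> C" "\<And>x. x \<in> B \<union> C \<Longrightarrow> m \<le> x"
    using fin ne Min_in[of "B \<union> C"] by (auto simp: m_def)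
  show ?thesis
  proof (cases "m \<in> B")
    case True
    have "m < c" if "c \<in> C" for c using m(2)[of c] that True disj by (auto simp: order_le_less)
    from arc_between[OF fin ne(2) disj sub True this nc(1)]
    show ?thesis using main sub by blast
  next
    case False
    then have mC: "m \<in> C" using m by auto
    have "m < b" if "b \<in> B" for b using m(2)[of b] that mC disj by (auto simp: order_le_less)
    from arc_between[OF fin(2,1) ne(1) _ sub(2,1) mC this nc(2)] disj
    show ?thesis using main sub by blast
  qed
qed

text \<open>The chords from \<open>a\<close> to \<open>c\<close> and from \<open>b\<close> to
  \<open>e\<close> cross. The signed areas are the coefficients of the affine dependence of the four
  points; all are positive and the two sides have the same total weight, so division by this total
  gives a point common to both chords.\<close>

lemma hulls_meet:
  assumes "0 \<le> a" "a < b" "b < c" "c < e" "e < 1" and B: "circle_pt a \<in> B" "circle_pt c \<in> B" and C: "circle_pt b \<in> C" "circle_pt e \<in> C"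
  shows "convex hull B \<inter> convex hull C \<noteq> {}"
proof -
  define \<alpha> \<gamma> \<beta> \<epsilon> where "\<alpha> = orient (circle_pt b) (circle_pt c) (circle_pt e)" and "\<gamma> = orient (circle_pt a) (circle_pt b) (circle_pt e)"
    and "\<beta> = orient (circle_pt a) (circle_pt c) (circle_pt e)" and "\<epsilon> = orient (circle_pt a) (circle_pt b) (circle_pt c)"
  have pos: "\<alpha> > 0" "\<gamma> > 0" "\<beta> > 0" "\<epsilon> > 0"
    unfolding \<alpha>_def \<gamma>_def \<beta>_def \<epsilon>_def using assms by (auto intro!: orient_pos)
  have sum: "\<alpha> + \<gamma> = \<beta> + \<epsilon>"
    unfolding \<alpha>_def \<gamma>_def \<beta>_def \<epsilon>_def orient_def by (simp add: algebra_simps)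
  have eq: "\<alpha> *\<^sub>R circle_pt a + \<gamma> *\<^sub>R circle_pt c = \<beta> *\<^sub>R circle_pt b + \<epsilon> *\<^sub>R circle_pt e"
    unfolding \<alpha>_def \<gamma>_def \<beta>_def \<epsilon>_def orient_def by (rule complex_eqI) (simp_all add: algebra_simps)
  have hull: "(s / (s + t)) *\<^sub>R x + (t / (s + t)) *\<^sub>R y \<in> convex hull S"
    if "s > 0" "t > 0" "x \<in> S" "y \<in> S" for s t :: real and x y :: complex and S
  proof (rule convexD[OF convex_convex_hull])
    show "s / (s + t) + t / (s + t) = 1" using that by (simp add: add_divide_distrib[symmetric])
  qed (use that in \<open>auto intro: hull_inc\<close>)
  define T where "T = \<alpha> + \<gamma>"
  have "(\<alpha> / T) *\<^sub>R circle_pt a + (\<gamma> / T) *\<^sub>R circle_pt c = (\<beta> / T) *\<^sub>R circle_pt b + (\<epsilon> / T) *\<^sub>R circle_pt e"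
    using arg_cong[OF eq, of "\<lambda>z. (1 / T) *\<^sub>R z"] by (simp add: scaleR_add_right)
  moreover have "(\<alpha> / T) *\<^sub>R circle_pt a + (\<gamma> / T) *\<^sub>R circle_pt c \<in> convex hull B"
    unfolding T_def by (rule hull) (use pos B in auto)
  moreover have "(\<beta> / T) *\<^sub>R circle_pt b + (\<epsilon> / T) *\<^sub>R circle_pt e \<in> convex hull C"
    unfolding T_def sum by (rule hull) (use pos C in auto)
  ultimately show ?thesis by auto
qed

section \<open>The permutation of the circle carried by a factorization\<close>

lemma card_image_same_kernel:
  assumes "finite D" "\<And>x y. x \<in> D \<Longrightarrow> y \<in> D \<Longrightarrow> g x = g y \<longleftrightarrow> h x = h y"
  shows "card (g ` D) = card (h ` D)"
proof -
  have "bij_betw (\<lambda>z. h (inv_into D g z)) (g ` D) (h ` D)"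
  proof -
    have k: "inv_into D g (g x) \<in> D" "g (inv_into D g (g x)) = g x" if "x \<in> D" for x
      using that by (auto intro: inv_into_into f_inv_into_f)
    then have hk: "h (inv_into D g (g x)) = h x" if "x \<in> D" for x using assms(2) that by blast
    have "inj_on (\<lambda>z. h (inv_into D g z)) (g ` D)"
    proof (rule inj_onI)
      fix z w assume "z \<in> g ` D" "w \<in> g ` D" and e: "h (inv_into D g z) = h (inv_into D g w)"
      then obtain x y where "x \<in> D" "z = g x" "y \<in> D" "w = g y" by blast
      then show "z = w" using e hk assms(2) by simp
    qed
    moreover have "(\<lambda>z. h (inv_into D g z)) ` g ` D = h ` D"
      unfolding image_image by (rule image_cong[OF refl]) (rule hk)
    ultimately show ?thesis by (simp add: bij_betw_def)
  qed
  then show ?thesis by (rule bij_betw_same_card)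
qed

text \<open>Here \<open>H\<close> plays the role of the first return map of \<open>f\<close> to the copy \<open>\<iota> ` D\<close> of \<open>D\<close>.\<close>

lemma num_orbs_retract:
  assumes A: "finite A" "bij_betw f A A" and D: "finite D" "bij_betw H D D"
    and \<rho>: "\<And>x. x \<in> A \<Longrightarrow> \<rho> x \<in> D" "\<And>x. x \<in> A \<Longrightarrow> \<rho> (f x) \<in> orb H (\<rho> x)"
    and \<iota>: "\<And>y. y \<in> D \<Longrightarrow> \<iota> y \<in> A" "\<And>y. y \<in> D \<Longrightarrow> \<rho> (\<iota> y) = y" "\<And>x. x \<in> A \<Longrightarrow> \<iota> (\<rho> x) \<in> orb f x"
      "\<And>y. y \<in> D \<Longrightarrow> \<iota> (H y) \<in> orb f (\<iota> y)"
  shows "num_orbs A f = num_orbs D H"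
proof -
  have HD: "H y \<in> D" if "y \<in> D" for y using D that bij_betwE by blast
  have fA: "f x \<in> A" if "x \<in> A" for x using A that bij_betwE by blast
  have "orbs A f = (\<lambda>y. orb f (\<iota> y)) ` D"
  proof
    show "(\<lambda>y. orb f (\<iota> y)) ` D \<subseteq> orbs A f" using \<iota>(1) by (auto simp: orbs_def)
    show "orbs A f \<subseteq> (\<lambda>y. orb f (\<iota> y)) ` D"
    proof
      fix B assume "B \<in> orbs A f"
      then obtain x where x: "x \<in> A" "B = orb f x" by (auto simp: orbs_def)
      then have "B = orb f (\<iota> (\<rho> x))" using orb_eq[OF A x(1) \<iota>(3)[OF x(1)]] by simp
      then show "B \<in> (\<lambda>y. orb f (\<iota> y)) ` D" using \<rho>(1)[OF x(1)] by blast
    qed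
  qed
  moreover have "orb f (\<iota> y) = orb f (\<iota> z) \<longleftrightarrow> orb H y = orb H z" if y: "y \<in> D" and z: "z \<in> D" for y z
  proof
    assume "orb f (\<iota> y) = orb f (\<iota> z)"
    then have "\<iota> z \<in> orb f (\<iota> y)" using orb_refl[of "\<iota> z" f] by simp
    moreover have "orb f (\<iota> y) \<subseteq> {x \<in> A. \<rho> x \<in> orb H y}"
    proof (rule orb_least)
      fix x assume x: "x \<in> {x \<in> A. \<rho> x \<in> orb H y}"
      then have "\<rho> (f x) \<in> orb H (\<rho> x)" "orb H (\<rho> x) \<subseteq> orb H y" using \<rho>(2)[of x] orb_mono[of "\<rho> x" H y] by auto
      then show "f x \<in> {x \<in> A. \<rho> x \<in> orb H y}" using fA x by blast
    qed (use y \<iota> in auto)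
    ultimately have "\<rho> (\<iota> z) \<in> orb H y" by blast
    then have "z \<in> orb H y" using \<iota>(2)[OF z] by simp
    then show "orb H y = orb H z" by (rule orb_eq[OF D y, symmetric])
  next
    assume "orb H y = orb H z"
    then have "z \<in> orb H y" using orb_refl[of z H] by simp
    moreover have "orb H y \<subseteq> {w \<in> D. \<iota> w \<in> orb f (\<iota> y)}"
    proof (rule orb_least)
      fix w assume w: "w \<in> {w \<in> D. \<iota> w \<in> orb f (\<iota> y)}"
      then have "\<iota> (H w) \<in> orb f (\<iota> w)" "orb f (\<iota> w) \<subseteq> orb f (\<iota> y)" using \<iota>(4)[of w] orb_mono[of "\<iota> w" f "\<iota> y"] by auto
      then show "H w \<in> {w \<in> D. \<iota> w \<in> orb f (\<iota> y)}" using HD w by blast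
    qed (use y in auto)
    ultimately have "\<iota> z \<in> orb f (\<iota> y)" by blast
    then show "orb f (\<iota> y) = orb f (\<iota> z)" by (rule orb_eq[OF A \<iota>(1)[OF y], symmetric])
  qed
  ultimately show ?thesis
    unfolding num_orbs_def using card_image_same_kernel[OF D(1), of "\<lambda>y. orb f (\<iota> y)" "orb H"]
    by (simp add: orbs_def)
qed

text \<open>
  \<open>pt d j s\<close> is the parameter in \<open>[0, 1)\<close> of the \<open>j\<close>-th preimage of \<open>circle_pt s\<close> under the \<open>d\<close>-th
  power map; \<open>lab\<close> and \<open>par\<close> recover \<open>j\<close> and \<open>s\<close>.
\<close>

definition pt :: "nat \<Rightarrow> nat \<Rightarrow> real \<Rightarrow> real" where
  "pt d j s = (s + real j - 1) / real d"

definition lab :: "nat \<Rightarrow> real \<Rightarrow> nat" where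
  "lab d \<theta> = nat \<lfloor>real d * \<theta>\<rfloor> + 1"

definition par :: "nat \<Rightarrow> real \<Rightarrow> real" where
  "par d \<theta> = frac (real d * \<theta>)"

text \<open>Each fibre of the power map is permuted by \<open>u\<close> at its own level. Being
  defined for all parameters at once, one map serves every choice of levels.\<close>

definition lift :: "nat \<Rightarrow> (real \<Rightarrow> perm) \<Rightarrow> real \<Rightarrow> real" where
  "lift d u \<theta> = pt d (u (par d \<theta>) (lab d \<theta>)) (par d \<theta>)"

definition pts :: "nat \<Rightarrow> real set \<Rightarrow> real set" where
  "pts d S = (\<Union>s\<in>S. (\<lambda>j. pt d j s) ` {1..d})"

lemma pt_range:
  assumes "j \<in> {1..d}" "s \<in> {0..<1}"
  shows "pt d j s \<in> {0..<1}"
proof -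
  have "1 \<le> real j" "real j \<le> real d" "0 < real d" using assms by auto
  then show ?thesis using assms by (auto simp: pt_def field_simps)
qed

lemma par_lab_pt:
  assumes "j \<in> {1..d}" "s \<in> {0..<1}"
  shows "par d (pt d j s) = s" "lab d (pt d j s) = j"
proof -
  have "real d * pt d j s = s + real (j - 1)" using assms by (auto simp: pt_def of_nat_diff)
  then have e: "real d * pt d j s = s + of_int (int (j - 1))" by simp
  have f: "\<lfloor>real d * pt d j s\<rfloor> = int (j - 1)" unfolding e using assms by (simp add: floor_eq_iff)
  then have "nat \<lfloor>real d * pt d j s\<rfloor> = j - 1" by simp
  then show "lab d (pt d j s) = j" using assms by (simp add: lab_def)
  show "par d (pt d j s) = s" unfolding par_def frac_def f using e by simp
qed

lemma pt_par_lab: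
  assumes "d \<ge> 1" "\<theta> \<in> {0..<1}"
  shows "lab d \<theta> \<in> {1..d}" "par d \<theta> \<in> {0..<1}" "pt d (lab d \<theta>) (par d \<theta>) = \<theta>"
proof -
  have nn: "0 \<le> \<lfloor>real d * \<theta>\<rfloor>" using assms by simp
  have "real d * \<theta> < real d" using assms by simp
  then have "\<lfloor>real d * \<theta>\<rfloor> < int d" by (simp add: floor_less_iff)
  then have "nat \<lfloor>real d * \<theta>\<rfloor> < d" using nn by linarith
  then show "lab d \<theta> \<in> {1..d}" by (simp add: lab_def)
  show "par d \<theta> \<in> {0..<1}" by (simp add: par_def frac_lt_1)
  show "pt d (lab d \<theta>) (par d \<theta>) = \<theta>"
    using assms nn by (simp add: pt_def lab_def par_def frac_def field_simps)
qed

text \<open>The preimages labelled \<open>j\<close> fill the sector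
  \<open>[(j - 1) / d, j / d)\<close>, so the order is lexicographic, with the label before the
  level.\<close>

lemma pt_less_iff:
  assumes "d \<ge> 1" "s \<in> {0..<1}" "t \<in> {0..<1}"
  shows "pt d j s < pt d i t \<longleftrightarrow> j < i \<or> j = i \<and> s < t"
proof -
  have 1: "pt d j s < pt d i t \<longleftrightarrow> s + real j < t + real i" using assms by (simp add: pt_def divide_less_cancel)
  consider "j < i" | "j = i" | "i < j" by linarith
  then show ?thesis
  proof cases
    case 1
    then have "real j + 1 \<le> real i" by simp
    then show ?thesis using \<open>pt d j s < pt d i t \<longleftrightarrow> _\<close> 1 assms by auto
  next
    case 3
    then have "real i + 1 \<le> real j" by simp
    then show ?thesis using \<open>pt d j s < pt d i t \<longleftrightarrow> _\<close> 3 assms by auto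
  qed (use 1 in auto)
qed

lemma pt_le_iff:
  assumes "d \<ge> 1" "s \<in> {0..<1}" "t \<in> {0..<1}"
  shows "pt d j s \<le> pt d i t \<longleftrightarrow> j < i \<or> j = i \<and> s \<le> t"
  using pt_less_iff[OF assms(1,3,2), of i j] by (auto simp: linorder_not_less[symmetric])

lemma inj_pt: "d \<ge> 1 \<Longrightarrow> inj (\<lambda>j. pt d j s)"
  by (auto simp: inj_def pt_def)

lemma pt_disjoint:
  assumes "s \<in> {0..<1}" "t \<in> {0..<1}" "s \<noteq> t"
  shows "(\<lambda>j. pt d j s) ` {1..d} \<inter> (\<lambda>j. pt d j t) ` {1..d} = {}"
proof -
  have False if x: "x \<in> (\<lambda>j. pt d j s) ` {1..d}" "x \<in> (\<lambda>j. pt d j t) ` {1..d}" for x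
  proof -
    obtain j k where "j \<in> {1..d}" "k \<in> {1..d}" "x = pt d j s" "x = pt d k t" using x by blast
    then show False using par_lab_pt(1)[of j d s] par_lab_pt(1)[of k d t] assms by simp
  qed
  then show ?thesis by blast
qed

lemma lift_pt:
  assumes "j \<in> {1..d}" "s \<in> {0..<1}"
  shows "lift d u (pt d j s) = pt d (u s j) s"
  by (simp add: lift_def par_lab_pt[OF assms])

lemma orb_lift:
  assumes "u s \<in> Sym d" "j \<in> {1..d}" "s \<in> {0..<1}"
  shows "orb (lift d u) (pt d j s) = (\<lambda>i. pt d i s) ` orb (u s) j"
proof (rule orb_image[where h = "\<lambda>i. pt d i s", OF assms(2)])
  fix i assume i: "i \<in> {1..d}"
  show "u s i \<in> {1..d}" by (rule bij_betw_apply[OF Sym_bij[OF assms(1)] i])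
  show "lift d u (pt d i s) = pt d (u s i) s" by (rule lift_pt[OF i assms(3)])
qed

section \<open>Products of permutations and the long cycle\<close>

lemma foldr_Sym: "(\<And>s. s \<in> set L \<Longrightarrow> u s \<in> Sym d) \<Longrightarrow> foldr (\<circ>) (map u L) id \<in> Sym d"
proof (induction L)
  case Nil
  show ?case using Sym_id[of d] by (simp add: id_def)
next
  case (Cons s L)
  have "foldr (\<circ>) (map u (s # L)) id = u s \<circ> foldr (\<circ>) (map u L) id" by simp
  moreover have "foldr (\<circ>) (map u L) id \<in> Sym d" by (rule Cons.IH) (rule Cons.prems, simp)
  moreover have "u s \<in> Sym d" by (rule Cons.prems) simp
  ultimately show ?case using Sym_comp by metis
qed

lemma Sym_inv_comp: "p \<in> Sym d \<Longrightarrow> q \<in> Sym d \<Longrightarrow> inv (p \<circ> q) x = inv q (inv p x)"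
  by (simp add: Sym_def o_inv_distrib permutes_bij)

lemma Sym_inv_app: "p \<in> Sym d \<Longrightarrow> p (inv p x) = x" "p \<in> Sym d \<Longrightarrow> inv p (p x) = x"
  by (auto simp: Sym_def permutes_inverses)

lemma Sym_in: "p \<in> Sym d \<Longrightarrow> x \<in> {1..d} \<Longrightarrow> p x \<in> {1..d}"
  by (simp only: Sym_def mem_Collect_eq permutes_in_image)

lemma long_cycle_nxt: "j \<in> {1..d} \<Longrightarrow> long_cycle d j = nxt {1..d} j"
proof -
  assume j: "j \<in> {1..d}"
  have "nxt {1..d} j = long_cycle d j"
    by (subst nxt_iff[OF _ j]) (use j in \<open>auto simp: long_cycle_def\<close>)
  then show ?thesis by simp
qed

lemma long_cycle_Sym: "d \<ge> 1 \<Longrightarrow> long_cycle d \<in> Sym d"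
proof -
  assume d: "d \<ge> 1"
  have "bij_betw (long_cycle d) {1..d} {1..d}"
    using bij_nxt[of "{1..d}"] bij_betw_cong[of "{1..d}" "long_cycle d" "nxt {1..d}"] long_cycle_nxt by blast
  moreover have "long_cycle d x = x" if "x \<notin> {1..d}" for x
    using that d by (auto simp: long_cycle_def)
  ultimately show ?thesis unfolding Sym_def using bij_imp_permutes by blast
qed

lemma tlen_long_cycle:
  assumes d: "d \<ge> 1"
  shows "tlen d (long_cycle d) + 1 = d"
proof -
  have "num_orbs {1..d} (long_cycle d) = num_orbs {1..d} (nxt {1..d})"
    by (rule num_orbs_cong) (use long_cycle_nxt Sym_in[OF long_cycle_Sym[OF d]] in blast)+
  then show ?thesis using num_orbs_nxt[of "{1..d}"] assms tlen_num_orbs[OF long_cycle_Sym[OF d]] by simp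
qed

section \<open>The lifted permutation over a finite list of levels\<close>

context
  fixes d :: nat and L :: "real list" and u :: "real \<Rightarrow> perm"
  assumes d: "d \<ge> 1" and L: "L \<noteq> []" "sorted_wrt (<) L" "set L \<subseteq> {0..<1}"
    and u: "\<And>s. s \<in> set L \<Longrightarrow> u s \<in> Sym d"
begin

lemma L01: "s \<in> set L \<Longrightarrow> s \<in> {0..<1}" using L by blast

lemma finite_pts: "finite (pts d (set L))" by (simp add: pts_def)

lemma ptsI: "j \<in> {1..d} \<Longrightarrow> s \<in> set L \<Longrightarrow> pt d j s \<in> pts d (set L)"
  unfolding pts_def by blast

lemma ptsE:
  assumes "x \<in> pts d (set L)"
  obtains j i where "j \<in> {1..d}" "i < length L" "x = pt d j (L ! i)"
  using assms by (auto simp: pts_def in_set_conv_nth)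

lemma nth_mono_L: "i < length L \<Longrightarrow> k < length L \<Longrightarrow> L ! i < L ! k \<longleftrightarrow> i < k"
  using sorted_wrt_nth_less[OF L(2), of i k] sorted_wrt_nth_less[OF L(2), of k i]
  by (cases i k rule: linorder_cases) auto

lemma nth_le_L: "i < length L \<Longrightarrow> k < length L \<Longrightarrow> L ! i \<le> L ! k \<longleftrightarrow> i \<le> k"
  using nth_mono_L[of k i] by (auto simp: linorder_not_less[symmetric])

lemma nth_L01: "i < length L \<Longrightarrow> L ! i \<in> {0..<1}" using L01 by simp

lemma nxt_pts:
  assumes "j \<in> {1..d}" "Suc i < length L"
  shows "nxt (pts d (set L)) (pt d j (L ! i)) = pt d j (L ! Suc i)"
proof (subst nxt_iff[OF finite_pts])
  show "pt d j (L ! i) \<in> pts d (set L)" using assms by (intro ptsI) auto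
  have 1: "pt d j (L ! Suc i) \<in> pts d (set L)" using assms by (intro ptsI) auto
  have 2: "pt d j (L ! i) < pt d j (L ! Suc i)"
    using pt_less_iff[OF d nth_L01 nth_L01] nth_mono_L assms by simp
  have 3: "pt d j (L ! Suc i) \<le> z" if z: "z \<in> pts d (set L)" "pt d j (L ! i) < z" for z
  proof -
    obtain k m where km: "k \<in> {1..d}" "m < length L" "z = pt d k (L ! m)" using z(1) by (rule ptsE)
    have "j < k \<or> j = k \<and> i < m"
      using z(2) km assms pt_less_iff[OF d nth_L01 nth_L01, of i m j k] nth_mono_L[of i m] by simp
    then show ?thesis
      using km assms pt_le_iff[OF d nth_L01 nth_L01, of "Suc i" m j k] nth_le_L[of "Suc i" m] by auto
  qed
  show "pt d j (L ! Suc i) \<in> pts d (set L) \<and> (pt d j (L ! i) < pt d j (L ! Suc i) \<and>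
    (\<forall>z\<in>pts d (set L). pt d j (L ! i) < z \<longrightarrow> pt d j (L ! Suc i) \<le> z) \<or>
    (\<forall>z\<in>pts d (set L). pt d j (L ! Suc i) \<le> z \<and> z \<le> pt d j (L ! i)))"
    using 1 2 3 by blast
qed

text \<open>Past the last level the successor enters the next of the \<open>d\<close> sectors at its
  first level. This is where the long cycle enters: it is the holonomy of one turn through the
  levels.\<close>

lemma nxt_pts_last:
  assumes "j \<in> {1..d}"
  shows "nxt (pts d (set L)) (pt d j (last L)) = pt d (long_cycle d j) (hd L)"
proof (subst nxt_iff[OF finite_pts])
  let ?P = "pts d (set L)" and ?i = "length L - 1"
  have i: "?i < length L" "last L = L ! ?i" "hd L = L ! 0" "0 < length L"
    using L by (auto simp: last_conv_nth hd_conv_nth)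
  show "pt d j (last L) \<in> ?P" using assms L by (intro ptsI) auto
  have cj: "long_cycle d j \<in> {1..d}" using Sym_in[OF long_cycle_Sym[OF d] assms] .
  have 1: "pt d (long_cycle d j) (hd L) \<in> ?P" using cj L by (intro ptsI) auto
  show "pt d (long_cycle d j) (hd L) \<in> ?P \<and> (pt d j (last L) < pt d (long_cycle d j) (hd L) \<and>
    (\<forall>z\<in>?P. pt d j (last L) < z \<longrightarrow> pt d (long_cycle d j) (hd L) \<le> z) \<or>
    (\<forall>z\<in>?P. pt d (long_cycle d j) (hd L) \<le> z \<and> z \<le> pt d j (last L)))"
  proof (cases "j < d")
    case True
    then have c: "long_cycle d j = Suc j" using assms by (simp add: long_cycle_def)
    have 2: "pt d j (last L) < pt d (Suc j) (hd L)"
      unfolding i(2,3) using pt_less_iff[OF d nth_L01[OF i(1)] nth_L01[OF i(4)]] by simp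
    have "pt d (Suc j) (hd L) \<le> z" if z: "z \<in> ?P" "pt d j (last L) < z" for z
    proof -
      obtain k m where km: "k \<in> {1..d}" "m < length L" "z = pt d k (L ! m)" using z(1) by (rule ptsE)
      have "j < k \<or> j = k \<and> ?i < m"
        using z(2) km i pt_less_iff[OF d nth_L01[OF i(1)] nth_L01[OF km(2)], of j k] nth_mono_L[OF i(1) km(2)] by simp
      then show ?thesis
        using km i pt_le_iff[OF d nth_L01[OF i(4)] nth_L01[OF km(2)], of "Suc j" k] nth_le_L[OF i(4) km(2)] by auto
    qed
    then show ?thesis using 1 2 c by auto
  next
    case False
    then have j: "j = d" and c: "long_cycle d j = 1" using assms d by (auto simp: long_cycle_def)
    have "pt d 1 (hd L) \<le> z \<and> z \<le> pt d d (last L)" if z: "z \<in> ?P" for z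
    proof -
      obtain k m where km: "k \<in> {1..d}" "m < length L" "z = pt d k (L ! m)" using z by (rule ptsE)
      have "m \<le> ?i" using km by simp
      then show ?thesis unfolding km(3) i(2,3)
        pt_le_iff[OF d nth_L01[OF i(4)] nth_L01[OF km(2)]] pt_le_iff[OF d nth_L01[OF km(2)] nth_L01[OF i(1)]]
        using km(1) nth_le_L[OF i(4) km(2)] nth_le_L[OF km(2) i(1)] by auto
    qed
    then show ?thesis using 1 c j by simp
  qed
qed

text \<open>Formulated for arbitrary \<open>v\<close> because the complementary permutation is built
  from the lift of the inverses.\<close>

lemma lift_bij:
  assumes "\<And>s. s \<in> set L \<Longrightarrow> v s \<in> Sym d"
  shows "bij_betw (lift d v) (pts d (set L)) (pts d (set L))"
proof -
  have "lift d v ` pts d (set L) \<subseteq> pts d (set L)"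
    using lift_pt L01 Sym_in[OF assms] by (fastforce simp: pts_def)
  moreover have "inj_on (lift d v) (pts d (set L))"
  proof (rule inj_onI)
    fix x y assume x: "x \<in> pts d (set L)" and y: "y \<in> pts d (set L)" and e: "lift d v x = lift d v y"
    obtain j i where x': "j \<in> {1..d}" "i < length L" "x = pt d j (L ! i)" using x by (rule ptsE)
    obtain k m where y': "k \<in> {1..d}" "m < length L" "y = pt d k (L ! m)" using y by (rule ptsE)
    have e': "pt d (v (L ! i) j) (L ! i) = pt d (v (L ! m) k) (L ! m)"
      using e lift_pt[OF x'(1) nth_L01[OF x'(2)]] lift_pt[OF y'(1) nth_L01[OF y'(2)]] x' y' by simp
    have vi: "v (L ! i) \<in> Sym d" "v (L ! m) \<in> Sym d" using assms x' y' by auto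
    have "L ! i = L ! m" "v (L ! i) j = v (L ! m) k"
      using par_lab_pt[OF Sym_in[OF vi(1) x'(1)] nth_L01[OF x'(2)]]
        par_lab_pt[OF Sym_in[OF vi(2) y'(1)] nth_L01[OF y'(2)]] e' by auto
    then show "x = y" using x' y' Sym_inv_app(2)[OF vi(2)] by metis
  qed
  ultimately show ?thesis using endo_inj_surj[OF finite_pts] by (simp add: bij_betw_def)
qed

lemma num_orbs_lift: "num_orbs (pts d (set L)) (lift d u) = (\<Sum>s\<in>set L. num_orbs {1..d} (u s))"
proof -
  have inj: "inj_on (\<lambda>j. pt d j s) {1..d}" for s using inj_pt[OF d] by (rule inj_on_subset) auto
  have lp: "lift d u (pt d j s) = pt d (u s j) s" if "s \<in> set L" "j \<in> {1..d}" for s j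
    using lift_pt[OF that(2) L01[OF that(1)]] .
  have "num_orbs (pts d (set L)) (lift d u) = (\<Sum>s\<in>set L. num_orbs ((\<lambda>j. pt d j s) ` {1..d}) (lift d u))"
    unfolding pts_def
  proof (rule num_orbs_Union)
    fix s assume s: "s \<in> set L"
    have "inj_on (lift d u) ((\<lambda>j. pt d j s) ` {1..d})"
      by (rule inj_on_subset[OF bij_betw_imp_inj_on[OF lift_bij[OF u]]]) (use s ptsI in auto)
    moreover have "lift d u ` (\<lambda>j. pt d j s) ` {1..d} \<subseteq> (\<lambda>j. pt d j s) ` {1..d}"
      using lp[OF s] Sym_in[OF u[OF s]] by force
    ultimately show "bij_betw (lift d u) ((\<lambda>j. pt d j s) ` {1..d}) ((\<lambda>j. pt d j s) ` {1..d})"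
      unfolding bij_betw_def using endo_inj_surj[OF finite_imageI[OF finite_atLeastAtMost]] by blast
  next
    fix s t assume "s \<in> set L" "t \<in> set L" "s \<noteq> t"
    then show "(\<lambda>j. pt d j s) ` {1..d} \<inter> (\<lambda>j. pt d j t) ` {1..d} = {}"
      using pt_disjoint L01 by blast
  qed auto
  also have "\<dots> = (\<Sum>s\<in>set L. num_orbs {1..d} (u s))"
  proof (rule sum.cong[OF refl])
    fix s assume s: "s \<in> set L"
    show "num_orbs ((\<lambda>j. pt d j s) ` {1..d}) (lift d u) = num_orbs {1..d} (u s)"
      by (rule num_orbs_image[OF Sym_bij[OF u[OF s]] inj]) (rule lp[OF s])
  qed
  finally show ?thesis .
qed

lemma card_pts: "card (pts d (set L)) = d * length L"
proof -
  have inj: "inj_on (\<lambda>j. pt d j s) {1..d}" for s using inj_pt[OF d] by (rule inj_on_subset) auto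
  have "card (pts d (set L)) = (\<Sum>s\<in>set L. card ((\<lambda>j. pt d j s) ` {1..d}))"
    unfolding pts_def
  proof (rule card_UN_disjoint)
    show "\<forall>s\<in>set L. \<forall>t\<in>set L. s \<noteq> t \<longrightarrow> (\<lambda>j. pt d j s) ` {1..d} \<inter> (\<lambda>j. pt d j t) ` {1..d} = {}"
      using pt_disjoint L01 by blast
  qed auto
  also have "\<dots> = (\<Sum>s\<in>set L. d)"
    by (rule sum.cong[OF refl]) (use card_image[OF inj] in simp)
  also have "\<dots> = d * card (set L)" by simp
  also have "card (set L) = length L"
    using L(2) distinct_card[of L] strict_sorted_iff by blast
  finally show ?thesis .
qed

text \<open>
  \<open>inv (tail_prod s)\<close> transports a label from level \<open>s\<close> to the last level, following the orbit of
  the complementary permutation.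
\<close>

definition tail_prod :: "real \<Rightarrow> perm" where
  "tail_prod s = foldr (\<circ>) (map u (filter (\<lambda>t. s < t) L)) id"

lemma filter_L: "i < length L \<Longrightarrow> filter (\<lambda>t. L ! i < t) L = drop (Suc i) L"
proof -
  assume i: "i < length L"
  have "filter (\<lambda>t. L ! i < t) (take (Suc i) L @ drop (Suc i) L) = drop (Suc i) L"
    unfolding filter_append
  proof -
    have "filter (\<lambda>t. L ! i < t) (take (Suc i) L) = []"
      unfolding filter_empty_conv
    proof
      fix t assume "t \<in> set (take (Suc i) L)"
      then obtain k where k: "k < length (take (Suc i) L)" "t = take (Suc i) L ! k" by (metis in_set_conv_nth)
      then have "k \<le> i" "k < length L" "t = L ! k" by auto
      then show "\<not> L ! i < t" using nth_le_L[of k i] i by (simp add: linorder_not_less)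
    qed
    moreover have "filter (\<lambda>t. L ! i < t) (drop (Suc i) L) = drop (Suc i) L"
      unfolding filter_id_conv
    proof
      fix t assume "t \<in> set (drop (Suc i) L)"
      then obtain k where k: "k < length (drop (Suc i) L)" "t = drop (Suc i) L ! k" by (metis in_set_conv_nth)
      then have "Suc i + k < length L" "t = L ! (Suc i + k)" by auto
      then show "L ! i < t" using nth_mono_L[of i "Suc i + k"] i by simp
    qed
    ultimately show "filter (\<lambda>t. L ! i < t) (take (Suc i) L) @ filter (\<lambda>t. L ! i < t) (drop (Suc i) L) = drop (Suc i) L"
      by simp
  qed
  then show ?thesis by simp
qed

lemma tail_prod_Sym: "tail_prod s \<in> Sym d"
  unfolding tail_prod_def by (rule foldr_Sym) (use u in auto)

lemma tail_prod_Suc: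
  assumes "Suc i < length L"
  shows "tail_prod (L ! i) = u (L ! Suc i) \<circ> tail_prod (L ! Suc i)"
proof -
  have "drop (Suc i) L = L ! Suc i # drop (Suc (Suc i)) L" using assms by (simp add: Cons_nth_drop_Suc)
  then show ?thesis using assms by (simp add: tail_prod_def filter_L)
qed

lemma tail_prod_last: "tail_prod (last L) = id"
proof -
  have i: "length L - 1 < length L" and e: "last L = L ! (length L - 1)"
    using L(1) by (simp_all add: last_conv_nth)
  have "filter (\<lambda>t. last L < t) L = []" unfolding e filter_L[OF i] by simp
  then show ?thesis by (simp add: tail_prod_def)
qed

lemma prod_eq: "foldr (\<circ>) (map u L) id = u (hd L) \<circ> tail_prod (hd L)"
proof -
  have e: "tail_prod (hd L) = foldr (\<circ>) (map u (tl L)) id"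
    using L(1) filter_L[of 0] by (simp add: tail_prod_def hd_conv_nth drop_Suc)
  obtain s L' where "L = s # L'" using L(1) by (cases L) auto
  then show ?thesis unfolding e by simp
qed

text \<open>With k levels, \<open>lift d u\<close> has dk minus the sum of the lengths many orbits,
  and its complement has as many as \<open>inv h \<circ> long_cycle d\<close>, namely d minus the
  length of that permutation. Equating the total with dk + 1 cancels dk and leaves the stated
  equation.\<close>

lemma nc_perm_lift_iff:
  "nc_perm (pts d (set L)) (lift d u) \<longleftrightarrow>
    (\<Sum>s\<leftarrow>L. tlen d (u s)) + tlen d (inv (foldr (\<circ>) (map u L) id) \<circ> long_cycle d) + 1 = d"
proof -
  define A where "A = pts d (set L)"
  define h where "h = foldr (\<circ>) (map u L) id"
  define H where "H = inv h \<circ> long_cycle d"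
  \<comment> \<open>On \<open>A\<close> this is the inverse of \<open>lift d u\<close> after the
    cyclic successor, since lifting commutes with inversion level by level.\<close>
  define Y where "Y = lift d (\<lambda>s. inv (u s)) \<circ> nxt A"
  have h: "h \<in> Sym d" unfolding h_def by (rule foldr_Sym) (rule u)
  have HS: "H \<in> Sym d" unfolding H_def by (rule Sym_comp[OF Sym_inv[OF h] long_cycle_Sym[OF d]])
  have finA: "finite A" unfolding A_def by (rule finite_pts)
  have neA: "A \<noteq> {}" using ptsI[of 1 "hd L"] L(1) d by (auto simp: A_def)
  have bX: "bij_betw (lift d u) A A" unfolding A_def by (rule lift_bij) (rule u)
  have bY: "bij_betw Y A A" unfolding Y_def
    by (rule bij_betw_trans[OF bij_nxt[OF finA]]) (unfold A_def, rule lift_bij, rule Sym_inv, rule u)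
  have XY: "lift d u (Y x) = nxt A x" if x: "x \<in> A" for x
  proof -
    have "nxt A x \<in> pts d (set L)" using nxt_in[OF finA x] by (simp add: A_def)
    then obtain j i where n: "j \<in> {1..d}" "i < length L" "nxt A x = pt d j (L ! i)" by (rule ptsE)
    have ui: "u (L ! i) \<in> Sym d" using u n by simp
    show ?thesis unfolding Y_def comp_def n(3) lift_pt[OF n(1) nth_L01[OF n(2)]]
        lift_pt[OF Sym_in[OF Sym_inv[OF ui] n(1)] nth_L01[OF n(2)]] Sym_inv_app[OF ui] ..
  qed
  define \<rho> where "\<rho> x = inv (tail_prod (par d x)) (lab d x)" for x
  define \<iota> where "\<iota> j = pt d j (last L)" for j
  have lastL: "last L \<in> set L" "last L = L ! (length L - 1)" "length L - 1 < length L"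
    using L(1) by (auto simp: last_conv_nth)
  have \<rho>pt: "\<rho> (pt d j s) = inv (tail_prod s) j" if "j \<in> {1..d}" "s \<in> set L" for j s
    using par_lab_pt[OF that(1) L01[OF that(2)]] by (simp add: \<rho>_def)
  have \<rho>\<iota>: "\<rho> (\<iota> j) = j" if "j \<in> {1..d}" for j
    using \<rho>pt[OF that lastL(1)] by (simp add: \<iota>_def tail_prod_last)
  have Ystep: "Y (pt d j (L ! i)) = pt d (inv (u (L ! Suc i)) j) (L ! Suc i)"
    "\<rho> (Y (pt d j (L ! i))) = \<rho> (pt d j (L ! i))" if ji: "j \<in> {1..d}" "Suc i < length L" for j i
  proof -
    have ui: "u (L ! Suc i) \<in> Sym d" using u ji by simp
    show e: "Y (pt d j (L ! i)) = pt d (inv (u (L ! Suc i)) j) (L ! Suc i)"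
      unfolding Y_def comp_def A_def nxt_pts[OF ji] by (rule lift_pt[OF ji(1) nth_L01[OF ji(2)]])
    have "\<rho> (pt d (inv (u (L ! Suc i)) j) (L ! Suc i)) = inv (tail_prod (L ! Suc i)) (inv (u (L ! Suc i)) j)"
      by (rule \<rho>pt[OF Sym_in[OF Sym_inv[OF ui] ji(1)]]) (use ji in simp)
    also have "\<dots> = inv (tail_prod (L ! i)) j"
      unfolding tail_prod_Suc[OF ji(2)] by (rule Sym_inv_comp[OF ui tail_prod_Sym, symmetric])
    also have "\<dots> = \<rho> (pt d j (L ! i))" by (rule \<rho>pt[OF ji(1), symmetric]) (use ji in simp)
    finally show "\<rho> (Y (pt d j (L ! i))) = \<rho> (pt d j (L ! i))" unfolding e .
  qed
  \<comment> \<open>From the last level \<open>Y\<close> wraps around with the label advanced by the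
    long cycle, and climbing through all levels undoes the whole product. So one full turn acts on
    labels as \<open>H\<close>.\<close>
  have Ylast: "\<rho> (Y (\<iota> j)) = H j" if j: "j \<in> {1..d}" for j
  proof -
    have uh: "u (hd L) \<in> Sym d" using u L(1) by simp
    have cj: "long_cycle d j \<in> {1..d}" by (rule Sym_in[OF long_cycle_Sym[OF d] j])
    have h0: "hd L \<in> set L" using L(1) by simp
    have e: "Y (\<iota> j) = pt d (inv (u (hd L)) (long_cycle d j)) (hd L)"
      unfolding Y_def comp_def A_def \<iota>_def nxt_pts_last[OF j] by (rule lift_pt[OF cj L01[OF h0]])
    have "\<rho> (Y (\<iota> j)) = inv (tail_prod (hd L)) (inv (u (hd L)) (long_cycle d j))"
      unfolding e by (rule \<rho>pt[OF Sym_in[OF Sym_inv[OF uh] cj] h0])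
    also have "\<dots> = inv h (long_cycle d j)"
      unfolding h_def prod_eq by (rule Sym_inv_comp[OF uh tail_prod_Sym, symmetric])
    finally show ?thesis by (simp add: H_def)
  qed
  have YA: "Y x \<in> A" if "x \<in> A" for x using bY that bij_betwE by blast
  have \<iota>A: "\<iota> j \<in> A" if "j \<in> {1..d}" for j using ptsI[OF that lastL(1)] by (simp add: \<iota>_def A_def)
  \<comment> \<open>The induction is on the number of levels still above \<open>i\<close>: one
    application of \<open>Y\<close> goes up one level and leaves the transported label
    unchanged.\<close>
  have climb: "\<iota> (\<rho> (pt d j (L ! i))) \<in> orb Y (pt d j (L ! i))" if "j \<in> {1..d}" "i < length L" for i j
    using that
  proof (induction "length L - 1 - i" arbitrary: i j)
    case 0
    then have "i = length L - 1" by simp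
    then have e: "pt d j (L ! i) = \<iota> j" using lastL(2) by (simp add: \<iota>_def)
    show ?case unfolding e \<rho>\<iota>[OF 0(2)] by simp
  next
    case (Suc n)
    have ji: "j \<in> {1..d}" "Suc i < length L" using Suc by auto
    have ui: "u (L ! Suc i) \<in> Sym d" using u ji by simp
    have "n = length L - 1 - Suc i" using Suc.hyps(2) by simp
    from Suc.hyps(1)[OF this Sym_in[OF Sym_inv[OF ui] ji(1)] ji(2)]
    have "\<iota> (\<rho> (Y (pt d j (L ! i)))) \<in> orb Y (Y (pt d j (L ! i)))" unfolding Ystep(1)[OF ji] .
    then show ?case unfolding Ystep(2)[OF ji]
      using orb_mono[OF orb_step[OF orb_refl], of Y "pt d j (L ! i)"] by blast
  qed
  have climb': "\<iota> (\<rho> x) \<in> orb Y x" if x: "x \<in> A" for x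
  proof -
    obtain j i where "j \<in> {1..d}" "i < length L" "x = pt d j (L ! i)"
      using x unfolding A_def by (rule ptsE)
    then show ?thesis using climb by simp
  qed
  have "num_orbs A Y = num_orbs {1..d} H"
  proof (rule num_orbs_retract[OF finA bY _ Sym_bij[OF HS], of \<rho> \<iota>])
    fix x assume x: "x \<in> A"
    obtain j i where ji: "j \<in> {1..d}" "i < length L" "x = pt d j (L ! i)"
      using x unfolding A_def by (rule ptsE)
    have "\<rho> x = inv (tail_prod (L ! i)) j" unfolding ji(3) by (rule \<rho>pt[OF ji(1)]) (use ji in simp)
    then show "\<rho> x \<in> {1..d}" using Sym_in[OF Sym_inv[OF tail_prod_Sym] ji(1)] by simp
    show "\<rho> (Y x) \<in> orb H (\<rho> x)"
    proof (cases "Suc i < length L")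
      case True
      then show ?thesis using Ystep(2)[OF ji(1) True] ji(3) by simp
    next
      case False
      then have "i = length L - 1" using ji(2) by simp
      then have "x = \<iota> j" using ji(3) lastL(2) by (simp add: \<iota>_def)
      then show ?thesis using Ylast[OF ji(1)] \<rho>\<iota>[OF ji(1)] orb_step[of j H j] by simp
    qed
    show "\<iota> (\<rho> x) \<in> orb Y x" by (rule climb'[OF x])
  next
    fix j assume j: "j \<in> {1..d}"
    show "\<iota> j \<in> A" "\<rho> (\<iota> j) = j" using \<iota>A \<rho>\<iota> j by auto
    have "\<iota> (\<rho> (Y (\<iota> j))) \<in> orb Y (Y (\<iota> j))" by (rule climb'[OF YA[OF \<iota>A[OF j]]])
    then show "\<iota> (H j) \<in> orb Y (\<iota> j)" unfolding Ylast[OF j]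
      using orb_mono[OF orb_step[OF orb_refl], of Y "\<iota> j"] by blast
  qed simp
  moreover have "num_orbs A (lift d u) = (\<Sum>s\<in>set L. num_orbs {1..d} (u s))"
    unfolding A_def by (rule num_orbs_lift)
  moreover have "(\<Sum>s\<in>set L. tlen d (u s)) + (\<Sum>s\<in>set L. num_orbs {1..d} (u s)) = d * length L"
  proof -
    have "(\<Sum>s\<in>set L. tlen d (u s)) + (\<Sum>s\<in>set L. num_orbs {1..d} (u s)) = (\<Sum>s\<in>set L. d)"
      unfolding sum.distrib[symmetric] by (rule sum.cong[OF refl]) (rule tlen_num_orbs[OF u])
    also have "\<dots> = d * card (set L)" by simp
    also have "card (set L) = length L" using L(2) distinct_card[of L] strict_sorted_iff by blast
    finally show ?thesis .
  qed
  moreover have "(\<Sum>s\<leftarrow>L. tlen d (u s)) = (\<Sum>s\<in>set L. tlen d (u s))"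
    using L(2) strict_sorted_iff by (metis sum_list_distinct_conv_sum_set)
  moreover have "tlen d H + num_orbs {1..d} H = d" by (rule tlen_num_orbs[OF HS])
  moreover have "num_orbs A (lift d u) + num_orbs A Y = card A + 1 \<longleftrightarrow> nc_perm A (lift d u)"
    by (rule num_orbs_nc_perm[OF finA neA bX bY XY])
  moreover have "card A = d * length L" unfolding A_def by (rule card_pts)
  ultimately have "nc_perm A (lift d u) \<longleftrightarrow> (\<Sum>s\<leftarrow>L. tlen d (u s)) + tlen d H + 1 = d" by linarith
  then show ?thesis by (simp only: A_def H_def h_def)
qed

end

section \<open>Noncrossing partitions of the circle\<close>

lemma circle_pt_arg: "t \<in> {0..<1} \<Longrightarrow> Arg2pi (circle_pt t) = 2 * pi * t"
proof (rule Arg2pi_unique[of 1])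
  assume t: "t \<in> {0..<1}"
  show "complex_of_real 1 * exp (\<i> * complex_of_real (2 * pi * t)) = circle_pt t"
    by (simp add: circle_pt_def cis_conv_exp)
  have "2 * pi * t < 2 * pi * 1" using t by (intro mult_strict_left_mono) auto
  then show "2 * pi * t < 2 * pi" by simp
  show "0 \<le> 2 * pi * t" using t by simp
qed simp

lemma circle_pt_inj: "s \<in> {0..<1} \<Longrightarrow> t \<in> {0..<1} \<Longrightarrow> circle_pt s = circle_pt t \<Longrightarrow> s = t"
proof -
  assume "s \<in> {0..<1}" "t \<in> {0..<1}" "circle_pt s = circle_pt t"
  then have "2 * pi * s = 2 * pi * t" by (metis circle_pt_arg)
  then show ?thesis by simp
qed

lemma circle_pt_sphere [simp]: "circle_pt t \<in> sphere 0 1"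
  by (simp add: circle_pt_def)

lemma circle_pt_surj:
  assumes "z \<in> sphere 0 1"
  obtains t where "t \<in> {0..<1}" "z = circle_pt t"
proof -
  have "z = cis (Arg2pi z)" using assms complex_norm_eq_1_exp[of z] by (simp add: cis_conv_exp)
  moreover have "0 \<le> Arg2pi z" "Arg2pi z < 2 * pi" using Arg2pi[of z] by auto
  ultimately show ?thesis using that[of "Arg2pi z / (2 * pi)"] by (simp add: circle_pt_def)
qed

lemma circ_param_circle_pt: "t \<in> {0..<1} \<Longrightarrow> circ_param (circle_pt t) = t"
  unfolding circ_param_def
proof (rule some_equality)
  assume t: "t \<in> {0..<1}"
  then show "0 \<le> t \<and> t < 1 \<and> circle_pt t = cis (2 * pi * t)" by (simp add: circle_pt_def)
  fix s assume "0 \<le> s \<and> s < 1 \<and> circle_pt t = cis (2 * pi * s)"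
  then show "s = t" using circle_pt_inj[of s t] t by (simp add: circle_pt_def)
qed

lemma to_circle_circle_pt: "t \<in> {0..<1} \<Longrightarrow> to_circle u (circle_pt t) = u t"
proof -
  assume t: "t \<in> {0..<1}"
  show ?thesis unfolding to_circle_def circ_param_circle_pt[OF t] if_P[OF circle_pt_sphere] ..
qed

lemma root_label_circle_pt: "t \<in> {0..<1} \<Longrightarrow> root_label d (circle_pt t) j = circle_pt (pt d j t)"
proof -
  assume t: "t \<in> {0..<1}"
  show ?thesis unfolding root_label_def circ_param_circle_pt[OF t] by (simp add: circle_pt_def pt_def)
qed

lemma circle_pt_pt_power:
  assumes "j \<in> {1..d}"
  shows "circle_pt (pt d j s) ^ d = circle_pt s"
proof -
  have "real d * (2 * pi * pt d j s) = 2 * pi * s + 2 * pi * real (j - 1)"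
  proof -
    have "real d * pt d j s = s + real (j - 1)" using assms by (simp add: pt_def of_nat_diff)
    then show ?thesis by (metis distrib_left mult.left_commute)
  qed
  then have "circle_pt (pt d j s) ^ d = cis (2 * pi * s + 2 * pi * real (j - 1))"
    by (simp only: circle_pt_def Complex.DeMoivre)
  also have "\<dots> = cis (2 * pi * s) * cis (2 * pi * real (j - 1))" by (simp only: cis_mult)
  also have "\<dots> = circle_pt s" unfolding cis_multiple_2pi[OF Ints_of_nat] by (simp add: circle_pt_def)
  finally show ?thesis .
qed

lemma nxt_image:
  assumes "finite S" "x \<in> S" "\<And>y z. y \<in> S \<Longrightarrow> z \<in> S \<Longrightarrow> h y < h z \<longleftrightarrow> y < z"
  shows "nxt (h ` S) (h x) = h (nxt S x)"
proof (subst nxt_iff)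
  have le: "h y \<le> h z \<longleftrightarrow> y \<le> z" if "y \<in> S" "z \<in> S" for y z
    using assms(3)[OF that(2,1)] by (auto simp: linorder_not_less[symmetric])
  have n: "nxt S x \<in> S" by (rule nxt_in[OF assms(1,2)])
  show "h (nxt S x) \<in> h ` S \<and> (h x < h (nxt S x) \<and> (\<forall>z\<in>h ` S. h x < z \<longrightarrow> h (nxt S x) \<le> z) \<or>
    (\<forall>z\<in>h ` S. h (nxt S x) \<le> z \<and> z \<le> h x))"
    using nxt_iff[OF assms(1,2), of "nxt S x"] n assms(2,3) le by simp
qed (use assms in auto)

lemma circle_pt_image_mem:
  assumes "S \<subseteq> {0..<1}" "\<theta> \<in> {0..<1}" "circle_pt \<theta> \<in> circle_pt ` S"
  shows "\<theta> \<in> S"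
proof -
  obtain \<phi> where "\<phi> \<in> S" "circle_pt \<theta> = circle_pt \<phi>" using assms(3) by blast
  then show ?thesis using circle_pt_inj[of \<theta> \<phi>] assms(1,2) by auto
qed

context
  fixes d :: nat
  assumes d: "d \<ge> 1"
begin

lemma orb_lift_facts:
  assumes u: "\<forall>s\<in>{0..<1}. u s \<in> Sym d" and \<theta>: "\<theta> \<in> {0..<1}"
  shows "orb (lift d u) \<theta> = (\<lambda>i. pt d i (par d \<theta>)) ` orb (u (par d \<theta>)) (lab d \<theta>)"
    "orb (lift d u) \<theta> \<subseteq> {0..<1}" "finite (orb (lift d u) \<theta>)"
    "\<phi> \<in> orb (lift d u) \<theta> \<Longrightarrow> orb (lift d u) \<phi> = orb (lift d u) \<theta>"
    "\<phi> \<in> orb (lift d u) \<theta> \<Longrightarrow> par d \<phi> = par d \<theta>"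
proof -
  let ?s = "par d \<theta>" and ?j = "lab d \<theta>"
  note p = pt_par_lab[OF d \<theta>]
  have us: "u ?s \<in> Sym d" by (rule bspec[OF u p(2)])
  have oD: "orb (u ?s) ?j \<subseteq> {1..d}" by (rule orb_subset[OF Sym_bij[OF us] p(1)])
  show o: "orb (lift d u) \<theta> = (\<lambda>i. pt d i ?s) ` orb (u ?s) ?j"
    using orb_lift[of u, OF us p(1,2)] unfolding p(3) .
  show "orb (lift d u) \<theta> \<subseteq> {0..<1}" unfolding o using pt_range[OF _ p(2)] oD by blast
  show "finite (orb (lift d u) \<theta>)" unfolding o by (rule finite_imageI[OF finite_subset[OF oD]]) simp
  assume \<phi>: "\<phi> \<in> orb (lift d u) \<theta>"
  then obtain i where i: "i \<in> orb (u ?s) ?j" "\<phi> = pt d i ?s" unfolding o by blast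
  then have iD: "i \<in> {1..d}" using oD by blast
  show "par d \<phi> = ?s" unfolding i(2) by (rule par_lab_pt(1)[OF iD p(2)])
  have "orb (u ?s) i = orb (u ?s) ?j" by (rule orb_eq[OF _ Sym_bij[OF us] p(1) i(1)]) simp
  then show "orb (lift d u) \<phi> = orb (lift d u) \<theta>"
    unfolding i(2) orb_lift[of u, OF us iD p(2)] o by simp
qed

text \<open>Every parameter is a preimage with exactly one level and one label, so the blocks, given
  by a union over levels and labels, can be indexed by a single parameter as orbits of the
  lift.\<close>

lemma Psi_to_circle:
  assumes u: "\<forall>s\<in>{0..<1}. u s \<in> Sym d"
  shows "Psi d (to_circle u) = (\<lambda>\<theta>. circle_pt ` orb (lift d u) \<theta>) ` {0..<1}"
proof -
  have blk: "root_label d (circle_pt s) ` orb (u s) j = circle_pt ` orb (lift d u) (pt d j s)" if "s \<in> {0..<1}" "j \<in> {1..d}" for s j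
    unfolding orb_lift[of u, OF bspec[OF u that(1)] that(2,1)] image_image by (simp add: root_label_circle_pt[OF that(1)])
  have "Psi d (to_circle u) = (\<Union>z\<in>sphere 0 1. (\<lambda>j. root_label d z ` orb (to_circle u z) j) ` {1..d})"
    by (simp add: Psi_def psi_def orb_def image_image)
  also have "sphere 0 1 = circle_pt ` {0..<1}" using circle_pt_surj circle_pt_sphere by (metis (no_types, lifting) image_iff subsetI subset_antisym)
  also have "(\<Union>z\<in>circle_pt ` {0..<1}. (\<lambda>j. root_label d z ` orb (to_circle u z) j) ` {1..d}) =
    (\<Union>s\<in>{0..<1}. (\<lambda>j. circle_pt ` orb (lift d u) (pt d j s)) ` {1..d})"
    unfolding UN_simps(10) by (intro SUP_cong image_cong refl) (simp only: to_circle_circle_pt blk)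
  also have "\<dots> = (\<lambda>\<theta>. circle_pt ` orb (lift d u) \<theta>) ` {0..<1}" (is "?A = ?B")
  proof
    show "?A \<subseteq> ?B" using pt_range by blast
    show "?B \<subseteq> ?A"
    proof
      fix B assume "B \<in> ?B"
      then obtain \<theta> where t: "\<theta> \<in> {0..<1}" "B = circle_pt ` orb (lift d u) \<theta>" by blast
      then have "B = circle_pt ` orb (lift d u) (pt d (lab d \<theta>) (par d \<theta>))" using pt_par_lab(3)[OF d] by simp
      then show "B \<in> ?A" using pt_par_lab(1,2)[OF d t(1)] by blast
    qed
  qed
  finally show ?thesis .
qed

lemma Psi_Pi_d:
  assumes u: "\<forall>s\<in>{0..<1}. u s \<in> Sym d"
  shows "Psi d (to_circle u) \<in> Pi_d d"
proof -
  let ?X = "lift d u" and ?P = "(\<lambda>\<theta>. circle_pt ` orb (lift d u) \<theta>) ` {0..<1}"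
  note f = orb_lift_facts[OF u]
  have "is_partition ?P (sphere 0 1)"
    unfolding is_partition_def
  proof (intro conjI ballI impI)
    fix B assume "B \<in> ?P"
    then obtain \<theta> where "B = circle_pt ` orb ?X \<theta>" by blast
    then show "B \<noteq> {}" "B \<subseteq> sphere 0 1" using orb_refl[of \<theta> ?X] circle_pt_sphere by blast+
  next
    show "\<Union> ?P = sphere 0 1"
    proof
      show "\<Union> ?P \<subseteq> sphere 0 1" using circle_pt_sphere by blast
      show "sphere 0 1 \<subseteq> \<Union> ?P"
      proof
        fix z :: complex assume "z \<in> sphere 0 1"
        then obtain t where "t \<in> {0..<1}" "z = circle_pt t" by (rule circle_pt_surj)
        then show "z \<in> \<Union> ?P" using orb_refl[of t ?X] by blast
      qed
    qed
  next
    fix B C assume BC: "B \<in> ?P" "C \<in> ?P" "B \<noteq> C"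
    then obtain \<theta> \<phi> where t: "\<theta> \<in> {0..<1}" "\<phi> \<in> {0..<1}" "B = circle_pt ` orb ?X \<theta>" "C = circle_pt ` orb ?X \<phi>" by blast
    show "B \<inter> C = {}"
    proof (rule ccontr)
      assume "B \<inter> C \<noteq> {}"
      then obtain x y where xy: "x \<in> orb ?X \<theta>" "y \<in> orb ?X \<phi>" "circle_pt x = circle_pt y" using t by blast
      then have "x = y" using circle_pt_inj f(2)[OF t(1)] f(2)[OF t(2)] by blast
      then have "orb ?X \<theta> = orb ?X \<phi>"
        using f(4)[OF t(1), of x] f(4)[OF t(2), of y] xy by simp
      then show False using BC t by simp
    qed
  qed
  moreover have "z ^ d = w ^ d" if B: "B \<in> ?P" "z \<in> B" "w \<in> B" for B z w
  proof -
    obtain \<theta> where t: "\<theta> \<in> {0..<1}" "B = circle_pt ` orb ?X \<theta>" using B(1) by blast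
    have "v ^ d = circle_pt (par d \<theta>)" if v: "v \<in> B" for v
    proof -
      obtain x where x: "x \<in> orb ?X \<theta>" "v = circle_pt x" using v t(2) by blast
      have x01: "x \<in> {0..<1}" using f(2)[OF t(1)] x(1) by blast
      have "v ^ d = circle_pt (pt d (lab d x) (par d x)) ^ d" using pt_par_lab(3)[OF d x01] x(2) by simp
      also have "\<dots> = circle_pt (par d x)" by (rule circle_pt_pt_power[OF pt_par_lab(1)[OF d x01]])
      also have "par d x = par d \<theta>" by (rule f(5)[OF t(1) x(1)])
      finally show ?thesis .
    qed
    then show ?thesis using B by simp
  qed
  ultimately show ?thesis unfolding Psi_to_circle[OF u] Pi_d_def mem_Collect_eq
    by (intro conjI ballI)
qed

end

section \<open>Normal forms and their levels\<close>

text \<open>Level 0 is listed even when \<open>u 0\<close> is trivial: it then contributes length 0,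
  and the list is never empty.\<close>

definition param_list :: "(real \<Rightarrow> perm) \<Rightarrow> real list" where
  "param_list u = 0 # interior_pts u"

lemma multI_Sym: "u \<in> multI d \<Longrightarrow> u s \<in> Sym d"
  by (simp add: multI_def)

lemma multI_Sym_all: "u \<in> multI d \<Longrightarrow> \<forall>s\<in>{0..<1}. u s \<in> Sym d"
  by (simp add: multI_def)

lemma finite_interior: "u \<in> multI d \<Longrightarrow> finite {r \<in> {0<..<1}. u r \<noteq> id}"
  by (rule finite_subset[of _ "{r. u r \<noteq> id}"]) (auto simp: multI_def)

lemma param_list:
  assumes "u \<in> multI d"
  shows "param_list u \<noteq> []" "sorted_wrt (<) (param_list u)" "set (param_list u) \<subseteq> {0..<1}"
    "s \<in> {0..<1} \<Longrightarrow> s \<notin> set (param_list u) \<Longrightarrow> u s = id"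
proof -
  have ipts: "set (interior_pts u) = {r \<in> {0<..<1}. u r \<noteq> id}"
    unfolding interior_pts_def by (rule set_sorted_list_of_set[OF finite_interior[OF assms]])
  show "param_list u \<noteq> []" by (simp add: param_list_def)
  have "sorted_wrt (<) (interior_pts u)"
    unfolding interior_pts_def by (rule strict_sorted_list_of_set)
  then show "sorted_wrt (<) (param_list u)" using ipts by (simp add: param_list_def)
  have pset: "set (param_list u) = insert 0 {r \<in> {0<..<1}. u r \<noteq> id}"
    unfolding param_list_def list.set(2) ipts ..
  show "set (param_list u) \<subseteq> {0..<1}" unfolding pset by auto
  assume "s \<in> {0..<1}" "s \<notin> set (param_list u)"
  then have "0 < s" "s < 1" "\<not> (s \<in> {0<..<1} \<and> u s \<noteq> id)" unfolding pset by auto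
  then show "u s = id" by simp
qed

lemma tlen_foldr_le:
  assumes "\<And>s. s \<in> set L \<Longrightarrow> u s \<in> Sym d"
  shows "tlen d (foldr (\<circ>) (map u L) id) \<le> (\<Sum>s\<leftarrow>L. tlen d (u s))"
  using assms
proof (induction L)
  case Nil
  have "foldr (\<circ>) (map u []) id = id" by simp
  then show ?case by (metis le0 tlen_id)
next
  case (Cons s L)
  have IH: "tlen d (foldr (\<circ>) (map u L) id) \<le> (\<Sum>s\<leftarrow>L. tlen d (u s))"
    by (rule Cons.IH) (rule Cons.prems, simp)
  have "foldr (\<circ>) (map u L) id \<in> Sym d" by (rule foldr_Sym) (rule Cons.prems, simp)
  then have "tlen d (u s \<circ> foldr (\<circ>) (map u L) id) \<le> tlen d (u s) + tlen d (foldr (\<circ>) (map u L) id)"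
    by (intro tlen_comp_le Cons.prems) simp
  moreover have "foldr (\<circ>) (map u (s # L)) id = u s \<circ> foldr (\<circ>) (map u L) id" by simp
  moreover have "(\<Sum>t\<leftarrow>s # L. tlen d (u t)) = tlen d (u s) + (\<Sum>s\<leftarrow>L. tlen d (u s))" by simp
  ultimately show ?case using IH by (metis add_left_mono order_trans)
qed

section \<open>The absolute order and refinement of orbits\<close>

lemma Sym_cancel:
  assumes "p \<in> Sym d"
  shows "p \<circ> (inv p \<circ> q) = q" "inv p \<circ> (p \<circ> q) = q"
  by (simp_all add: fun_eq_iff Sym_inv_app[OF assms])

lemma FI_multI: "u \<in> FI d g \<Longrightarrow> u \<in> multI d"
  by (auto simp: FI_def wlf_def)

text \<open>By the definition of the order, \<open>q\<close> is the length-additive product of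
  \<open>p\<close> and \<open>inv p \<circ> q\<close>, so \<open>p\<close> moves points only inside
  cycles of \<open>q\<close>.\<close>

lemma tle_orb:
  assumes "p \<in> Sym d" "q \<in> Sym d" "tle d p q" "j \<in> {1..d}"
  shows "orb p j \<subseteq> orb q j"
proof (rule orb_least)
  fix y assume y: "y \<in> orb q j"
  have yD: "y \<in> {1..d}" using orb_subset[OF Sym_bij[OF assms(2)] assms(4)] y by blast
  have e: "p \<circ> (inv p \<circ> q) = q" by (rule Sym_cancel(1)[OF assms(1)])
  have "p y \<in> orb (p \<circ> (inv p \<circ> q)) y"
    by (rule tlen_comp_eq_orb(1)[OF assms(1) Sym_comp[OF Sym_inv[OF assms(1)] assms(2)] _ yD])
      (use assms(3) e in \<open>simp add: tle_def\<close>)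
  then show "p y \<in> orb q j" unfolding e using orb_mono[OF y] by blast
qed simp

text \<open>On each orbit \<open>Q\<close> of \<open>q\<close> the permutation \<open>q\<close> is
  the cyclic successor and \<open>p\<close> is noncrossing, so Biane's count applies to
  \<open>p\<close> and \<open>inv p \<circ> q\<close> on \<open>Q\<close>. Summed over all orbits of
  \<open>q\<close>, the counts say that the lengths add up to that of \<open>q\<close>.\<close>

lemma nc_tle:
  assumes p: "p \<in> Sym d" "nc_perm {1..d} p" and q: "q \<in> Sym d" "nc_perm {1..d} q"
    and sub: "\<And>j. j \<in> {1..d} \<Longrightarrow> orb p j \<subseteq> orb q j"
  shows "tle d p q"
proof -
  define Y where "Y = inv p \<circ> q"
  have YS: "Y \<in> Sym d" unfolding Y_def by (rule Sym_comp[OF Sym_inv[OF p(1)] q(1)])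
  have Q: "num_orbs Q p + num_orbs Q Y = card Q + 1 \<and> bij_betw p Q Q \<and> bij_betw Y Q Q \<and> Q \<subseteq> {1..d} \<and> finite Q"
    if Q: "Q \<in> orbs {1..d} q" for Q
  proof -
    obtain j where j: "j \<in> {1..d}" "Q = orb q j" using Q by (auto simp: orbs_def)
    have QD: "Q \<subseteq> {1..d}" unfolding j(2) by (rule orb_subset[OF Sym_bij[OF q(1)] j(1)])
    have finQ: "finite Q" by (rule finite_subset[OF QD]) simp
    have oq: "orb q x = Q" if "x \<in> Q" for x
      unfolding j(2) by (rule orb_eq[OF _ Sym_bij[OF q(1)] j(1)]) (use that j in auto)
    have pQ: "p x \<in> Q" if "x \<in> Q" for x
      using sub[of x] oq[OF that] QD that orb_step[OF orb_refl, of p x] by blast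
    have qQ: "q x \<in> Q" if "x \<in> Q" for x using orb_step[of x q j] that j(2) by simp
    have bp: "bij_betw p Q Q" by (rule bij_betw_split(1)[OF _ Sym_bij[OF p(1)] QD pQ]) simp
    have pY: "p (Y x) = q x" for x by (simp add: Y_def Sym_inv_app[OF p(1)])
    have YQ: "Y x \<in> Q" if x: "x \<in> Q" for x
    proof -
      have "q x \<in> p ` Q" using qQ[OF x] bp by (simp add: bij_betw_def)
      then obtain z where "z \<in> Q" "q x = p z" by blast
      then show ?thesis by (simp add: Y_def Sym_inv_app[OF p(1)])
    qed
    have bY: "bij_betw Y Q Q" by (rule bij_betw_split(1)[OF _ Sym_bij[OF YS] QD YQ]) simp
    have "nc_perm Q p" using p(2) QD unfolding nc_perm_def by blast
    moreover have "p (Y x) = nxt Q x" if x: "x \<in> Q" for x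
    proof -
      have "x \<in> {1..d}" using x QD by blast
      from nc_permD(1)[OF q(2) this] show ?thesis unfolding pY oq[OF x] .
    qed
    moreover have "Q \<noteq> {}" using j(2) orb_refl[of j q] by (metis empty_iff)
    ultimately show ?thesis using num_orbs_nc_perm[OF finQ _ bp bY] bp bY QD finQ by blast
  qed
  have U: "(\<Union>Q\<in>orbs {1..d} q. Q) = {1..d}"
  proof
    show "(\<Union>Q\<in>orbs {1..d} q. Q) \<subseteq> {1..d}" using Q by blast
    show "{1..d} \<subseteq> (\<Union>Q\<in>orbs {1..d} q. Q)" unfolding orbs_def using orb_refl by fast
  qed
  have dis: "Q \<inter> R = {}" if QR: "Q \<in> orbs {1..d} q" "R \<in> orbs {1..d} q" "Q \<noteq> R" for Q R
  proof (rule ccontr)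
    assume "Q \<inter> R \<noteq> {}"
    then obtain x where x: "x \<in> Q" "x \<in> R" by blast
    obtain i j where ij: "i \<in> {1..d}" "j \<in> {1..d}" "Q = orb q i" "R = orb q j"
      using QR(1,2) unfolding orbs_def by blast
    have "orb q x = Q" unfolding ij(3) by (rule orb_eq[OF _ Sym_bij[OF q(1)] ij(1)]) (use x ij in auto)
    moreover have "orb q x = R" unfolding ij(4) by (rule orb_eq[OF _ Sym_bij[OF q(1)] ij(2)]) (use x ij in auto)
    ultimately show False using QR by simp
  qed
  have "num_orbs (\<Union>Q\<in>orbs {1..d} q. Q) p = (\<Sum>Q\<in>orbs {1..d} q. num_orbs Q p)"
    by (rule num_orbs_Union) (use Q dis in auto)
  moreover have "num_orbs (\<Union>Q\<in>orbs {1..d} q. Q) Y = (\<Sum>Q\<in>orbs {1..d} q. num_orbs Q Y)"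
    by (rule num_orbs_Union) (use Q dis in auto)
  moreover have "card (\<Union>Q\<in>orbs {1..d} q. Q) = (\<Sum>Q\<in>orbs {1..d} q. card Q)"
    by (rule card_UN_disjoint) (use Q dis in auto)
  ultimately have "num_orbs {1..d} p + num_orbs {1..d} Y = (\<Sum>Q\<in>orbs {1..d} q. num_orbs Q p + num_orbs Q Y)"
    "(\<Sum>Q\<in>orbs {1..d} q. card Q) = d"
    unfolding U by (simp_all add: sum.distrib)
  moreover have "(\<Sum>Q\<in>orbs {1..d} q. num_orbs Q p + num_orbs Q Y) = (\<Sum>Q\<in>orbs {1..d} q. card Q + 1)"
    by (rule sum.cong[OF refl]) (use Q in blast)
  moreover have "(\<Sum>Q\<in>orbs {1..d} q. card Q + 1) = (\<Sum>Q\<in>orbs {1..d} q. card Q) + num_orbs {1..d} q"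
    unfolding sum.distrib by (simp add: num_orbs_def)
  ultimately have "num_orbs {1..d} p + num_orbs {1..d} Y = d + num_orbs {1..d} q" by linarith
  then show ?thesis unfolding tle_def Y_def[symmetric]
    using tlen_num_orbs[OF p(1)] tlen_num_orbs[OF q(1)] tlen_num_orbs[OF YS] by linarith
qed

section \<open>Factorizations give noncrossing partitions\<close>

context
  fixes d :: nat
  assumes d: "d \<ge> 1"
begin

text \<open>Two inequalities hold for any \<open>u\<close>: the length of the product
  \<open>h\<close> is at most the sum of the lengths, and the length of the long cycle is at most
  that of \<open>h\<close> plus that of \<open>inv h \<circ> long_cycle d\<close>. Being a
  factorization of some \<open>h\<close> in the interval means equality in both, which is equality
  of the extreme terms, the equation of \<open>nc_perm_lift_iff\<close>.\<close>

lemma FI_iff: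
  assumes u: "u \<in> multI d" and u1: "u 1 = id"
  shows "u \<in> FI d (long_cycle d) \<longleftrightarrow> nc_perm (pts d (set (param_list u))) (lift d u)"
proof -
  let ?L = "param_list u" and ?g = "long_cycle d"
  define h where "h = foldr (\<circ>) (map u ?L) id"
  define \<Sigma> where "\<Sigma> = (\<Sum>s\<leftarrow>?L. tlen d (u s))"
  have hS: "h \<in> Sym d" unfolding h_def by (rule foldr_Sym) (rule multI_Sym[OF u])
  have nc: "nc_perm (pts d (set ?L)) (lift d u) \<longleftrightarrow> \<Sigma> + tlen d (inv h \<circ> ?g) + 1 = d"
    unfolding h_def \<Sigma>_def
    by (rule nc_perm_lift_iff[OF d param_list(1-3)[OF u] multI_Sym[OF u]])
  have g: "tlen d ?g + 1 = d" by (rule tlen_long_cycle[OF d])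
  have 1: "tlen d h \<le> \<Sigma>" unfolding h_def \<Sigma>_def by (rule tlen_foldr_le) (rule multI_Sym[OF u])
  have "tlen d (h \<circ> (inv h \<circ> ?g)) \<le> tlen d h + tlen d (inv h \<circ> ?g)"
    by (intro tlen_comp_le hS Sym_comp Sym_inv long_cycle_Sym[OF d])
  then have 2: "tlen d ?g \<le> tlen d h + tlen d (inv h \<circ> ?g)" unfolding Sym_cancel(1)[OF hS] .
  have hh: "u 0 \<circ> foldr (\<circ>) (map u (interior_pts u)) id \<circ> u 1 = h"
    by (simp add: h_def param_list_def u1)
  have ss: "tlen d (u 0) + (\<Sum>s\<leftarrow>interior_pts u. tlen d (u s)) + tlen d (u 1) = \<Sigma>"
    by (simp add: \<Sigma>_def param_list_def u1)
  have "u \<in> FI d ?g \<longleftrightarrow> \<Sigma> = tlen d h \<and> tlen d h + tlen d (inv h \<circ> ?g) = tlen d ?g"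
    unfolding FI_def wlf_def interval_def tle_def mem_Collect_eq hh ss using u hS by blast
  also have "\<dots> \<longleftrightarrow> \<Sigma> + tlen d (inv h \<circ> ?g) + 1 = d" using 1 2 g by linarith
  finally show ?thesis unfolding nc .
qed

lemma orb_lift_id:
  assumes "\<theta> \<in> {0..<1}" "u (par d \<theta>) = id"
  shows "orb (lift d u) \<theta> = {\<theta>}"
  by (rule orb_fixed) (simp add: lift_def assms(2) pt_par_lab(3)[OF d assms(1)])

text \<open>Reduces crossings on the whole circle to the finite set of preimages: the points of a
  crossing lie in nontrivial orbits, hence over listed levels.\<close>

lemma moved_in_pts:
  assumes u: "u \<in> multI d" and x: "x \<in> {0..<1}" and y: "y \<in> orb (lift d u) x" "y \<noteq> x"
  shows "x \<in> pts d (set (param_list u))" "y \<in> pts d (set (param_list u))"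
proof -
  note f = orb_lift_facts[OF d multI_Sym_all[OF u] x]
  have y01: "y \<in> {0..<1}" using f(2) y(1) by blast
  have "u (par d x) \<noteq> id" using orb_lift_id[OF x, of u] y by auto
  then have s: "par d x \<in> set (param_list u)" using param_list(4)[OF u pt_par_lab(2)[OF d x]] by blast
  have *: "z \<in> pts d (set (param_list u))" if z: "z \<in> {0..<1}" "par d z = par d x" for z
  proof -
    have "z = pt d (lab d z) (par d x)" using pt_par_lab(3)[OF d z(1)] z(2) by simp
    then show ?thesis unfolding pts_def using s pt_par_lab(1)[OF d z(1)] by blast
  qed
  show "x \<in> pts d (set (param_list u))" using *[OF x] by simp
  show "y \<in> pts d (set (param_list u))" using *[OF y01 f(5)[OF y(1)]] .
qed

lemma Psi_NC:
  assumes uF: "u \<in> FI d (long_cycle d)" and u1: "u 1 = id"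
  shows "Psi d (to_circle u) \<in> NC_d d"
proof -
  have u: "u \<in> multI d" by (rule FI_multI[OF uF])
  let ?X = "lift d u"
  note uS = multI_Sym_all[OF u]
  note f = orb_lift_facts[OF d uS]
  have nc: "nc_perm (pts d (set (param_list u))) ?X" using FI_iff[OF u u1] uF by blast
  have cross: False
    if \<theta>: "\<theta> \<in> {0..<1}" and \<phi>: "\<phi> \<in> {0..<1}" and dis: "orb ?X \<theta> \<inter> orb ?X \<phi> = {}"
      and m: "a \<in> orb ?X \<theta>" "b \<in> orb ?X \<phi>" "c \<in> orb ?X \<theta>" "e \<in> orb ?X \<phi>"
      and o: "a < b" "b < c" "c < e" for \<theta> \<phi> a b c e
  proof -
    have a: "a \<in> {0..<1}" "orb ?X a = orb ?X \<theta>" using f(2,4)[OF \<theta>] m(1) by blast+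
    have b: "b \<in> {0..<1}" "orb ?X b = orb ?X \<phi>" using f(2,4)[OF \<phi>] m(2) by blast+
    have c: "c \<in> orb ?X a" and e: "e \<in> orb ?X b" using m a b by auto
    have "a \<in> pts d (set (param_list u))" "c \<in> pts d (set (param_list u))"
      using moved_in_pts[OF u a(1) c] o by auto
    moreover have "b \<in> pts d (set (param_list u))" "e \<in> pts d (set (param_list u))"
      using moved_in_pts[OF u b(1) e] o by auto
    ultimately have "b \<in> orb ?X a" using nc_permD(2)[OF nc _ _ _ _ o c e] by blast
    then show False using a(2) m(2) dis by blast
  qed
  have "convex hull B \<inter> convex hull C = {}"
    if BC: "B \<in> Psi d (to_circle u)" "C \<in> Psi d (to_circle u)" "B \<noteq> C" for B C
  proof -
    obtain \<theta> \<phi> where t: "\<theta> \<in> {0..<1}" "\<phi> \<in> {0..<1}" "B = circle_pt ` orb ?X \<theta>" "C = circle_pt ` orb ?X \<phi>"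
      using BC(1,2) unfolding Psi_to_circle[OF d uS] by blast
    have dis: "orb ?X \<theta> \<inter> orb ?X \<phi> = {}"
    proof (rule ccontr)
      assume "orb ?X \<theta> \<inter> orb ?X \<phi> \<noteq> {}"
      then obtain x where "x \<in> orb ?X \<theta>" "x \<in> orb ?X \<phi>" by blast
      then have "orb ?X \<theta> = orb ?X \<phi>" using f(4)[OF t(1)] f(4)[OF t(2)] by metis
      then show False using BC(3) t by simp
    qed
    show ?thesis unfolding t(3,4)
    proof (rule hulls_disjoint[OF f(3)[OF t(1)] f(3)[OF t(2)] _ _ dis f(2)[OF t(1)] f(2)[OF t(2)]])
      show "orb ?X \<theta> \<noteq> {}" "orb ?X \<phi> \<noteq> {}" using orb_refl[of \<theta> ?X] orb_refl[of \<phi> ?X] by force+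
      have dis': "orb ?X \<phi> \<inter> orb ?X \<theta> = {}" using dis by (simp add: Int_commute)
      show "\<not> (a < b \<and> b < c \<and> c < e)"
        if "a \<in> orb ?X \<theta>" "b \<in> orb ?X \<phi>" "c \<in> orb ?X \<theta>" "e \<in> orb ?X \<phi>" for a b c e
        using cross[OF t(1,2) dis that] by blast
      show "\<not> (a < b \<and> b < c \<and> c < e)"
        if "a \<in> orb ?X \<phi>" "b \<in> orb ?X \<theta>" "c \<in> orb ?X \<phi>" "e \<in> orb ?X \<theta>" for a b c e
        using cross[OF t(2,1) dis' that] by blast
    qed
  qed
  then show ?thesis unfolding NC_d_def using Psi_Pi_d[OF d uS] by blast
qed

text \<open>At a fixed level the parameters increase with the label, so the noncrossing property of
  the lift restricts to the permutation of labels.\<close>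

lemma FI_nc_perm:
  assumes uF: "u \<in> FI d (long_cycle d)" and u1: "u 1 = id" and s: "s \<in> {0..<1}"
  shows "nc_perm {1..d} (u s)"
proof (cases "s \<in> set (param_list u)")
  case True
  have u: "u \<in> multI d" by (rule FI_multI[OF uF])
  have us: "u s \<in> Sym d" by (rule multI_Sym[OF u])
  let ?X = "lift d u"
  have nc: "nc_perm (pts d (set (param_list u))) ?X" using FI_iff[OF u u1] uF by blast
  have p: "pt d j s \<in> pts d (set (param_list u))" if "j \<in> {1..d}" for j
    unfolding pts_def using True that by blast
  have o: "orb ?X (pt d j s) = (\<lambda>i. pt d i s) ` orb (u s) j" if "j \<in> {1..d}" for j
    by (rule orb_lift[of u, OF us that s])
  have inj: "pt d i s = pt d j s \<longleftrightarrow> i = j" for i j using inj_pt[OF d, of s] by (auto simp: inj_def)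
  have lt: "pt d i s < pt d j s \<longleftrightarrow> i < j" for i j using pt_less_iff[OF d s s] by simp
  have "u s j = nxt (orb (u s) j) j" if j: "j \<in> {1..d}" for j
  proof -
    have fin: "finite (orb (u s) j)"
      by (rule finite_subset[OF orb_subset[OF Sym_bij[OF us] j]]) simp
    have "pt d (u s j) s = nxt ((\<lambda>i. pt d i s) ` orb (u s) j) (pt d j s)"
      using nc_permD(1)[OF nc p[OF j]] unfolding o[OF j] lift_pt[OF j s] .
    also have "\<dots> = pt d (nxt (orb (u s) j) j) s"
      by (rule nxt_image[OF fin orb_refl]) (rule lt)
    finally show ?thesis unfolding inj .
  qed
  moreover have "k \<in> orb (u s) j"
    if h: "j \<in> {1..d}" "k \<in> {1..d}" "l \<in> {1..d}" "m \<in> {1..d}" "j < k" "k < l" "l < m" "l \<in> orb (u s) j" "m \<in> orb (u s) k" for j k l m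
  proof -
    have "pt d k s \<in> orb ?X (pt d j s)"
      by (rule nc_permD(2)[OF nc p[OF h(1)] p[OF h(2)] p[OF h(3)] p[OF h(4)]])
        (use h o lt in auto)
    then show ?thesis unfolding o[OF h(1)] using inj by auto
  qed
  ultimately show ?thesis unfolding nc_perm_def by blast
next
  case False
  have "u s = id" using param_list(4)[OF FI_multI[OF uF] s False] .
  then show ?thesis unfolding nc_perm_def by (simp add: orb_fixed nxt_def)
qed

text \<open>Each block stays over one level, where its points correspond to labels, so refinement
  can be tested level by level.\<close>

lemma refines_iff:
  assumes v: "\<forall>s\<in>{0..<1}. v s \<in> Sym d" and u: "\<forall>s\<in>{0..<1}. u s \<in> Sym d"
  shows "refines (Psi d (to_circle v)) (Psi d (to_circle u)) \<longleftrightarrow>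
    (\<forall>s\<in>{0..<1}. \<forall>j\<in>{1..d}. orb (v s) j \<subseteq> orb (u s) j)" (is "?L \<longleftrightarrow> ?R")
proof
  note fv = orb_lift_facts[OF d v] and fu = orb_lift_facts[OF d u]
  assume L: ?L
  show ?R
  proof (intro ballI)
    fix s j assume s: "s \<in> {0..<(1::real)}" and j: "j \<in> {1..d}"
    let ?t = "pt d j s"
    have t: "?t \<in> {0..<1}" by (rule pt_range[OF j s])
    have "circle_pt ` orb (lift d v) ?t \<in> Psi d (to_circle v)" unfolding Psi_to_circle[OF d v] using t by blast
    then obtain C where C: "C \<in> Psi d (to_circle u)" "circle_pt ` orb (lift d v) ?t \<subseteq> C"
      using L unfolding refines_def by blast
    obtain \<phi> where \<phi>: "\<phi> \<in> {0..<1}" "C = circle_pt ` orb (lift d u) \<phi>"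
      using C(1) unfolding Psi_to_circle[OF d u] by blast
    have sub: "orb (lift d v) ?t \<subseteq> orb (lift d u) \<phi>"
    proof
      fix x assume x: "x \<in> orb (lift d v) ?t"
      have "circle_pt x \<in> circle_pt ` orb (lift d u) \<phi>" using C(2) x \<phi>(2) by blast
      then show "x \<in> orb (lift d u) \<phi>"
        by (rule circle_pt_image_mem[OF fu(2)[OF \<phi>(1)] subsetD[OF fv(2)[OF t] x]])
    qed
    have "orb (lift d u) ?t = orb (lift d u) \<phi>"
      by (rule fu(4)[OF \<phi>(1)]) (use sub orb_refl[of ?t "lift d v"] in blast)
    then have "(\<lambda>i. pt d i s) ` orb (v s) j \<subseteq> (\<lambda>i. pt d i s) ` orb (u s) j"
      using sub unfolding orb_lift[of v, OF bspec[OF v s] j s] orb_lift[of u, OF bspec[OF u s] j s] by simp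
    then show "orb (v s) j \<subseteq> orb (u s) j" unfolding inj_image_subset_iff[OF inj_pt[OF d]] .
  qed
next
  assume R: ?R
  show ?L unfolding refines_def
  proof
    fix B assume "B \<in> Psi d (to_circle v)"
    then obtain \<theta> where \<theta>: "\<theta> \<in> {0..<1}" "B = circle_pt ` orb (lift d v) \<theta>"
      unfolding Psi_to_circle[OF d v] by blast
    note p = pt_par_lab[OF d \<theta>(1)]
    have "orb (lift d v) \<theta> \<subseteq> orb (lift d u) \<theta>"
      unfolding orb_lift_facts(1)[OF d v \<theta>(1)] orb_lift_facts(1)[OF d u \<theta>(1)]
      using R p by (intro image_mono) blast
    then have "B \<subseteq> circle_pt ` orb (lift d u) \<theta>" unfolding \<theta>(2) by (rule image_mono)
    then show "\<exists>C\<in>Psi d (to_circle u). B \<subseteq> C" unfolding Psi_to_circle[OF d u] using \<theta>(1) by blast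
  qed
qed

end

section \<open>Order, injectivity and surjectivity\<close>

context
  fixes d :: nat
  assumes d: "d \<ge> 1"
begin

text \<open>The value at 0 of a normal form is the product of the conjugated \<open>u' 1\<close> and
  \<open>u' 0\<close>. For \<open>u'\<close> this product is length-additive, so both factors
  respect its cycles. The corresponding factors of \<open>v'\<close> lie below them and so respect
  these cycles too, and hence does their product.\<close>

lemma FS_le_imp_orb:
  assumes v': "v' \<in> FI d g" and u': "u' \<in> FI d g" and g: "g \<in> Sym d" and sub: "sub_le d v' u'" and j: "j \<in> {1..d}"
  shows "orb (g \<circ> v' 1 \<circ> inv g \<circ> v' 0) j \<subseteq> orb (g \<circ> u' 1 \<circ> inv g \<circ> u' 0) j"
proof -
  note S = multI_Sym[OF FI_multI[OF v']] multI_Sym[OF FI_multI[OF u']]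
  define cv cu where "cv = g \<circ> v' 1 \<circ> inv g" and "cu = g \<circ> u' 1 \<circ> inv g"
  have cS: "cv \<in> Sym d" "cu \<in> Sym d" unfolding cv_def cu_def by (intro Sym_comp S g Sym_inv)+
  define W where "W = cu \<circ> u' 0"
  have WS: "W \<in> Sym d" unfolding W_def by (rule Sym_comp[OF cS(2) S(2)])
  have ti: "tle d (v' 1) (u' 1)" "tle d (v' 0) (u' 0)" using sub by (auto simp: sub_le_def)
  have tc: "tle d cv cu"
  proof -
    have inv_cv: "inv cv = g \<circ> inv (v' 1) \<circ> inv g"
    proof (rule inv_unique_comp)
      show "cv \<circ> (g \<circ> inv (v' 1) \<circ> inv g) = id" "g \<circ> inv (v' 1) \<circ> inv g \<circ> cv = id"
        by (simp_all add: fun_eq_iff cv_def Sym_inv_app[OF g] Sym_inv_app[OF S(1)])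
    qed
    have "inv cv \<circ> cu = g \<circ> (inv (v' 1) \<circ> u' 1) \<circ> inv g"
      unfolding inv_cv by (simp add: fun_eq_iff cu_def Sym_inv_app[OF g])
    then have "tlen d (inv cv \<circ> cu) = tlen d (inv (v' 1) \<circ> u' 1)"
      using tlen_conj[OF g Sym_comp[OF Sym_inv[OF S(1)] S(2)]] by simp
    then show ?thesis using ti(1) unfolding tle_def cv_def cu_def
      by (simp only: tlen_conj[OF g S(1)] tlen_conj[OF g S(2)])
  qed
  have len: "tlen d W = tlen d cu + tlen d (u' 0)"
  proof -
    obtain h where h: "h \<in> Sym d" "tlen d h + tlen d (inv h \<circ> g) = tlen d g" "wlf d u' h"
      using u' by (auto simp: FI_def interval_def tle_def)
    define M where "M = foldr (\<circ>) (map u' (interior_pts u')) id"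
    have MS: "M \<in> Sym d" unfolding M_def by (rule foldr_Sym) (rule S(2))
    have Ml: "tlen d M \<le> (\<Sum>s\<leftarrow>interior_pts u'. tlen d (u' s))"
      unfolding M_def by (rule tlen_foldr_le) (rule S(2))
    have h1: "tlen d (u' 0) + (\<Sum>s\<leftarrow>interior_pts u'. tlen d (u' s)) + tlen d (u' 1) = tlen d h"
      and h2: "h = u' 0 \<circ> M \<circ> u' 1"
      using h(3) unfolding wlf_def M_def by blast+
    \<comment> \<open>Moving \<open>u' 1\<close> to the front changes the complement
      \<open>inv h \<circ> g\<close> by a conjugation into \<open>y\<close>, and g factors as
      \<open>W\<close>, \<open>M\<close>, \<open>y\<close>. Since conjugation keeps lengths, the
      lengths available add up exactly to that of g, which leaves \<open>W\<close> no room to be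
      shorter than the sum of its factors.\<close>
    define y where "y = u' 1 \<circ> (inv h \<circ> g) \<circ> inv (u' 1)"
    have yS: "inv h \<circ> g \<in> Sym d" "y \<in> Sym d"
      unfolding y_def by (intro Sym_comp Sym_inv S g h(1))+
    have ly: "tlen d y = tlen d (inv h \<circ> g)" unfolding y_def by (rule tlen_conj[OF S(2) yS(1)])
    have hx: "u' 0 (M (u' 1 x)) = h x" for x unfolding h2 by simp
    have "W \<circ> (M \<circ> y) = g"
      by (simp add: fun_eq_iff W_def cu_def y_def hx Sym_inv_app[OF h(1)] Sym_inv_app[OF g] Sym_inv_app[OF S(2)])
    then have "tlen d g \<le> tlen d W + (tlen d M + tlen d y)"
      using tlen_comp_le[OF WS Sym_comp[OF MS yS(2)]] tlen_comp_le[OF MS yS(2)] by simp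
    moreover have "tlen d cu = tlen d (u' 1)" unfolding cu_def by (rule tlen_conj[OF g S(2)])
    moreover have "tlen d W \<le> tlen d cu + tlen d (u' 0)" unfolding W_def by (rule tlen_comp_le[OF cS(2) S(2)])
    ultimately show ?thesis using Ml h1 h(2) ly by linarith
  qed
  have Wo: "cu x \<in> orb W x" "u' 0 x \<in> orb W x" if "x \<in> {1..d}" for x
    unfolding W_def using tlen_comp_eq_orb[OF cS(2) S(2) len[unfolded W_def] that] by blast+
  have sub_orb: "orb p x \<subseteq> orb W x" if p: "p \<in> Sym d" "\<And>x. x \<in> {1..d} \<Longrightarrow> p x \<in> orb W x" and x: "x \<in> {1..d}" for p x
  proof (rule orb_least)
    fix y assume y: "y \<in> orb W x"
    have "y \<in> {1..d}" using orb_subset[OF Sym_bij[OF WS] x] y by blast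
    then show "p y \<in> orb W x" using p(2) orb_mono[OF y] by blast
  qed simp
  have "orb (cv \<circ> v' 0) j \<subseteq> orb W j"
  proof (rule orb_least)
    fix y assume y: "y \<in> orb W j"
    have yD: "y \<in> {1..d}" using orb_subset[OF Sym_bij[OF WS] j] y by blast
    have "v' 0 y \<in> orb (u' 0) y"
      using tle_orb[OF S(1) S(2) ti(2) yD] orb_step[of y "v' 0" y] by auto
    then have 1: "v' 0 y \<in> orb W j" using sub_orb[OF S(2) Wo(2) yD] orb_mono[OF y] by blast
    then have zD: "v' 0 y \<in> {1..d}" using orb_subset[OF Sym_bij[OF WS] j] by blast
    have "cv (v' 0 y) \<in> orb cu (v' 0 y)"
      using tle_orb[OF cS tc zD] orb_step[of "v' 0 y" cv "v' 0 y"] by auto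
    then show "(cv \<circ> v' 0) y \<in> orb W j" using sub_orb[OF cS(2) Wo(1) zD] orb_mono[OF 1] by auto
  qed simp
  then show ?thesis unfolding W_def cv_def cu_def .
qed

text \<open>The normal forms hidden in \<open>FS_le\<close> need only induce the same multisets on
  the circle as \<open>v\<close> and \<open>u\<close>, which is all that \<open>Psi\<close> sees.
  Conversely, under refinement \<open>v\<close> and \<open>u\<close> are comparable pointwise by
  \<open>nc_tle\<close> and represent their own classes.\<close>

lemma FS_le_iff:
  assumes v: "v \<in> FI d (long_cycle d)" "v 1 = id" and u: "u \<in> FI d (long_cycle d)" "u 1 = id"
  shows "FS_le d (long_cycle d) (to_circle v) (to_circle u) \<longleftrightarrow>
    refines (Psi d (to_circle v)) (Psi d (to_circle u))"
proof
  let ?g = "long_cycle d"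
  have g: "?g \<in> Sym d" by (rule long_cycle_Sym[OF d])
  assume "FS_le d ?g (to_circle v) (to_circle u)"
  then obtain v0 u0 v' u' where
    v0: "v0 \<in> FI d ?g" "v0 1 = id" "to_circle v0 = to_circle v" and
    u0: "u0 \<in> FI d ?g" "u0 1 = id" "to_circle u0 = to_circle u" and
    v': "v' \<in> FI d ?g" "fequiv ?g v' v0" and u': "u' \<in> FI d ?g" "fequiv ?g u' u0" and sub: "sub_le d v' u'"
    unfolding FS_le_def by blast
  note S = multI_Sym[OF FI_multI[OF v'(1)]] multI_Sym[OF FI_multI[OF u'(1)]]
  have canc: "?g \<circ> id \<circ> inv ?g \<circ> w = w" for w by (simp add: fun_eq_iff Sym_inv_app[OF g])
  have "orb (v0 s) j \<subseteq> orb (u0 s) j" if s: "s \<in> {0..<1}" and j: "j \<in> {1..d}" for s j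
  proof (cases "s = 0")
    case True
    have "v0 0 = ?g \<circ> v' 1 \<circ> inv ?g \<circ> v' 0" "u0 0 = ?g \<circ> u' 1 \<circ> inv ?g \<circ> u' 0"
      using v'(2) u'(2) unfolding fequiv_def v0(2) u0(2) canc by simp_all
    then show ?thesis using FS_le_imp_orb[OF v'(1) u'(1) g sub j] True by simp
  next
    case False
    then have s': "s \<in> {0<..<1}" using s by simp
    have "v0 s = v' s" "u0 s = u' s" using v'(2) u'(2) s' unfolding fequiv_def by auto
    moreover have "tle d (v' s) (u' s)" using sub s' by (auto simp: sub_le_def)
    ultimately show ?thesis using tle_orb[OF S(1) S(2) _ j] by simp
  qed
  then have "refines (Psi d (to_circle v0)) (Psi d (to_circle u0))"
    using refines_iff[OF d multI_Sym_all[OF FI_multI[OF v0(1)]] multI_Sym_all[OF FI_multI[OF u0(1)]]] by blast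
  then show "refines (Psi d (to_circle v)) (Psi d (to_circle u))" unfolding v0(3) u0(3) .
next
  assume "refines (Psi d (to_circle v)) (Psi d (to_circle u))"
  then have R: "orb (v s) j \<subseteq> orb (u s) j" if "s \<in> {0..<1}" "j \<in> {1..d}" for s j
    using refines_iff[OF d multI_Sym_all[OF FI_multI[OF v(1)]] multI_Sym_all[OF FI_multI[OF u(1)]]] that by blast
  have "tle d (v r) (u r)" if "r \<in> {0..1}" for r
  proof (cases "r = 1")
    case True then show ?thesis using v(2) u(2) by (simp add: tle_def)
  next
    case False
    then have r: "r \<in> {0..<1}" using that by simp
    show ?thesis
      by (rule nc_tle[OF multI_Sym[OF FI_multI[OF v(1)]] FI_nc_perm[OF d v r]
        multI_Sym[OF FI_multI[OF u(1)]] FI_nc_perm[OF d u r] R[OF r]])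
  qed
  then have "sub_le d v u" by (simp add: sub_le_def)
  moreover have "fequiv (long_cycle d) w w" for w by (simp add: fequiv_def)
  ultimately show "FS_le d (long_cycle d) (to_circle v) (to_circle u)"
    unfolding FS_le_def using v u by blast
qed

text \<open>Equal partitions refine each other, so all orbits agree; a noncrossing permutation is
  the cyclic successor on its orbits and is thus determined by them.\<close>

lemma Psi_inj:
  assumes v: "v \<in> FI d (long_cycle d)" "v 1 = id" and u: "u \<in> FI d (long_cycle d)" "u 1 = id"
    and eq: "Psi d (to_circle v) = Psi d (to_circle u)"
  shows "to_circle v = to_circle u"
proof -
  note S = multI_Sym_all[OF FI_multI[OF v(1)]] multI_Sym_all[OF FI_multI[OF u(1)]]
  have "refines P P" for P :: "complex set set" by (auto simp: refines_def)
  then have orbs: "orb (v s) j = orb (u s) j" if "s \<in> {0..<1}" "j \<in> {1..d}" for s j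
    using refines_iff[OF d S] refines_iff[OF d S(2,1)] eq that by (metis subset_antisym)
  have "v s = u s" if s: "s \<in> {0..<1}" for s
  proof
    fix j
    show "v s j = u s j"
    proof (cases "j \<in> {1..d}")
      case True
      show ?thesis
        using nc_permD(1)[OF FI_nc_perm[OF d v s] True] nc_permD(1)[OF FI_nc_perm[OF d u s] True] orbs[OF s True]
        by simp
    next
      case False
      have "v s permutes {1..d}" "u s permutes {1..d}" using S s by (auto simp: Sym_def)
      then show ?thesis using False by (metis permutes_not_in)
    qed
  qed
  moreover have "circ_param z \<in> {0..<1}" if "z \<in> sphere 0 1" for z
  proof -
    obtain t where "t \<in> {0..<1}" "z = circle_pt t" using \<open>z \<in> sphere 0 1\<close> by (rule circle_pt_surj)
    then show ?thesis using circ_param_circle_pt by simp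
  qed
  ultimately show ?thesis unfolding to_circle_def by (intro ext) simp
qed

text \<open>The only candidate runs cyclically through the labels of each block at every level.
  Crossing blocks would have meeting hulls, so its lift is noncrossing over any set of levels;
  finite support then follows from the length bound.\<close>

lemma Psi_surj:
  assumes P: "P \<in> NC_d d"
  shows "\<exists>u. u \<in> FI d (long_cycle d) \<and> u 1 = id \<and> Psi d (to_circle u) = P"
proof -
  have Pi: "P \<in> Pi_d d" and nc: "\<And>B C. B \<in> P \<Longrightarrow> C \<in> P \<Longrightarrow> B \<noteq> C \<Longrightarrow> convex hull B \<inter> convex hull C = {}"
    using P unfolding NC_d_def by blast+
  then have part: "is_partition P (sphere 0 1)" and pow: "\<And>B z w. B \<in> P \<Longrightarrow> z \<in> B \<Longrightarrow> w \<in> B \<Longrightarrow> z ^ d = w ^ d"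
    unfolding Pi_d_def by blast+
  note part' = part[unfolded is_partition_def]
  note p1 = part'[THEN conjunct1] and p2 = part'[THEN conjunct2, THEN conjunct1]
    and p3 = part'[THEN conjunct2, THEN conjunct2]
  have ne: "B \<noteq> {}" "B \<subseteq> sphere 0 1" if "B \<in> P" for B using p1 that by auto
  have cover: "\<exists>B\<in>P. z \<in> B" if "z \<in> sphere 0 1" for z using that unfolding p2[symmetric] by blast
  have uniq: "B = C" if "B \<in> P" "C \<in> P" "z \<in> B" "z \<in> C" for B C z using p3 that by blast
  \<comment> \<open>The labels at level \<open>s\<close> of the points in the block of the
    \<open>j\<close>-th preimage.\<close>
  define R where "R s j = {i \<in> {1..d}. \<exists>B\<in>P. circle_pt (pt d j s) \<in> B \<and> circle_pt (pt d i s) \<in> B}" for s j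
  have Rrefl: "j \<in> R s j" if "j \<in> {1..d}" for s j using that cover[OF circle_pt_sphere] unfolding R_def by blast
  have Req: "R s i = R s j" if "i \<in> R s j" for s i j
  proof -
    obtain B where B: "B \<in> P" "circle_pt (pt d j s) \<in> B" "circle_pt (pt d i s) \<in> B" using \<open>i \<in> R s j\<close> unfolding R_def by blast
    have "(\<exists>C\<in>P. circle_pt (pt d i s) \<in> C \<and> z \<in> C) \<longleftrightarrow> z \<in> B" "(\<exists>C\<in>P. circle_pt (pt d j s) \<in> C \<and> z \<in> C) \<longleftrightarrow> z \<in> B" for z
      using B uniq by blast+
    then show ?thesis unfolding R_def by simp
  qed
  have Rfin: "finite (R s j)" "R s j \<subseteq> {1..d}" for s j by (auto simp: R_def)
  define u where "u s j = (if s \<in> {0..<1} \<and> j \<in> {1..d} then nxt (R s j) j else j)" for s j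
  have uR: "u s i = nxt (R s j) i" if "s \<in> {0..<1}" "i \<in> R s j" for s i j
    using that Req[OF that(2)] Rfin(2)[of s j] by (auto simp: u_def)
  have uin: "u s i \<in> R s j" if "s \<in> {0..<1}" "i \<in> R s j" for s i j
    unfolding uR[OF that] by (rule nxt_in[OF Rfin(1) that(2)])
  have uout: "u s = id" if "s \<notin> {0..<1}" for s using that by (auto simp: u_def fun_eq_iff)
  have uS: "u s \<in> Sym d" for s
  proof (cases "s \<in> {0..<1}")
    case True
    have "inj_on (u s) {1..d}"
    proof (rule inj_onI)
      fix i j assume ij: "i \<in> {1..d}" "j \<in> {1..d}" "u s i = u s j"
      have "u s i \<in> R s i" "u s j \<in> R s j" using uin[OF True] Rrefl ij by blast+
      then have "R s i = R s j" using Req ij(3) by metis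
      then have i: "i \<in> R s j" using Rrefl[OF ij(1)] by metis
      show "i = j"
        by (rule nxt_inj[OF Rfin(1) i Rrefl[OF ij(2)]]) (use uR[OF True i] uR[OF True Rrefl[OF ij(2)]] ij(3) in simp)
    qed
    moreover have "u s ` {1..d} \<subseteq> {1..d}" using uin[OF True] Rrefl Rfin(2) by blast
    ultimately have "bij_betw (u s) {1..d} {1..d}"
      unfolding bij_betw_def using endo_inj_surj[OF finite_atLeastAtMost] by blast
    moreover have "u s j = j" if "j \<notin> {1..d}" for j using that by (simp only: u_def simp_thms if_False)
    ultimately show ?thesis unfolding Sym_def using bij_imp_permutes by blast
  next
    case False then show ?thesis using uout Sym_id by metis
  qed
  have uSall: "\<forall>s\<in>{0..<1}. u s \<in> Sym d" using uS by blast
  have orbu: "orb (u s) j = R s j" if s: "s \<in> {0..<1}" and j: "j \<in> {1..d}" for s j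
  proof -
    have "orb (u s) j = orb (nxt (R s j)) j"
      by (rule orb_cong[OF Rrefl[OF j]]) (use uin[OF s] uR[OF s] in blast)+
    then show ?thesis using orb_nxt[OF Rfin(1) Rrefl[OF j]] by simp
  qed
  let ?X = "lift d u"
  have orbX: "orb ?X (pt d j s) = (\<lambda>i. pt d i s) ` R s j" if "s \<in> {0..<1}" "j \<in> {1..d}" for s j
    unfolding orb_lift[of u, OF uS that(2,1)] orbu[OF that] ..
  have blk: "circle_pt ` orb ?X \<theta> = B" if \<theta>: "\<theta> \<in> {0..<1}" and B: "B \<in> P" "circle_pt \<theta> \<in> B" for \<theta> B
  proof -
    define s j where "s = par d \<theta>" and "j = lab d \<theta>"
    note p = pt_par_lab[OF d \<theta>, folded s_def j_def]
    have o: "orb ?X \<theta> = (\<lambda>i. pt d i s) ` R s j" using orbX[OF p(2,1)] unfolding p(3) .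
    show ?thesis
    proof
      show "circle_pt ` orb ?X \<theta> \<subseteq> B"
      proof
        fix z assume "z \<in> circle_pt ` orb ?X \<theta>"
        then obtain i where i: "i \<in> R s j" "z = circle_pt (pt d i s)" unfolding o by blast
        then obtain C where "C \<in> P" "circle_pt (pt d j s) \<in> C" "z \<in> C" unfolding R_def by blast
        then show "z \<in> B" using uniq B p(3) by metis
      qed
      show "B \<subseteq> circle_pt ` orb ?X \<theta>"
      proof
        fix z assume z: "z \<in> B"
        then have "z \<in> sphere 0 1" using ne(2)[OF B(1)] by blast
        then obtain \<phi> where \<phi>: "\<phi> \<in> {0..<1}" "z = circle_pt \<phi>" by (rule circle_pt_surj)
        note q = pt_par_lab[OF d \<phi>(1)]
        \<comment> \<open>Points of a block share their \<open>d\<close>-th power and therefore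
          their level, so the block is recovered from labels at one level.\<close>
        have "circle_pt (par d \<phi>) = z ^ d" using circle_pt_pt_power[OF q(1), of "par d \<phi>"] unfolding q(3) \<phi>(2) by simp
        also have "\<dots> = circle_pt \<theta> ^ d" by (rule pow[OF B(1) z B(2)])
        also have "\<dots> = circle_pt s" using circle_pt_pt_power[OF p(1), of s] unfolding p(3) .
        finally have "par d \<phi> = s" by (rule circle_pt_inj[OF q(2) p(2)])
        then have \<phi>pt: "\<phi> = pt d (lab d \<phi>) s" using q(3) by simp
        then have "lab d \<phi> \<in> R s j" unfolding R_def using q(1) B z \<phi>(2) p(3) by auto
        then show "z \<in> circle_pt ` orb ?X \<theta>" unfolding o \<phi>(2) using \<phi>pt by blast
      qed
    qed
  qed
  have PsiP: "Psi d (to_circle u) = P"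
    unfolding Psi_to_circle[OF d uSall]
  proof
    show "(\<lambda>\<theta>. circle_pt ` orb ?X \<theta>) ` {0..<1} \<subseteq> P"
    proof
      fix B assume "B \<in> (\<lambda>\<theta>. circle_pt ` orb ?X \<theta>) ` {0..<1}"
      then obtain \<theta> where \<theta>: "\<theta> \<in> {0..<1}" "B = circle_pt ` orb ?X \<theta>" by blast
      obtain C where C: "C \<in> P" "circle_pt \<theta> \<in> C" using cover[OF circle_pt_sphere] by blast
      show "B \<in> P" unfolding \<theta>(2) blk[OF \<theta>(1) C] by (rule C(1))
    qed
    show "P \<subseteq> (\<lambda>\<theta>. circle_pt ` orb ?X \<theta>) ` {0..<1}"
    proof
      fix B assume B: "B \<in> P"
      then obtain z where z: "z \<in> B" "z \<in> sphere 0 1" using ne by blast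
      obtain \<theta> where \<theta>: "\<theta> \<in> {0..<1}" "z = circle_pt \<theta>" using z(2) by (rule circle_pt_surj)
      have "B = circle_pt ` orb ?X \<theta>" using blk[OF \<theta>(1) B] z(1) \<theta>(2) by simp
      then show "B \<in> (\<lambda>\<theta>. circle_pt ` orb ?X \<theta>) ` {0..<1}" using \<theta>(1) by blast
    qed
  qed
  note f = orb_lift_facts[OF d uSall]
  have cross: "q \<in> orb ?X p"
    if h: "p \<in> {0..<1}" "q \<in> {0..<1}" "s \<in> {0..<1}" "p < q" "q < r" "r < s" "r \<in> orb ?X p" "s \<in> orb ?X q" for p q r s
  proof (rule ccontr)
    assume n: "q \<notin> orb ?X p"
    have BC: "circle_pt ` orb ?X p \<in> P" "circle_pt ` orb ?X q \<in> P"
      using PsiP h(1,2) unfolding Psi_to_circle[OF d uSall] by blast+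
    have "circle_pt ` orb ?X p \<noteq> circle_pt ` orb ?X q"
    proof
      assume "circle_pt ` orb ?X p = circle_pt ` orb ?X q"
      then have "circle_pt q \<in> circle_pt ` orb ?X p" using orb_refl[of q ?X] by blast
      then show False using circle_pt_image_mem[OF f(2)[OF h(1)] h(2)] n by blast
    qed
    then have "convex hull (circle_pt ` orb ?X p) \<inter> convex hull (circle_pt ` orb ?X q) = {}" by (rule nc[OF BC])
    moreover have "convex hull (circle_pt ` orb ?X p) \<inter> convex hull (circle_pt ` orb ?X q) \<noteq> {}"
      by (rule hulls_meet[of p q r s]) (use h orb_refl[of p ?X] orb_refl[of q ?X] in auto)
    ultimately show False by blast
  qed
  \<comment> \<open>The set \<open>S\<close> is arbitrary because this is applied first to
    hypothetical levels refuting infinite support, and only then to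
    \<open>param_list u\<close>.\<close>
  have ncL: "nc_perm (pts d S) ?X" if S: "S \<subseteq> {0..<1}" for S
    unfolding nc_perm_def
  proof (intro conjI ballI impI)
    fix x assume "x \<in> pts d S"
    then obtain j s where js: "j \<in> {1..d}" "s \<in> {0..<1}" "x = pt d j s" using S unfolding pts_def by blast
    have "nxt (orb ?X x) x = pt d (nxt (R s j) j) s"
      unfolding js(3) orbX[OF js(2,1)]
      by (rule nxt_image[OF Rfin(1) Rrefl[OF js(1)]]) (use pt_less_iff[OF d js(2) js(2)] in simp)
    also have "\<dots> = ?X x"
      unfolding js(3) lift_pt[OF js(1,2)] uR[OF js(2) Rrefl[OF js(1)]] ..
    finally show "?X x = nxt (orb ?X x) x" by simp
  next
    fix p q r s assume h: "p \<in> pts d S" "q \<in> pts d S" "r \<in> pts d S" "s \<in> pts d S"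
      and o: "p < q \<and> q < r \<and> r < s \<and> r \<in> orb ?X p \<and> s \<in> orb ?X q"
    have "pts d S \<subseteq> {0..<1}" using S pt_range unfolding pts_def by blast
    then show "q \<in> orb ?X p" using cross[of p q s r] h o by blast
  qed
  \<comment> \<open>Among infinitely many nontrivial levels choose \<open>d\<close>. Each
    contributes length at least 1, so the sum is at least \<open>d\<close>, whereas the equation for
    a noncrossing lift limits it to \<open>d - 1\<close>.\<close>
  have finsupp: "finite {s. u s \<noteq> id}"
  proof (rule ccontr)
    assume "infinite {s. u s \<noteq> id}"
    then obtain F where F: "finite F" "card F = d" "F \<subseteq> {s. u s \<noteq> id}"
      using infinite_arbitrarily_large by blast
    have F01: "F \<subseteq> {0..<1}" using F(3) uout by blast
    define L where "L = sorted_list_of_set F"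
    have L: "set L = F" "sorted_wrt (<) L" using F(1) by (simp_all add: L_def)
    have L01: "set L \<subseteq> {0..<1}" unfolding L(1) by (rule F01)
    have Lne: "L \<noteq> []" using L(1) F(2) d by auto
    have "(\<Sum>s\<leftarrow>L. tlen d (u s)) + tlen d (inv (foldr (\<circ>) (map u L) id) \<circ> long_cycle d) + 1 = d"
      by (rule iffD1[OF nc_perm_lift_iff[of d L u, OF d Lne L(2) L01 uS] ncL[OF L01]])
    moreover have "(\<Sum>s\<leftarrow>L. tlen d (u s)) = (\<Sum>s\<in>F. tlen d (u s))"
      using F(1) by (simp add: L_def sum_list_distinct_conv_sum_set)
    moreover have "(\<Sum>s\<in>F. 1) \<le> (\<Sum>s\<in>F. tlen d (u s))"
    proof (rule sum_mono)
      fix s assume "s \<in> F"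
      then have "u s \<noteq> id" using F(3) by blast
      then show "1 \<le> tlen d (u s)" using tlen_eq_0[OF uS, of s] by (cases "tlen d (u s)") auto
    qed
    ultimately show False using F(2) by simp
  qed
  have um: "u \<in> multI d" unfolding multI_def using uS uout finsupp by auto
  have u1: "u 1 = id" by (rule uout) simp
  have "u \<in> FI d (long_cycle d)" using FI_iff[OF d um u1] ncL[OF param_list(3)[OF um]] by blast
  then show ?thesis using u1 PsiP by blast
qed

end

theorem theorem6p11:
  fixes d :: nat
  assumes "d \<ge> 1"
  defines "\<delta> \<equiv> long_cycle d"
  shows "bij_betw (Psi d) (FS d \<delta>) (NC_d d) \<and>
         (\<forall>m \<in> FS d \<delta>. \<forall>m' \<in> FS d \<delta>. FS_le d \<delta> m m' \<longleftrightarrow> refines (Psi d m) (Psi d m'))"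
proof -
  note d = assms(1)
  have FS: "\<exists>u. u \<in> FI d (long_cycle d) \<and> u 1 = id \<and> m = to_circle u" if "m \<in> FS d \<delta>" for m
    using that unfolding FS_def \<delta>_def by blast
  have "inj_on (Psi d) (FS d \<delta>)"
  proof (rule inj_onI)
    fix m m' assume "m \<in> FS d \<delta>" "m' \<in> FS d \<delta>" "Psi d m = Psi d m'"
    then show "m = m'" using FS[of m] FS[of m'] Psi_inj[OF d] by blast
  qed
  moreover have "Psi d ` FS d \<delta> = NC_d d"
  proof
    show "Psi d ` FS d \<delta> \<subseteq> NC_d d" using FS Psi_NC[OF d] by blast
    show "NC_d d \<subseteq> Psi d ` FS d \<delta>"
    proof
      fix P assume "P \<in> NC_d d"
      then obtain u where "u \<in> FI d (long_cycle d)" "u 1 = id" "Psi d (to_circle u) = P"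
        using Psi_surj[OF d] by blast
      then show "P \<in> Psi d ` FS d \<delta>" unfolding FS_def \<delta>_def by blast
    qed
  qed
  moreover have "FS_le d \<delta> m m' \<longleftrightarrow> refines (Psi d m) (Psi d m')" if mm: "m \<in> FS d \<delta>" "m' \<in> FS d \<delta>" for m m'
  proof -
    obtain v where v: "v \<in> FI d (long_cycle d)" "v 1 = id" "m = to_circle v" using FS[OF mm(1)] by blast
    obtain u where u: "u \<in> FI d (long_cycle d)" "u 1 = id" "m' = to_circle u" using FS[OF mm(2)] by blast
    show ?thesis unfolding v(3) u(3) \<delta>_def by (rule FS_le_iff[OF d v(1,2) u(1,2)])
  qed
  ultimately show ?thesis unfolding bij_betw_def by blast
qed

end
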